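(* There exist universal constants $c,C,\varepsilon_0>0$ such that for all integers $1\le s\le n$, all $\sigma>0$, all $0<\varepsilon\le\varepsilon_0$ and all $0<\delta\le1/4$, $$\frac{c\,\sigma^2\bigl(ns^2+s\log(1/\delta)\bigr)}{\varepsilon^2}\ \le\ m^*(\mathcal S_{n,s},\varepsilon,\delta)\ \le\ \frac{C(\sigma^2+1)\bigl(ns^2+s\log(1/\delta)\bigr)}{\varepsilon^2}.$$ Thus, if $\sigma$ is bounded below by a positive universal constant and $s\le n$, then $m^*(\mathcal S_{n,s},\varepsilon,\delta)=\Theta\bigl((\sigma/\varepsilon)^2(ns^2+s\log(1/\delta))\bigr)$.
   Context: Walsh functions: for $S\subseteq[n]$, $\chi_S(x)=\prod_{i\in S}x_i$ on $\{-1,1\}^n$ ($\chi_\emptyset=1$). Every $f:\{-1,1\}^n\to\mathbb R$ has a unique expansion $f=\sum_{S\subseteq[n]}\theta_S\chi_S$. $\|f\|_{L_\infty}=\max_{x\in\{-1,1\}^n}|f(x)|$. $\mathcal S_{n,s}$ is the set of $f=\sum_{S\subseteq[n]}\theta_S\chi_S$ with at most $s$ nonzero coefficients $\theta_S$ and $\|f\|_{L_\infty}\le1$. Adaptive noisy query model: at each round $t=1,\dots,m$, the learner picks $X_t\in\{-1,1\}^n$, possibly depending (possibly in a randomized way) on the previous pairs $(X_1,Y_1),\dots,(X_{t-1},Y_{t-1})$, and observes $Y_t=f(X_t)+\xi_t$. The noises $\xi_t$ are independent (and independent of the learner's internal randomness), centered and $\sigma$-subgaussian: $\mathbb E[\xi_t]=0$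 and $\mathbb P(|\xi_t|\ge u)\le 2\exp(-u^2/(2\sigma^2))$ for all $u\ge0$. After $m$ queries it outputs $\widehat f:\{-1,1\}^n\to\mathbb R$ based on all the observations. For a class $\mathcal F$, $m^*(\mathcal F,\varepsilon,\delta)$ (for noise level $\sigma$) is the infimum of the integers $m\ge0$ for which there is an $m$-query adaptive learner such that $\mathbb P_f(\|f-\widehat f\|_{L_\infty}>\varepsilon)\le\delta$ for every $f\in\mathcal F$ and every choice of independent centered $\sigma$-subgaussian noises, where $\mathbb P_f$ is the probability when the data are generated from $f$. *)

theory Defs
  imports "HOL-Probability.Probability" "HOL-Library.Extended_Nat"
begin

text \<open>Points of the cube, and real-valued functions on it, are extensional functions, i.e.
  elements of \<^term>\<open>PiE\<close> that are undefined outside their domain.\<close>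

definition cube :: "nat \<Rightarrow> (nat \<Rightarrow> real) set" where
  "cube n = {1..n} \<rightarrow>\<^sub>E {-1, 1}"

definition walsh :: "nat set \<Rightarrow> (nat \<Rightarrow> real) \<Rightarrow> real" where
  "walsh S x = (\<Prod>i\<in>S. x i)"

definition linf_norm :: "nat \<Rightarrow> ((nat \<Rightarrow> real) \<Rightarrow> real) \<Rightarrow> real" where
  "linf_norm n f = Max ((\<lambda>x. \<bar>f x\<bar>) ` cube n)"

definition sparse_class :: "nat \<Rightarrow> nat \<Rightarrow> ((nat \<Rightarrow> real) \<Rightarrow> real) set" where
  "sparse_class n s =
     {f. \<exists>\<theta> :: nat set \<Rightarrow> real.
           f = (\<lambda>x\<in>cube n. \<Sum>S\<in>Pow {1..n}. \<theta> S * walsh S x) \<and>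
           card {S \<in> Pow {1..n}. \<theta> S \<noteq> 0} \<le> s \<and>
           linf_norm n f \<le> 1}"

text \<open>A centered \<open>\<sigma>\<close>-subgaussian law on the real line.\<close>

definition subgaussian :: "real \<Rightarrow> real measure \<Rightarrow> bool" where
  "subgaussian \<sigma> N \<longleftrightarrow>
     prob_space N \<and> sets N = sets borel \<and>
     integrable N (\<lambda>x. x) \<and> (\<integral>x. x \<partial>N) = 0 \<and>
     (\<forall>u\<ge>0. measure N {x. \<bar>x\<bar> \<ge> u} \<le> 2 * exp (- (u\<^sup>2 / (2 * \<sigma>\<^sup>2))))"

text \<open>A history of \<open>t\<close> rounds is the family of pairs \<open>(X\<^sub>i, Y\<^sub>i)\<close>; rounds are numbered from \<open>0\<close>.\<close>

type_synonym history = "nat \<Rightarrow> (nat \<Rightarrow> real) \<times> real"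

definition history_space :: "nat \<Rightarrow> nat \<Rightarrow> history measure" where
  "history_space n t = PiM {..<t} (\<lambda>_. count_space (cube n) \<Otimes>\<^sub>M borel)"

text \<open>The internal randomness of a learner is a seed \<open>u\<close> drawn from an arbitrary probability
  space \<open>R\<close> before the first round; it is available to all queries and to the output.  Taking
  the seeds in \<^typ>\<open>real\<close> is no restriction: the queries and the output take values in
  standard Borel spaces, so any randomized choice of them can be realized from a uniform
  seed.  \<open>q t u h\<close> is the query made in round \<open>t\<close> after history \<open>h\<close>, and \<open>g u h\<close> is the final
  estimate.\<close>

definition learner ::
  "nat \<Rightarrow> nat \<Rightarrow> real measure \<Rightarrow> (nat \<Rightarrow> real \<Rightarrow> history \<Rightarrow> nat \<Rightarrow> real) \<Rightarrow>
   (real \<Rightarrow> history \<Rightarrow> (nat \<Rightarrow> real) \<Rightarrow> real) \<Rightarrow> bool" where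
  "learner n m R q g \<longleftrightarrow>
     prob_space R \<and>
     (\<forall>t<m. (\<lambda>(u, h). q t u h) \<in> R \<Otimes>\<^sub>M history_space n t \<rightarrow>\<^sub>M count_space (cube n)) \<and>
     (\<lambda>(u, h). g u h) \<in> R \<Otimes>\<^sub>M history_space n m \<rightarrow>\<^sub>M PiM (cube n) (\<lambda>_. borel)"

primrec transcript ::
  "(nat \<Rightarrow> real \<Rightarrow> history \<Rightarrow> nat \<Rightarrow> real) \<Rightarrow> ((nat \<Rightarrow> real) \<Rightarrow> real) \<Rightarrow>
   real \<Rightarrow> (nat \<Rightarrow> real) \<Rightarrow> nat \<Rightarrow> history" where
  "transcript q f u \<xi> 0 = (\<lambda>_. undefined)"
| "transcript q f u \<xi> (Suc t) =
     (let h = transcript q f u \<xi> t; x = q t u h in h(t := (x, f x + \<xi> t)))"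

text \<open>Independence of the noises, from each other and from the seed, means that the joint law of
  \<open>(u, \<xi>)\<close> is the product measure; \<open>N t\<close> is the law of \<open>\<xi> t\<close> and may vary with \<open>t\<close>.\<close>

definition data_law :: "nat \<Rightarrow> real measure \<Rightarrow> (nat \<Rightarrow> real measure) \<Rightarrow> (real \<times> (nat \<Rightarrow> real)) measure"
  where "data_law m R N = R \<Otimes>\<^sub>M PiM {..<m} N"

definition failure_event ::
  "nat \<Rightarrow> nat \<Rightarrow> real measure \<Rightarrow> (nat \<Rightarrow> real \<Rightarrow> history \<Rightarrow> nat \<Rightarrow> real) \<Rightarrow>
   (real \<Rightarrow> history \<Rightarrow> (nat \<Rightarrow> real) \<Rightarrow> real) \<Rightarrow> (nat \<Rightarrow> real measure) \<Rightarrow>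
   ((nat \<Rightarrow> real) \<Rightarrow> real) \<Rightarrow> real \<Rightarrow> (real \<times> (nat \<Rightarrow> real)) set" where
  "failure_event n m R q g N f \<epsilon> =
     {(u, \<xi>) \<in> space (data_law m R N).
        linf_norm n (\<lambda>x. f x - g u (transcript q f u \<xi> m) x) > \<epsilon>}"

text \<open>The failure event is measurable, so its measure below is its actual probability.\<close>

lemma finite_cube: "finite (cube n)" and cube_nonempty: "cube n \<noteq> {}"
  by (auto simp: cube_def PiE_eq_empty_iff intro: finite_PiE)

lemma transcript_measurable:
  assumes L: "learner n m R q g" and N: "\<And>t. sets (N t) = sets borel" and "t \<le> m"
  shows "(\<lambda>(u, \<xi>). transcript q f u \<xi> t) \<in> data_law m R N \<rightarrow>\<^sub>M history_space n t"
  using \<open>t \<le> m\<close>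
proof (induction t)
  case 0
  then show ?case
    by (auto simp: history_space_def case_prod_beta' space_PiM intro!: measurable_const)
next
  case (Suc t)
  let ?D = "data_law m R N" and ?C = "count_space (cube n) \<Otimes>\<^sub>M (borel :: real measure)"
  have IH: "(\<lambda>w. transcript q f (fst w) (snd w) t) \<in> ?D \<rightarrow>\<^sub>M history_space n t"
    using Suc by (simp add: case_prod_beta')
  have U: "fst \<in> ?D \<rightarrow>\<^sub>M R"
    unfolding data_law_def by (rule measurable_fst)
  have "(\<lambda>(u, h). q t u h) \<in> R \<Otimes>\<^sub>M history_space n t \<rightarrow>\<^sub>M count_space (cube n)"
    using L Suc by (simp add: learner_def)
  from measurable_compose[OF measurable_Pair[OF U IH] this]
  have X: "(\<lambda>w. q t (fst w) (transcript q f (fst w) (snd w) t)) \<in> ?D \<rightarrow>\<^sub>M count_space (cube n)"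
    by simp
  have "(\<lambda>w. snd w t) \<in> ?D \<rightarrow>\<^sub>M N t"
    unfolding data_law_def using Suc
    by (intro measurable_compose[OF measurable_snd] measurable_component_singleton) auto
  then have Z: "(\<lambda>w. snd w t) \<in> borel_measurable ?D"
    using N measurable_cong_sets by blast
  have fX: "(\<lambda>w. f (q t (fst w) (transcript q f (fst w) (snd w) t))) \<in> borel_measurable ?D"
    by (rule measurable_compose[OF X]) simp
  have P: "(\<lambda>w. (q t (fst w) (transcript q f (fst w) (snd w) t),
      f (q t (fst w) (transcript q f (fst w) (snd w) t)) + snd w t)) \<in> ?D \<rightarrow>\<^sub>M ?C"
    by (intro measurable_Pair X borel_measurable_add fX Z)
  have "(\<lambda>w. (transcript q f (fst w) (snd w) t)(t :=
      (q t (fst w) (transcript q f (fst w) (snd w) t),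
       f (q t (fst w) (transcript q f (fst w) (snd w) t)) + snd w t)))
     \<in> ?D \<rightarrow>\<^sub>M PiM (insert t {..<t}) (\<lambda>_. ?C)"
    by (rule measurable_fun_upd[OF _ IH[unfolded history_space_def] P]) auto
  then show ?case
    by (simp add: history_space_def case_prod_beta' Let_def lessThan_Suc fun_upd_def)
qed

lemma failure_event_measurable:
  assumes L: "learner n m R q g" and N: "\<And>t. sets (N t) = sets borel"
  shows "failure_event n m R q g N f \<epsilon> \<in> sets (data_law m R N)"
proof -
  let ?D = "data_law m R N"
  have T: "(\<lambda>w. transcript q f (fst w) (snd w) m) \<in> ?D \<rightarrow>\<^sub>M history_space n m"
    using transcript_measurable[OF assms order_refl] by (simp add: case_prod_beta')
  have U: "fst \<in> ?D \<rightarrow>\<^sub>M R"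
    unfolding data_law_def by (rule measurable_fst)
  have "(\<lambda>(u, h). g u h) \<in> R \<Otimes>\<^sub>M history_space n m \<rightarrow>\<^sub>M PiM (cube n) (\<lambda>_. borel)"
    using L by (simp add: learner_def)
  from measurable_compose[OF measurable_Pair[OF U T] this]
  have G: "(\<lambda>w. g (fst w) (transcript q f (fst w) (snd w) m)) \<in> ?D \<rightarrow>\<^sub>M PiM (cube n) (\<lambda>_. borel)"
    by simp
  have Gx: "(\<lambda>w. g (fst w) (transcript q f (fst w) (snd w) m) x) \<in> borel_measurable ?D"
    if "x \<in> cube n" for x
    by (rule measurable_compose[OF G measurable_component_singleton[OF that]])
  have *: "failure_event n m R q g N f \<epsilon> =
     (\<Union>x\<in>cube n. {w \<in> space ?D. \<epsilon> < \<bar>f x - g (fst w) (transcript q f (fst w) (snd w) m) x\<bar>})"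
    unfolding failure_event_def linf_norm_def
    using finite_cube cube_nonempty by (auto simp: Max_gr_iff)
  show ?thesis
    unfolding * using finite_cube
  proof (intro sets.finite_UN)
    fix x assume "x \<in> cube n"
    note [measurable] = Gx[OF this]
    show "{w \<in> space ?D. \<epsilon> < \<bar>f x - g (fst w) (transcript q f (fst w) (snd w) m) x\<bar>} \<in> sets ?D"
      by measurable
  qed
qed

definition learnable ::
  "nat \<Rightarrow> real \<Rightarrow> ((nat \<Rightarrow> real) \<Rightarrow> real) set \<Rightarrow> real \<Rightarrow> real \<Rightarrow> nat \<Rightarrow> bool" where
  "learnable n \<sigma> F \<epsilon> \<delta> m \<longleftrightarrow>
     (\<exists>R q g. learner n m R q g \<and>
        (\<forall>f\<in>F. \<forall>N. (\<forall>t. subgaussian \<sigma> (N t)) \<longrightarrow>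
           measure (data_law m R N) (failure_event n m R q g N f \<epsilon>) \<le> \<delta>))"

text \<open>The infimum is taken in \<^typ>\<open>enat\<close>, so that it is \<open>\<infinity>\<close> if no number of queries suffices.\<close>

definition query_complexity ::
  "nat \<Rightarrow> real \<Rightarrow> ((nat \<Rightarrow> real) \<Rightarrow> real) set \<Rightarrow> real \<Rightarrow> real \<Rightarrow> enat" where
  "query_complexity n \<sigma> F \<epsilon> \<delta> = Inf (enat ` {m. learnable n \<sigma> F \<epsilon> \<delta> m})"

end

theory Submission
  imports Defs
begin

text \<open>Upper bound. A random design of at least \<open>512 n s\<^sup>2\<close> points has all nonempty Walsh averages at
  most \<open>1 / (8 s)\<close>, which makes it an approximate isometry on \<open>2 s\<close>-sparse polynomials. Least squares
  over a fine net of sparse coefficient vectors then has \<open>L\<^sub>2\<close> error controlled by the noise on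
  \<open>2 s\<close> Walsh coefficients, uniformly over their choice; the sup norm costs a further factor \<open>sqrt (2 s)\<close>.

  Lower bound. The term \<open>s ln (1 / \<delta>)\<close> comes from testing \<open>0\<close> against bumps on about \<open>s\<close> disjoint
  subcubes. For the term \<open>n s\<^sup>2\<close> take a sum of \<open>k\<close> terms \<open>x\<^sub>j \<chi>\<^bsub>T\<^sub>j\<^esub>\<close> of size \<open>4 \<epsilon> / k\<close>, where \<open>k\<close> is about \<open>s / 2\<close>
  and the \<open>T\<^sub>j\<close> are random sets of coordinates beyond \<open>k\<close>: an accurate estimate reveals most of the \<open>T\<^sub>j\<close>,
  while a query carries little information about a single \<open>T\<^sub>j\<close> even given all the others.\<close>

section \<open>Walsh polynomials and low-coherence designs\<close>

text \<open>Origin of the rate: the difference of two \<open>s\<close>-sparse polynomials lives on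
  at most \<open>2 * s\<close> sets, chosen in at most \<open>2 ^ (2 * n * s)\<close> ways, so the
  squared coefficient error is of order
  \<open>\<sigma>\<^sup>2 * (n * s + ln (1 / \<delta>)) / m\<close>. Passing to the sup norm
  multiplies it by \<open>2 * s\<close>. The design asks for order \<open>n * s\<^sup>2\<close>
  points whatever the noise, which is paid by the \<open>+ 1\<close> in
  \<open>\<sigma>\<^sup>2 + 1\<close>.

  The obstacle below is adaptivity. The hard functions reach the value
  \<open>4 * \<epsilon>\<close>, and a learner may steer its queries towards such points; bounding
  the information of a query about the whole tuple by that amplitude would give only
  \<open>n * k\<close>. Revealing all sets but one replaces the amplitude by
  \<open>4 * \<epsilon> / k\<close>, the same at every point, so steering gains nothing, while order
  \<open>n\<close> bits of the hidden set remain to be found: this gives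
  \<open>n * k\<^sup>2\<close>. The factors \<open>x\<^sub>j\<close> are free signs that make the
  errors of all wrongly decoded sets add up in the sup norm.\<close>

lemma linf_norm_le_iff: "linf_norm n f \<le> c \<longleftrightarrow> (\<forall>x\<in>cube n. \<bar>f x\<bar> \<le> c)"
  unfolding linf_norm_def using finite_cube cube_nonempty by (subst Max_le_iff) auto

definition wpoly :: "nat \<Rightarrow> (nat set \<Rightarrow> real) \<Rightarrow> (nat \<Rightarrow> real) \<Rightarrow> real" where
  "wpoly n \<theta> x = (\<Sum>S\<in>Pow {1..n}. \<theta> S * walsh S x)"

lemma walsh_empty [simp]: "walsh {} x = 1"
  by (simp add: walsh_def)

lemma walsh_abs:
  assumes "x \<in> cube n" "S \<subseteq> {1..n}"
  shows "\<bar>walsh S x\<bar> = 1"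
proof -
  have "\<bar>x i\<bar> = 1" if "i \<in> S" for i
    using assms that unfolding cube_def PiE_iff by fastforce
  then show ?thesis
    unfolding walsh_def abs_prod by simp
qed

lemma walsh_pm:
  assumes "x \<in> cube n" "S \<subseteq> {1..n}"
  shows "walsh S x = 1 \<or> walsh S x = -1"
  using walsh_abs[OF assms] by linarith

lemma walsh_square:
  assumes "x \<in> cube n" "S \<subseteq> {1..n}"
  shows "(walsh S x)\<^sup>2 = 1"
  using walsh_pm[OF assms] by auto

lemma walsh_mult:
  assumes x: "x \<in> cube n" and S: "S \<subseteq> {1..n}" and T: "T \<subseteq> {1..n}"
  shows "walsh S x * walsh T x = walsh (sym_diff S T) x"
proof -
  have fin: "finite S" "finite T" using S T by (auto intro: finite_subset)
  have 1: "walsh S x = walsh (S - T) x * walsh (S \<inter> T) x"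
    unfolding walsh_def using fin by (metis prod.Int_Diff mult.commute)
  have 2: "walsh T x = walsh (T - S) x * walsh (S \<inter> T) x"
    unfolding walsh_def using fin by (metis prod.Int_Diff mult.commute Int_commute)
  have 3: "walsh (sym_diff S T) x = walsh (S - T) x * walsh (T - S) x"
    unfolding walsh_def using fin by (intro prod.union_disjoint) auto
  have "(walsh (S \<inter> T) x)\<^sup>2 = 1" using walsh_square[OF x] S by blast
  then show ?thesis
    unfolding 1 2 3 power2_eq_square
    by (metis (no_types, opaque_lifting) mult.assoc mult.commute mult.right_neutral)
qed

lemma card_cube: "card (cube n) = 2 ^ n"
  unfolding cube_def by (subst card_PiE) (auto simp: numeral_2_eq_2)

lemma sum_walsh:
  assumes "S \<subseteq> {1..n}" "S \<noteq> {}"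
  shows "(\<Sum>x\<in>cube n. walsh S x) = 0"
proof -
  have "walsh S x = (\<Prod>i\<in>{1..n}. if i \<in> S then x i else 1)" for x
    unfolding walsh_def using assms by (subst prod.inter_restrict[symmetric]) (auto simp: Int_absorb1)
  then have "(\<Sum>x\<in>cube n. walsh S x) = (\<Prod>i\<in>{1..n}. \<Sum>v\<in>{-1,1}. if i \<in> S then v else 1)"
    unfolding cube_def by (subst prod_sum_PiE) auto
  also have "\<dots> = 0"
    using assms by (intro prod_zero) auto
  finally show ?thesis .
qed

section \<open>Existence of designs with small Walsh averages\<close>

lemma exp_le_quadratic:
  fixes x :: real
  assumes "\<bar>x\<bar> \<le> 1"
  shows "exp x \<le> 1 + x + x\<^sup>2"
proof (cases "x \<ge> 0")
  case True
  then show ?thesis using assms by (intro exp_bound) auto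
next
  case False
  define y where "y = - x"
  have y: "0 \<le> y" "y \<le> 1" using False assms by (auto simp: y_def)
  have a: "1 + y + y\<^sup>2/2 \<le> exp y" using y exp_lower_Taylor_quadratic by auto
  have "1 \<le> (1 - y + y\<^sup>2) * (1 + y + y\<^sup>2/2)"
  proof -
    have "(1 - y + y\<^sup>2) * (1 + y + y\<^sup>2/2) - 1 = y\<^sup>2 * (1/2 + y/2 + y\<^sup>2/2)"
      by (simp add: field_simps power2_eq_square)
    moreover have "\<dots> \<ge> 0" using y by simp
    ultimately show ?thesis by linarith
  qed
  also have "\<dots> \<le> (1 - y + y\<^sup>2) * exp y"
    using a y by (intro mult_left_mono) (auto intro: add_nonneg_nonneg)
  finally have "exp (- y) \<le> 1 - y + y\<^sup>2"
    by (simp add: exp_minus field_simps)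
  then show ?thesis by (simp add: y_def)
qed

text \<open>Products of Walsh functions are Walsh functions, so these sums are the off-diagonal
  entries of the Gram matrix on the design. The level \<open>1 / (8 * s)\<close> makes every
  off-diagonal block on \<open>2 * s\<close> sets contribute at most a quarter of the diagonal.
  Points beyond \<open>m\<close> are also kept in the cube, so that \<open>X\<close> can serve as a
  query rule for all rounds.\<close>

definition low_coherence :: "nat \<Rightarrow> nat \<Rightarrow> nat \<Rightarrow> (nat \<Rightarrow> nat \<Rightarrow> real) \<Rightarrow> bool" where
  "low_coherence n s m X \<longleftrightarrow> (\<forall>t. X t \<in> cube n) \<and>
     (\<forall>S. S \<subseteq> {1..n} \<longrightarrow> S \<noteq> {} \<longrightarrow> \<bar>\<Sum>t<m. walsh S (X t)\<bar> \<le> real m / (8 * real s))"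

text \<open>Probabilistic method by counting: \<open>D\<close> is the set of all designs, and
  exponential moments summed over both signs and all nonempty sets have a small average over
  \<open>D\<close>, so some design has them all small.\<close>

lemma low_coherence_design:
  assumes n: "n \<ge> 1" and s: "s \<ge> 1" and m: "real m \<ge> 512 * real n * (real s)\<^sup>2"
  obtains X where "low_coherence n s m X"
proof -
  \<comment> \<open>The moments will give
    \<open>l * \<bar>z\<bar> \<le> 2 * n + m * l\<^sup>2\<close> for a Walsh sum \<open>z\<close>.
    With this \<open>l\<close> the hypothesis on \<open>m\<close> says
    \<open>2 * n \<le> m * l\<^sup>2\<close>, and the resulting bound \<open>2 * m * l\<close> is
    exactly \<open>m / (8 * s)\<close>.\<close>
  define l where "l = 1 / (16 * real s)"
  have l: "0 < l" "l \<le> 1" using s by (auto simp: l_def field_simps)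
  define D where "D = {..<m} \<rightarrow>\<^sub>E cube n"
  define NS where "NS = Pow {1..n} - {{}}"
  have avg: "(\<Sum>x\<in>cube n. exp (a * walsh S x)) \<le> 2 ^ n * exp (l\<^sup>2)" if "S \<in> NS" "\<bar>a\<bar> = l" for S a
  proof -
    have S: "S \<subseteq> {1..n}" "S \<noteq> {}" using that by (auto simp: NS_def)
    have "(\<Sum>x\<in>cube n. exp (a * walsh S x)) \<le> (\<Sum>x\<in>cube n. 1 + a * walsh S x + l\<^sup>2)"
    proof (intro sum_mono)
      fix x assume x: "x \<in> cube n"
      have e: "\<bar>a * walsh S x\<bar> = l" using walsh_abs[OF x S(1)] that by (simp add: abs_mult)
      have "(a * walsh S x)\<^sup>2 = l\<^sup>2" using e by (metis power2_abs)
      then show "exp (a * walsh S x) \<le> 1 + a * walsh S x + l\<^sup>2"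
        using exp_le_quadratic[of "a * walsh S x"] e l by simp
    qed
    also have "\<dots> = 2 ^ n * (1 + l\<^sup>2)"
      using sum_walsh[OF S] by (simp add: sum.distrib card_cube sum_distrib_left[symmetric] field_simps)
    also have "\<dots> \<le> 2 ^ n * exp (l\<^sup>2)" by (intro mult_left_mono) auto
    finally show ?thesis .
  qed
  have pow: "(\<Sum>X\<in>D. exp (a * (\<Sum>t<m. walsh S (X t)))) \<le> (2 ^ n * exp (l\<^sup>2)) ^ m"
    if "S \<in> NS" "\<bar>a\<bar> = l" for S a
  proof -
    have "(\<Sum>X\<in>D. exp (a * (\<Sum>t<m. walsh S (X t)))) = (\<Sum>X\<in>D. \<Prod>t<m. exp (a * walsh S (X t)))"
      by (simp add: exp_sum sum_distrib_left)
    also have "\<dots> = (\<Prod>t<m. \<Sum>x\<in>cube n. exp (a * walsh S x))"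
      unfolding D_def by (rule prod_sum_PiE[symmetric]) (auto simp: finite_cube)
    also have "\<dots> \<le> (2 ^ n * exp (l\<^sup>2)) ^ m"
      using avg[OF that] by (auto intro!: power_mono sum_nonneg)
    finally show ?thesis .
  qed
  define \<Phi> where "\<Phi> X = (\<Sum>S\<in>NS. exp (l * (\<Sum>t<m. walsh S (X t))) + exp (- l * (\<Sum>t<m. walsh S (X t))))"
    for X :: "nat \<Rightarrow> nat \<Rightarrow> real"
  have finNS: "finite NS" by (simp add: NS_def)
  have cardNS: "real (card NS) \<le> 2 ^ n"
  proof -
    have "card NS \<le> card (Pow {1..n})" unfolding NS_def by (intro card_mono) auto
    then show ?thesis by (simp add: card_Pow)
  qed
  have finD: "finite D" unfolding D_def by (intro finite_PiE) (auto simp: finite_cube)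
  have cardD: "real (card D) = (2 ^ n) ^ m"
    unfolding D_def by (subst card_PiE) (auto simp: card_cube)
  have "(\<Sum>X\<in>D. \<Phi> X) = (\<Sum>S\<in>NS. (\<Sum>X\<in>D. exp (l * (\<Sum>t<m. walsh S (X t)))) + (\<Sum>X\<in>D. exp (- l * (\<Sum>t<m. walsh S (X t)))))"
    unfolding \<Phi>_def by (subst sum.swap) (simp add: sum.distrib)
  also have "\<dots> \<le> (\<Sum>S\<in>NS. (2 ^ n * exp (l\<^sup>2)) ^ m + (2 ^ n * exp (l\<^sup>2)) ^ m)"
    using l by (intro sum_mono add_mono pow) auto
  also have "\<dots> = real (card NS) * (2 * (2 ^ n * exp (l\<^sup>2)) ^ m)" by simp
  also have "\<dots> \<le> 2 ^ n * (2 * (2 ^ n * exp (l\<^sup>2)) ^ m)"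
    using cardNS by (intro mult_right_mono) auto
  also have "\<dots> = real (card D) * (2 * 2 ^ n * exp (l\<^sup>2) ^ m)"
    by (simp add: cardD power_mult_distrib)
  also have "\<dots> = (\<Sum>X\<in>D. 2 * 2 ^ n * exp (l\<^sup>2) ^ m)" by simp
  finally have le: "(\<Sum>X\<in>D. \<Phi> X) \<le> (\<Sum>X\<in>D. 2 * 2 ^ n * exp (l\<^sup>2) ^ m)" .
  have "D \<noteq> {}" unfolding D_def using cube_nonempty by (auto simp: PiE_eq_empty_iff)
  then obtain X where X: "X \<in> D" "\<Phi> X \<le> 2 * 2 ^ n * exp (l\<^sup>2) ^ m"
    using le finD by (metis (no_types, lifting) not_le sum_strict_mono)
  have logb: "2 * 2 ^ n * exp (l\<^sup>2) ^ m \<le> exp (2 * real n + real m * l\<^sup>2)"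
  proof -
    have "(2::real) * 2 ^ n \<le> exp 1 ^ n * exp 1 ^ n"
    proof (intro mult_mono)
      have e: "(2::real) \<le> exp 1" using exp_ge_add_one_self[of 1] by simp
      show "(2::real) ^ n \<le> exp 1 ^ n" using e by (intro power_mono) auto
      have "(2::real) \<le> 2 ^ n" using n self_le_power[of "2::real" n] by auto
      also have "\<dots> \<le> exp 1 ^ n" using e by (intro power_mono) auto
      finally show "(2::real) \<le> exp 1 ^ n" .
    qed auto
    also have "\<dots> = exp (2 * real n)" by (simp add: exp_of_nat_mult[symmetric] exp_add[symmetric])
    finally show ?thesis
      by (simp add: exp_add exp_of_nat_mult[symmetric])
  qed
  have bnd: "\<bar>\<Sum>t<m. walsh S (X t)\<bar> \<le> real m / (8 * real s)" if S: "S \<subseteq> {1..n}" "S \<noteq> {}" for S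
  proof -
    define z where "z = (\<Sum>t<m. walsh S (X t))"
    have "exp (l * \<bar>z\<bar>) \<le> exp (l * z) + exp (- l * z)" by (cases "z \<ge> 0") auto
    also have "\<dots> \<le> \<Phi> X"
      unfolding \<Phi>_def z_def using S
      by (intro member_le_sum[of S NS "\<lambda>S. exp (l * (\<Sum>t<m. walsh S (X t))) + exp (- l * (\<Sum>t<m. walsh S (X t)))"])
        (auto simp: NS_def intro: add_nonneg_nonneg)
    also have "\<dots> \<le> exp (2 * real n + real m * l\<^sup>2)" using X logb by linarith
    finally have "l * \<bar>z\<bar> \<le> 2 * real n + real m * l\<^sup>2" by simp
    also have "2 * real n \<le> real m * l\<^sup>2 * 2 - real m * l\<^sup>2"
      using m s by (simp add: l_def field_simps power2_eq_square)
    finally have "l * \<bar>z\<bar> \<le> l * (2 * real m * l)" by (simp add: power2_eq_square algebra_simps)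
    then have "\<bar>z\<bar> \<le> 2 * real m * l" using l by simp
    then show ?thesis by (simp add: z_def l_def)
  qed
  obtain x0 where x0: "x0 \<in> cube n" using cube_nonempty by blast
  \<comment> \<open>Members of \<open>D\<close> are undefined from index \<open>m\<close>
    on.\<close>
  define X' where "X' t = (if t < m then X t else x0)" for t
  have "low_coherence n s m X'"
    using X x0 bnd by (auto simp: low_coherence_def X'_def D_def PiE_iff)
  then show ?thesis by (rule that)
qed

text \<open>After expanding the square, \<open>G\<close> is the Gram matrix minus \<open>m\<close>
  times the identity. Its entries are at most \<open>m / (8 * s)\<close>, and the squared l1 norm of
  the coefficients is at most \<open>2 * s\<close> times their squared l2 norm.\<close>

lemma restricted_isometry:
  assumes X: "low_coherence n s m X" and s: "s \<ge> 1"
    and A: "A \<subseteq> Pow {1..n}" "card A \<le> 2 * s"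
  shows "\<bar>(\<Sum>t<m. (\<Sum>S\<in>A. c S * walsh S (X t))\<^sup>2) - real m * (\<Sum>S\<in>A. (c S)\<^sup>2)\<bar>
    \<le> real m / 4 * (\<Sum>S\<in>A. (c S)\<^sup>2)"
proof -
  have Xc: "X t \<in> cube n" for t using X by (auto simp: low_coherence_def)
  have coh: "\<bar>\<Sum>t<m. walsh S (X t)\<bar> \<le> real m / (8 * real s)" if "S \<subseteq> {1..n}" "S \<noteq> {}" for S
    using X that by (auto simp: low_coherence_def)
  have finA: "finite A" using A by (auto intro: finite_subset)
  define G where "G S T = (\<Sum>t<m. walsh (sym_diff S T) (X t)) - (if S = T then real m else 0)" for S T
  have G: "\<bar>G S T\<bar> \<le> real m / (8 * real s)" if "S \<in> A" "T \<in> A" for S T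
  proof (cases "S = T")
    case False
    then show ?thesis unfolding G_def using that A by (simp, intro coh) auto
  qed (simp add: G_def)
  have "(\<Sum>t<m. (\<Sum>S\<in>A. c S * walsh S (X t))\<^sup>2)
      = (\<Sum>t<m. \<Sum>S\<in>A. \<Sum>T\<in>A. c S * c T * walsh (sym_diff S T) (X t))"
  proof (intro sum.cong refl)
    fix t
    have "(\<Sum>S\<in>A. c S * walsh S (X t))\<^sup>2 = (\<Sum>S\<in>A. \<Sum>T\<in>A. c S * walsh S (X t) * (c T * walsh T (X t)))"
      by (simp add: power2_eq_square sum_product)
    also have "\<dots> = (\<Sum>S\<in>A. \<Sum>T\<in>A. c S * c T * walsh (sym_diff S T) (X t))"
    proof (intro sum.cong refl)
      fix S T assume "S \<in> A" "T \<in> A"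
      then have "walsh S (X t) * walsh T (X t) = walsh (sym_diff S T) (X t)"
        using A Xc by (intro walsh_mult) auto
      then show "c S * walsh S (X t) * (c T * walsh T (X t)) = c S * c T * walsh (sym_diff S T) (X t)"
        by (metis mult.assoc mult.left_commute)
    qed
    finally show "(\<Sum>S\<in>A. c S * walsh S (X t))\<^sup>2 = (\<Sum>S\<in>A. \<Sum>T\<in>A. c S * c T * walsh (sym_diff S T) (X t))" .
  qed
  also have "\<dots> = (\<Sum>S\<in>A. \<Sum>T\<in>A. c S * c T * (\<Sum>t<m. walsh (sym_diff S T) (X t)))"
    by (subst sum.swap, rule sum.cong[OF refl], subst sum.swap) (simp add: sum_distrib_left)
  also have "\<dots> = (\<Sum>S\<in>A. \<Sum>T\<in>A. c S * c T * G S T + (if S = T then real m * (c S)\<^sup>2 else 0))"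
    by (intro sum.cong refl) (auto simp: G_def algebra_simps power2_eq_square)
  also have "\<dots> = (\<Sum>S\<in>A. \<Sum>T\<in>A. c S * c T * G S T) + real m * (\<Sum>S\<in>A. (c S)\<^sup>2)"
    using finA by (simp add: sum.distrib sum_distrib_left)
  finally have "\<bar>(\<Sum>t<m. (\<Sum>S\<in>A. c S * walsh S (X t))\<^sup>2) - real m * (\<Sum>S\<in>A. (c S)\<^sup>2)\<bar>
     = \<bar>\<Sum>S\<in>A. \<Sum>T\<in>A. c S * c T * G S T\<bar>" by simp
  also have "\<dots> \<le> (\<Sum>S\<in>A. \<Sum>T\<in>A. \<bar>c S\<bar> * \<bar>c T\<bar> * (real m / (8 * real s)))"
  proof (intro order_trans[OF sum_abs] sum_mono)
    fix S T assume "S \<in> A" "T \<in> A"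
    then show "\<bar>c S * c T * G S T\<bar> \<le> \<bar>c S\<bar> * \<bar>c T\<bar> * (real m / (8 * real s))"
      using G unfolding abs_mult by (intro mult_left_mono) auto
  qed
  also have "\<dots> = (real m / (8 * real s)) * (\<Sum>S\<in>A. \<bar>c S\<bar>)\<^sup>2"
  proof -
    have "(\<Sum>S\<in>A. \<Sum>T\<in>A. \<bar>c S\<bar> * \<bar>c T\<bar> * K) = K * (\<Sum>S\<in>A. \<bar>c S\<bar>)\<^sup>2" for K
      by (simp add: power2_eq_square sum_product sum_distrib_left mult_ac)
    then show ?thesis .
  qed
  also have "\<dots> \<le> (real m / (8 * real s)) * ((\<Sum>S\<in>A. (c S)\<^sup>2) * real (2 * s))"
  proof (intro mult_left_mono)
    have "(\<Sum>S\<in>A. \<bar>c S\<bar>)\<^sup>2 \<le> (\<Sum>S\<in>A. \<bar>c S\<bar>\<^sup>2) * real (card A)"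
      by (rule sum_squared_le_sum_of_squares)
    also have "\<dots> \<le> (\<Sum>S\<in>A. (c S)\<^sup>2) * real (2 * s)"
      using A by (simp, intro mult_left_mono sum_nonneg) auto
    finally show "(\<Sum>S\<in>A. \<bar>c S\<bar>)\<^sup>2 \<le> (\<Sum>S\<in>A. (c S)\<^sup>2) * real (2 * s)" .
  qed auto
  also have "\<dots> = real m / 4 * (\<Sum>S\<in>A. (c S)\<^sup>2)" using s by (simp add: field_simps)
  finally show ?thesis .
qed

lemma wpoly_restrict:
  assumes "A \<subseteq> Pow {1..n}" "\<And>S. S \<in> Pow {1..n} - A \<Longrightarrow> c S = 0"
  shows "wpoly n c x = (\<Sum>S\<in>A. c S * walsh S x)"
  unfolding wpoly_def using assms by (intro sum.mono_neutral_right) auto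

lemma wpoly_sup_le:
  assumes A: "A \<subseteq> Pow {1..n}" "\<And>S. S \<in> Pow {1..n} - A \<Longrightarrow> c S = 0" and x: "x \<in> cube n"
  shows "\<bar>wpoly n c x\<bar> \<le> sqrt (real (card A) * (\<Sum>S\<in>A. (c S)\<^sup>2))"
proof -
  have "\<bar>wpoly n c x\<bar> \<le> (\<Sum>S\<in>A. \<bar>c S\<bar>)"
  proof -
    have "\<bar>c S * walsh S x\<bar> \<le> \<bar>c S\<bar>" if "S \<in> A" for S
      using A(1) walsh_abs[OF x, of S] that by (auto simp: abs_mult)
    moreover have "wpoly n c x = (\<Sum>S\<in>A. c S * walsh S x)" using A by (intro wpoly_restrict)
    ultimately show ?thesis
      by (simp only:) (intro order_trans[OF sum_abs] sum_mono)
  qed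
  also have "\<dots> \<le> sqrt (real (card A) * (\<Sum>S\<in>A. (c S)\<^sup>2))"
    using sum_squared_le_sum_of_squares[of "\<lambda>S. \<bar>c S\<bar>" A] by (intro real_le_rsqrt) (simp add: mult.commute)
  finally show ?thesis .
qed

section \<open>Subgaussian noise\<close>

text \<open>Tailored to centered variables: the linear term integrates to zero, leaving only a
  square exponential moment.\<close>

lemma exp_le_self_plus_exp_square: "exp y \<le> y + exp (y\<^sup>2)" for y :: real
proof -
  have sq: "1 + y\<^sup>2 \<le> exp (y\<^sup>2)" by simp
  consider "\<bar>y\<bar> \<le> 1" | "y > 1" | "y < -1" by linarith
  then show ?thesis
  proof cases
    case 1
    then show ?thesis using exp_le_quadratic[of y] sq by linarith
  next
    case 2
    then have "y \<le> y\<^sup>2" by (simp add: power2_eq_square)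
    then show ?thesis using 2 by (smt (verit) exp_le_cancel_iff)
  next
    case 3
    then have "- y \<le> y\<^sup>2" by (simp add: power2_eq_square mult_le_cancel_right1 flip: mult_minus_left) (smt (verit) mult_le_cancel_right1 mult_minus_left)
    moreover have "exp y \<le> 1" using 3 by simp
    ultimately show ?thesis using sq by linarith
  qed
qed

lemma exp_mult_le_chord:
  fixes p z :: real
  assumes "0 \<le> p" "p \<le> 1"
  shows "exp (p * z) \<le> 1 + p * (exp z - 1)"
  using convex_onD[OF exp_convex assms, of 0 z] by (simp add: algebra_simps)

lemma subgaussian_exp_square:
  assumes N: "subgaussian \<sigma> N" and \<sigma>: "\<sigma> > 0"
  shows "(\<integral>\<^sup>+x. ennreal (exp (x\<^sup>2 / (4 * \<sigma>\<^sup>2))) \<partial>N) \<le> 12"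
proof -
  interpret prob_space N using N by (simp add: subgaussian_def)
  have [measurable_cong]: "sets N = sets borel" using N by (simp add: subgaussian_def)
  then have space: "space N = UNIV" by (metis sets_eq_imp_space_eq space_borel)
  \<comment> \<open>The levels are chosen so that the tail bound at level \<open>k\<close> is
    exactly \<open>2 * exp (- k)\<close>. Between levels \<open>k\<close> and \<open>k + 1\<close>
    the integrand is at most \<open>exp ((k + 1) / 2)\<close>, so the layers form a geometric series
    of ratio \<open>exp (- 1 / 2)\<close>.\<close>
  define E where "E k = {x :: real. \<bar>x\<bar> \<ge> \<sigma> * sqrt (2 * real k)}" for k :: nat
  have [measurable]: "E k \<in> sets N" for k unfolding E_def by measurable
  have pE: "emeasure N (E k) \<le> ennreal (2 * exp (- real k))" for k
  proof -
    have "measure N (E k) \<le> 2 * exp (- ((\<sigma> * sqrt (2 * real k))\<^sup>2 / (2 * \<sigma>\<^sup>2)))"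
      using N \<sigma> unfolding subgaussian_def E_def by auto
    also have "\<dots> = 2 * exp (- real k)" using \<sigma> by (simp add: power_mult_distrib)
    finally show ?thesis by (simp add: emeasure_eq_measure ennreal_leI)
  qed
  have "ennreal (exp (x\<^sup>2 / (4 * \<sigma>\<^sup>2))) \<le> (\<Sum>k. ennreal (exp ((real k + 1) / 2)) * indicator (E k) x)" for x
  proof -
    define k where "k = nat \<lfloor>x\<^sup>2 / (2 * \<sigma>\<^sup>2)\<rfloor>"
    have k: "real k \<le> x\<^sup>2 / (2 * \<sigma>\<^sup>2)" "x\<^sup>2 / (2 * \<sigma>\<^sup>2) \<le> real k + 1"
      unfolding k_def by auto
    have "2 * real k * \<sigma>\<^sup>2 \<le> x\<^sup>2" using k(1) \<sigma> by (simp add: field_simps)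
    then have "sqrt (2 * real k * \<sigma>\<^sup>2) \<le> \<bar>x\<bar>" by (metis real_sqrt_abs real_sqrt_le_iff)
    then have "x \<in> E k" using \<sigma> by (simp add: E_def real_sqrt_mult mult_ac)
    moreover have "exp (x\<^sup>2 / (4 * \<sigma>\<^sup>2)) \<le> exp ((real k + 1) / 2)"
      using k(2) by (simp add: field_simps)
    ultimately have "ennreal (exp (x\<^sup>2 / (4 * \<sigma>\<^sup>2))) \<le> ennreal (exp ((real k + 1) / 2)) * indicator (E k) x"
      by (simp add: ennreal_leI)
    also have "\<dots> \<le> (\<Sum>k. ennreal (exp ((real k + 1) / 2)) * indicator (E k) x)"
    proof -
      define F where "F k = ennreal (exp ((real k + 1) / 2)) * indicator (E k) x" for k
      have "sum F {k} \<le> suminf F" by (intro sum_le_suminf) auto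
      then have "F k \<le> suminf F" by simp
      then show ?thesis unfolding F_def .
    qed
    finally show ?thesis .
  qed
  then have "(\<integral>\<^sup>+x. ennreal (exp (x\<^sup>2 / (4 * \<sigma>\<^sup>2))) \<partial>N)
      \<le> (\<integral>\<^sup>+x. (\<Sum>k. ennreal (exp ((real k + 1) / 2)) * indicator (E k) x) \<partial>N)"
    by (intro nn_integral_mono) auto
  also have "\<dots> = (\<Sum>k. ennreal (exp ((real k + 1) / 2)) * emeasure N (E k))"
    by (subst nn_integral_suminf) (auto simp: nn_integral_cmult_indicator)
  also have "\<dots> \<le> (\<Sum>k. ennreal (exp ((real k + 1) / 2)) * ennreal (2 * exp (- real k)))"
    by (intro suminf_le mult_left_mono pE) auto
  also have "\<dots> = (\<Sum>k. ennreal (2 * exp (1/2) * exp (-1/2) ^ k))"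
    by (intro suminf_cong)
      (simp add: ennreal_mult[symmetric] exp_add[symmetric] exp_of_nat_mult[symmetric] field_simps)
  also have "\<dots> \<le> ennreal 12"
  proof -
    have h: "(1.5::real) \<le> exp (1/2)" using exp_ge_add_one_self[of "1/2"] by simp
    have h2: "exp (1/2) \<le> (2::real)" using exp_bound_half[of "1/2::real"] by simp
    have q: "exp (-1/2) \<le> (2/3 :: real)" using h by (simp add: exp_minus field_simps)
    have "(\<lambda>k. 2 * exp (1/2) * exp (-1/2 :: real) ^ k) sums (2 * exp (1/2) * (1 / (1 - exp (-1/2))))"
      by (intro sums_mult geometric_sums) auto
    then have "(\<Sum>k. ennreal (2 * exp (1/2) * exp (-1/2) ^ k)) = ennreal (2 * exp (1/2) * (1 / (1 - exp (-1/2))))"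
      by (intro suminf_ennreal_eq) auto
    also have "\<dots> \<le> ennreal (2 * 2 * 3)"
      using q h2 by (intro ennreal_leI mult_mono) (auto simp: field_simps)
    finally show ?thesis by simp
  qed
  finally show ?thesis by simp
qed

text \<open>Tail bounds give a quadratic exponent only up to a constant. The factor 45 serves both
  regimes below: for small \<open>l\<close> centering removes the linear term and the chord bound
  leaves \<open>11 * p = 44 * \<sigma>\<^sup>2 * l\<^sup>2\<close>; for large \<open>l\<close> the
  factor \<open>12 \<le> exp 11\<close> is absorbed since
  \<open>11 < 44 * \<sigma>\<^sup>2 * l\<^sup>2\<close>.\<close>

lemma subgaussian_mgf:
  assumes N: "subgaussian \<sigma> N" and \<sigma>: "\<sigma> > 0"
  shows "(\<integral>\<^sup>+x. ennreal (exp (l * x)) \<partial>N) \<le> ennreal (exp (45 * \<sigma>\<^sup>2 * l\<^sup>2))"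
proof -
  interpret prob_space N using N by (simp add: subgaussian_def)
  have [measurable_cong]: "sets N = sets borel" using N by (simp add: subgaussian_def)
  have ix: "integrable N (\<lambda>x. x)" "(\<integral>x. x \<partial>N) = 0" using N by (auto simp: subgaussian_def)
  define b where "b = 1 / (4 * \<sigma>\<^sup>2)"
  have b: "b > 0" using \<sigma> by (simp add: b_def)
  have nn: "(\<integral>\<^sup>+x. ennreal (exp (b * x\<^sup>2)) \<partial>N) \<le> 12"
    using subgaussian_exp_square[OF assms] by (simp add: b_def)
  have ie: "integrable N (\<lambda>x. exp (b * x\<^sup>2))"
    by (rule integrableI_nonneg) (use nn in \<open>auto simp: top_unique intro: le_less_trans\<close>)
  have Ie: "(\<integral>x. exp (b * x\<^sup>2) \<partial>N) \<le> 12"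
  proof -
    have "ennreal (\<integral>x. exp (b * x\<^sup>2) \<partial>N) \<le> ennreal 12"
      using nn by (subst nn_integral_eq_integral[OF ie, symmetric]) auto
    then show ?thesis by (subst (asm) ennreal_le_iff) auto
  qed
  have bound: "(\<integral>\<^sup>+x. ennreal (exp (l * x)) \<partial>N) \<le> ennreal (\<integral>x. h x \<partial>N)"
    if "integrable N h" "\<And>x. exp (l * x) \<le> h x" for h
  proof -
    have "(\<integral>\<^sup>+x. ennreal (exp (l * x)) \<partial>N) \<le> (\<integral>\<^sup>+x. ennreal (h x) \<partial>N)"
      using that by (intro nn_integral_mono ennreal_leI) auto
    also have "\<dots> = ennreal (\<integral>x. h x \<partial>N)"
      using that by (intro nn_integral_eq_integral) (auto intro: order_trans[OF exp_ge_zero])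
    finally show ?thesis .
  qed
  define p where "p = l\<^sup>2 / b"
  have p: "p * b = l\<^sup>2" "p \<ge> 0" "p = 4 * \<sigma>\<^sup>2 * l\<^sup>2" using b by (auto simp: p_def b_def)
  show ?thesis
  proof (cases "p \<le> 1")
    case True
    have pw: "exp (l * x) \<le> l * x + (1 + p * (exp (b * x\<^sup>2) - 1))" for x
    proof -
      have "exp (l * x) \<le> l * x + exp (p * (b * x\<^sup>2))"
        using exp_le_self_plus_exp_square[of "l * x"] p(1) by (simp add: power_mult_distrib mult.assoc[symmetric])
      also have "exp (p * (b * x\<^sup>2)) \<le> 1 + p * (exp (b * x\<^sup>2) - 1)"
        using p True by (intro exp_mult_le_chord)
      finally show ?thesis by simp
    qed
    have "(\<integral>\<^sup>+x. ennreal (exp (l * x)) \<partial>N) \<le> ennreal (\<integral>x. l * x + (1 + p * (exp (b * x\<^sup>2) - 1)) \<partial>N)"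
      using ix ie by (intro bound pw) auto
    also have "(\<integral>x. l * x + (1 + p * (exp (b * x\<^sup>2) - 1)) \<partial>N) = 1 + p * ((\<integral>x. exp (b * x\<^sup>2) \<partial>N) - 1)"
      using ix ie by (simp add: prob_space)
    also have "\<dots> \<le> 1 + p * 11" using Ie p by (intro add_left_mono mult_left_mono) auto
    also have "\<dots> \<le> 1 + 45 * \<sigma>\<^sup>2 * l\<^sup>2" using p by (simp add: mult_right_mono)
    also have "\<dots> \<le> exp (45 * \<sigma>\<^sup>2 * l\<^sup>2)" by simp
    finally show ?thesis by (simp add: ennreal_leI)
  next
    case False
    have pw: "exp (l * x) \<le> exp (\<sigma>\<^sup>2 * l\<^sup>2) * exp (b * x\<^sup>2)" for x
    proof -
      have "0 \<le> (\<sigma> * l - x / (2 * \<sigma>))\<^sup>2" by simp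
      also have "\<dots> = \<sigma>\<^sup>2 * l\<^sup>2 - l * x + b * x\<^sup>2"
        using \<sigma> by (simp add: b_def power2_diff power_mult_distrib power_divide)
      finally show ?thesis by (simp add: exp_add[symmetric])
    qed
    have "(\<integral>\<^sup>+x. ennreal (exp (l * x)) \<partial>N) \<le> ennreal (\<integral>x. exp (\<sigma>\<^sup>2 * l\<^sup>2) * exp (b * x\<^sup>2) \<partial>N)"
      using ie by (intro bound pw) auto
    also have "(\<integral>x. exp (\<sigma>\<^sup>2 * l\<^sup>2) * exp (b * x\<^sup>2) \<partial>N) = exp (\<sigma>\<^sup>2 * l\<^sup>2) * (\<integral>x. exp (b * x\<^sup>2) \<partial>N)"
      by simp
    also have "\<dots> \<le> exp (\<sigma>\<^sup>2 * l\<^sup>2) * (1 + 11)" using Ie by (intro mult_left_mono) auto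
    also have "\<dots> \<le> exp (\<sigma>\<^sup>2 * l\<^sup>2) * exp 11" by (intro mult_left_mono exp_ge_add_one_self) auto
    also have "\<dots> \<le> exp (45 * \<sigma>\<^sup>2 * l\<^sup>2)" using False p by (simp add: exp_add[symmetric])
    finally show ?thesis by (simp add: ennreal_leI)
  qed
qed

section \<open>Gaussian noise and quadratic forms in subgaussian noise\<close>

abbreviation gaussian :: "real \<Rightarrow> real measure" where
  "gaussian \<sigma> \<equiv> density lborel (\<lambda>x. ennreal (normal_density 0 \<sigma> x))"

lemma nn_integral_normal_density:
  "\<sigma> > 0 \<Longrightarrow> (\<integral>\<^sup>+x. ennreal (normal_density \<mu> \<sigma> x) \<partial>lborel) = 1"
  by (subst nn_integral_eq_integral) auto

lemma prob_space_gaussian: "\<sigma> > 0 \<Longrightarrow> prob_space (gaussian \<sigma>)"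
  by (rule prob_space_normal_density)

lemma gaussian_mgf:
  assumes "\<sigma> > 0"
  shows "(\<integral>\<^sup>+x. ennreal (exp (l * x)) \<partial>gaussian \<sigma>) = ennreal (exp (l\<^sup>2 * \<sigma>\<^sup>2 / 2))"
proof -
  have *: "normal_density 0 \<sigma> x * exp (l * x) = exp (l\<^sup>2 * \<sigma>\<^sup>2 / 2) * normal_density (l * \<sigma>\<^sup>2) \<sigma> x" for x
  proof -
    have "- (x\<^sup>2) / (2 * \<sigma>\<^sup>2) + l * x = l\<^sup>2 * \<sigma>\<^sup>2 / 2 + (- (x - l * \<sigma>\<^sup>2)\<^sup>2 / (2 * \<sigma>\<^sup>2))"
      using assms by (simp add: field_simps power2_eq_square)
    then have "exp (- (x\<^sup>2) / (2 * \<sigma>\<^sup>2)) * exp (l * x)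
        = exp (l\<^sup>2 * \<sigma>\<^sup>2 / 2) * exp (- (x - l * \<sigma>\<^sup>2)\<^sup>2 / (2 * \<sigma>\<^sup>2))"
      by (metis exp_add)
    then show ?thesis by (simp add: normal_density_def)
  qed
  have "(\<integral>\<^sup>+x. ennreal (exp (l * x)) \<partial>gaussian \<sigma>)
      = (\<integral>\<^sup>+x. ennreal (exp (l\<^sup>2 * \<sigma>\<^sup>2 / 2)) * ennreal (normal_density (l * \<sigma>\<^sup>2) \<sigma> x) \<partial>lborel)"
    by (subst nn_integral_density) (auto simp: ennreal_mult[symmetric] *)
  also have "\<dots> = ennreal (exp (l\<^sup>2 * \<sigma>\<^sup>2 / 2))"
    using assms by (subst nn_integral_cmult) (auto simp: nn_integral_normal_density)
  finally show ?thesis .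
qed

text \<open>The weight turns the density into \<open>sqrt 2\<close> times that of a Gaussian with
  standard deviation \<open>sqrt 2\<close>.\<close>

lemma gaussian_exp_square: "(\<integral>\<^sup>+x. ennreal (exp (x\<^sup>2 / 4)) \<partial>gaussian 1) \<le> 2"
proof -
  have *: "normal_density 0 1 x * exp (x\<^sup>2 / 4) = sqrt 2 * normal_density 0 (sqrt 2) x" for x
  proof -
    have "- (x\<^sup>2) / 2 + x\<^sup>2 / 4 = - (x\<^sup>2) / 4" by simp
    then have "exp (- (x\<^sup>2) / 2) * exp (x\<^sup>2 / 4) = exp (- (x\<^sup>2) / 4)" by (metis exp_add)
    then show ?thesis by (simp add: normal_density_def real_sqrt_mult field_simps)
  qed
  have "(\<integral>\<^sup>+x. ennreal (exp (x\<^sup>2 / 4)) \<partial>gaussian 1)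
      = (\<integral>\<^sup>+x. ennreal (sqrt 2) * ennreal (normal_density 0 (sqrt 2) x) \<partial>lborel)"
    by (subst nn_integral_density) (auto simp: ennreal_mult[symmetric] *)
  also have "\<dots> = ennreal (sqrt 2)"
    by (subst nn_integral_cmult) (auto simp: nn_integral_normal_density)
  also have "\<dots> \<le> ennreal 2" by (intro ennreal_leI real_le_lsqrt) auto
  finally show ?thesis by simp
qed

text \<open>Makes Gaussian noise an admissible choice, to which all lower bounds are
  specialised.\<close>

lemma gaussian_subgaussian:
  assumes "\<sigma> > 0"
  shows "subgaussian \<sigma> (gaussian \<sigma>)"
proof -
  interpret prob_space "gaussian \<sigma>" by (rule prob_space_gaussian[OF assms])
  have tail: "measure (gaussian \<sigma>) {x. u \<le> s * x} \<le> exp (- (u\<^sup>2 / (2 * \<sigma>\<^sup>2)))"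
    if "u \<ge> 0" "\<bar>s\<bar> = 1" for u s
  proof -
    \<comment> \<open>Minimiser of the Chernoff exponent
      \<open>l\<^sup>2 * \<sigma>\<^sup>2 / 2 - l * u\<close>. The sign \<open>s\<close> treats both
      tails at once.\<close>
    define l where "l = u / \<sigma>\<^sup>2"
    have "emeasure (gaussian \<sigma>) {x. u \<le> s * x}
        \<le> (\<integral>\<^sup>+x. ennreal (exp (- l * u)) * ennreal (exp ((l * s) * x)) \<partial>gaussian \<sigma>)"
      unfolding nn_integral_indicator[symmetric]
    proof (subst nn_integral_indicator[symmetric])
      show "{x. u \<le> s * x} \<in> sets (gaussian \<sigma>)" by simp
      show "(\<integral>\<^sup>+x. indicator {x. u \<le> s * x} x \<partial>gaussian \<sigma>)
        \<le> (\<integral>\<^sup>+x. ennreal (exp (- l * u)) * ennreal (exp ((l * s) * x)) \<partial>gaussian \<sigma>)"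
      proof (intro nn_integral_mono)
        fix x
        have "1 \<le> exp (- l * u) * exp ((l * s) * x)" if "u \<le> s * x"
        proof -
          have "l * u \<le> l * (s * x)" using that \<open>u \<ge> 0\<close> by (intro mult_left_mono) (auto simp: l_def)
          then show ?thesis by (simp add: exp_add[symmetric] mult.assoc)
        qed
        then show "indicator {x. u \<le> s * x} x \<le> ennreal (exp (- l * u)) * ennreal (exp ((l * s) * x))"
          by (auto simp: indicator_def ennreal_mult[symmetric] simp flip: ennreal_1)
      qed
    qed
    also have "\<dots> = ennreal (exp (- l * u)) * ennreal (exp ((l * s)\<^sup>2 * \<sigma>\<^sup>2 / 2))"
      by (subst nn_integral_cmult) (auto simp: gaussian_mgf[OF assms])
    also have "\<dots> = ennreal (exp (- (u\<^sup>2 / (2 * \<sigma>\<^sup>2))))"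
    proof -
      have "s\<^sup>2 = 1" using that by (metis power2_abs power_one)
      then have "- l * u + (l * s)\<^sup>2 * \<sigma>\<^sup>2 / 2 = - (u\<^sup>2 / (2 * \<sigma>\<^sup>2))"
        using assms by (simp add: l_def power_mult_distrib field_simps power2_eq_square)
      then show ?thesis by (simp add: ennreal_mult[symmetric] exp_add[symmetric])
    qed
    finally show ?thesis by (simp add: emeasure_eq_measure)
  qed
  have "measure (gaussian \<sigma>) {x. \<bar>x\<bar> \<ge> u} \<le> 2 * exp (- (u\<^sup>2 / (2 * \<sigma>\<^sup>2)))" if "u \<ge> 0" for u
  proof -
    have "{x. \<bar>x\<bar> \<ge> u} = {x. u \<le> 1 * x} \<union> {x. u \<le> (-1) * x}" using that by auto
    then have "measure (gaussian \<sigma>) {x. \<bar>x\<bar> \<ge> u}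
        \<le> measure (gaussian \<sigma>) {x. u \<le> 1 * x} + measure (gaussian \<sigma>) {x. u \<le> (-1) * x}"
      by (simp only:) (intro measure_Un_le; simp)
    then show ?thesis using tail[OF that, of 1] tail[OF that, of "-1"] by simp
  qed
  moreover have "integrable (gaussian \<sigma>) (\<lambda>x. x)" "(\<integral>x. x \<partial>gaussian \<sigma>) = 0"
    using integrable_normal_moment_nz_1[OF assms, of 0] integral_normal_moment_nz_1[OF assms, of 0]
    by (auto simp: integrable_real_density integral_real_density)
  ultimately show ?thesis using prob_space_axioms by (simp add: subgaussian_def)
qed

text \<open>Gaussian randomization: \<open>exp (a * z\<^sup>2)\<close> is the moment generating function of a standard Gaussian
  at \<open>sqrt (2 * a) * z\<close>, which makes the exponent linear in the noise.\<close>

lemma quadratic_exp_moment: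
  fixes w :: "'b \<Rightarrow> nat \<Rightarrow> real"
  assumes \<sigma>: "\<sigma> > 0" and N: "\<And>t. subgaussian \<sigma> (N t)" and A: "finite A" and a: "a \<ge> 0"
    and B: "\<And>g. (\<Sum>t<m. (\<Sum>S\<in>A. g S * w S t)\<^sup>2) \<le> B * (\<Sum>S\<in>A. (g S)\<^sup>2)"
    and small: "360 * \<sigma>\<^sup>2 * a * B \<le> 1"
  shows "(\<integral>\<^sup>+\<xi>. ennreal (exp (a * (\<Sum>S\<in>A. (\<Sum>t<m. \<xi> t * w S t)\<^sup>2))) \<partial>PiM {..<m} N) \<le> 2 ^ card A"
proof -
  have probN: "prob_space (N t)" and setsN [measurable_cong]: "sets (N t) = sets borel" for t
    using N[of t] by (auto simp: subgaussian_def)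
  have probG: "prob_space (gaussian 1)" by (rule prob_space_gaussian) simp
  interpret PN: product_prob_space N "{..<m}" by (rule product_prob_spaceI[OF probN])
  interpret PG: product_prob_space "\<lambda>_::'b. gaussian 1" A by (rule product_prob_spaceI[OF probG])
  have sets1 [measurable_cong]: "sets (PiM {..<m} N) = sets (PiM {..<m} (\<lambda>_. borel))"
    by (rule sets_PiM_cong) (auto simp: setsN)
  have sets2 [measurable_cong]: "sets (PiM A (\<lambda>_::'b. gaussian 1)) = sets (PiM A (\<lambda>_. borel))"
    by (rule sets_PiM_cong) auto
  interpret P: pair_sigma_finite "PiM {..<m} N" "PiM A (\<lambda>_::'b. gaussian 1)"
    by (intro pair_sigma_finite.intro PN.sigma_finite_measure_axioms PG.sigma_finite_measure_axioms)
  define c where "c = sqrt (2 * a)"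
  have c2: "c\<^sup>2 = 2 * a" using a by (simp add: c_def)
  define F where "F \<xi> g = ennreal (exp (\<Sum>S\<in>A. c * (\<Sum>t<m. \<xi> t * w S t) * g S))" for \<xi> g
  have meas: "(\<lambda>(\<xi>, g). F \<xi> g) \<in> borel_measurable (PiM {..<m} N \<Otimes>\<^sub>M PiM A (\<lambda>_::'b. gaussian 1))"
    unfolding F_def case_prod_beta'
    by (intro measurable_compose[OF _ measurable_ennreal] borel_measurable_exp borel_measurable_sum
        borel_measurable_times measurable_const; measurable)
  have 1: "ennreal (exp (a * (\<Sum>S\<in>A. (\<Sum>t<m. \<xi> t * w S t)\<^sup>2))) = (\<integral>\<^sup>+g. F \<xi> g \<partial>PiM A (\<lambda>_. gaussian 1))" for \<xi>
  proof -
    define z where "z S = c * (\<Sum>t<m. \<xi> t * w S t)" for S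
    have "(\<integral>\<^sup>+g. F \<xi> g \<partial>PiM A (\<lambda>_. gaussian 1)) = (\<integral>\<^sup>+g. (\<Prod>S\<in>A. ennreal (exp (z S * g S))) \<partial>PiM A (\<lambda>_. gaussian 1))"
      unfolding F_def z_def using A by (simp add: exp_sum prod_ennreal)
    also have "\<dots> = (\<Prod>S\<in>A. \<integral>\<^sup>+x. ennreal (exp (z S * x)) \<partial>gaussian 1)"
      using A by (intro PG.product_nn_integral_prod) auto
    also have "\<dots> = (\<Prod>S\<in>A. ennreal (exp (a * (\<Sum>t<m. \<xi> t * w S t)\<^sup>2)))"
      by (intro prod.cong refl) (simp add: gaussian_mgf z_def power_mult_distrib c2)
    also have "\<dots> = ennreal (exp (a * (\<Sum>S\<in>A. (\<Sum>t<m. \<xi> t * w S t)\<^sup>2)))"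
      using A by (simp add: prod_ennreal exp_sum sum_distrib_left)
    finally show ?thesis by simp
  qed
  \<comment> \<open>For fixed \<open>g\<close> the exponent is linear in the independent noises,
    with coefficients \<open>y t\<close>. The factor 90 is \<open>45 * 2\<close>, from
    \<open>subgaussian_mgf\<close> and \<open>c\<^sup>2 = 2 * a\<close>; the hypothesis
    \<open>small\<close> is four times as strong, which brings the exponent down to
    \<open>(g S)\<^sup>2 / 4\<close>, where the Gaussian integral is still finite.\<close>
  have 2: "(\<integral>\<^sup>+\<xi>. F \<xi> g \<partial>PiM {..<m} N) \<le> (\<Prod>S\<in>A. ennreal (exp ((g S)\<^sup>2 / 4)))" for g
  proof -
    define y where "y t = c * (\<Sum>S\<in>A. g S * w S t)" for t
    have "(\<Sum>S\<in>A. c * (\<Sum>t<m. \<xi> t * w S t) * g S) = (\<Sum>t<m. y t * \<xi> t)" for \<xi>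
      unfolding y_def by (simp add: sum_distrib_left sum_distrib_right mult_ac) (rule sum.swap)
    then have "(\<integral>\<^sup>+\<xi>. F \<xi> g \<partial>PiM {..<m} N) = (\<integral>\<^sup>+\<xi>. (\<Prod>t<m. ennreal (exp (y t * \<xi> t))) \<partial>PiM {..<m} N)"
      unfolding F_def by (simp add: exp_sum prod_ennreal)
    also have "\<dots> = (\<Prod>t<m. \<integral>\<^sup>+x. ennreal (exp (y t * x)) \<partial>N t)"
      by (intro PN.product_nn_integral_prod) auto
    also have "\<dots> \<le> (\<Prod>t<m. ennreal (exp (45 * \<sigma>\<^sup>2 * (y t)\<^sup>2)))"
      by (intro prod_mono_ennreal subgaussian_mgf[OF N \<sigma>])
    also have "\<dots> = ennreal (exp (90 * \<sigma>\<^sup>2 * a * (\<Sum>t<m. (\<Sum>S\<in>A. g S * w S t)\<^sup>2)))"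
    proof -
      have "45 * \<sigma>\<^sup>2 * (y t)\<^sup>2 = 90 * \<sigma>\<^sup>2 * a * (\<Sum>S\<in>A. g S * w S t)\<^sup>2" for t
        unfolding y_def power_mult_distrib c2 by simp
      then have "(\<Sum>t<m. 45 * \<sigma>\<^sup>2 * (y t)\<^sup>2) = 90 * \<sigma>\<^sup>2 * a * (\<Sum>t<m. (\<Sum>S\<in>A. g S * w S t)\<^sup>2)"
        unfolding sum_distrib_left by (intro sum.cong refl)
      then show ?thesis by (simp add: prod_ennreal exp_sum[symmetric])
    qed
    also have "\<dots> \<le> ennreal (exp (\<Sum>S\<in>A. (g S)\<^sup>2 / 4))"
    proof (intro ennreal_leI)
      have "90 * \<sigma>\<^sup>2 * a * (\<Sum>t<m. (\<Sum>S\<in>A. g S * w S t)\<^sup>2) \<le> 90 * \<sigma>\<^sup>2 * a * (B * (\<Sum>S\<in>A. (g S)\<^sup>2))"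
        using a B by (intro mult_left_mono) auto
      also have "\<dots> = (360 * \<sigma>\<^sup>2 * a * B) * ((\<Sum>S\<in>A. (g S)\<^sup>2) / 4)" by simp
      also have "\<dots> \<le> 1 * ((\<Sum>S\<in>A. (g S)\<^sup>2) / 4)"
        using small by (intro mult_right_mono) (auto intro: sum_nonneg)
      finally show "exp (90 * \<sigma>\<^sup>2 * a * (\<Sum>t<m. (\<Sum>S\<in>A. g S * w S t)\<^sup>2)) \<le> exp (\<Sum>S\<in>A. (g S)\<^sup>2 / 4)"
        by (simp add: sum_divide_distrib)
    qed
    also have "\<dots> = (\<Prod>S\<in>A. ennreal (exp ((g S)\<^sup>2 / 4)))"
      using A by (simp add: exp_sum prod_ennreal)
    finally show ?thesis .
  qed
  have "(\<integral>\<^sup>+\<xi>. ennreal (exp (a * (\<Sum>S\<in>A. (\<Sum>t<m. \<xi> t * w S t)\<^sup>2))) \<partial>PiM {..<m} N)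
      = (\<integral>\<^sup>+\<xi>. (\<integral>\<^sup>+g. F \<xi> g \<partial>PiM A (\<lambda>_. gaussian 1)) \<partial>PiM {..<m} N)"
    by (simp add: 1)
  also have "\<dots> = (\<integral>\<^sup>+g. (\<integral>\<^sup>+\<xi>. F \<xi> g \<partial>PiM {..<m} N) \<partial>PiM A (\<lambda>_. gaussian 1))"
    by (rule P.Fubini'[OF meas, symmetric])
  also have "\<dots> \<le> (\<integral>\<^sup>+g. (\<Prod>S\<in>A. ennreal (exp ((g S)\<^sup>2 / 4))) \<partial>PiM A (\<lambda>_. gaussian 1))"
    by (intro nn_integral_mono 2)
  also have "\<dots> = (\<Prod>S\<in>A. \<integral>\<^sup>+x. ennreal (exp (x\<^sup>2 / 4)) \<partial>gaussian 1)"
    using A by (intro PG.product_nn_integral_prod) auto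
  also have "\<dots> \<le> (\<Prod>S\<in>A. 2)"
    by (intro prod_mono_ennreal gaussian_exp_square)
  finally show ?thesis by simp
qed

text \<open>Chernoff bound for each support and union bound over all supports of size
  \<open>2 * s\<close>. The control is uniform in the coefficients on a support, so no union over
  candidate functions is taken later.\<close>

lemma sparse_noise_tail:
  fixes \<rho> :: real
  assumes \<sigma>: "\<sigma> > 0" and N: "\<And>t. subgaussian \<sigma> (N t)" and s: "s \<ge> 1" and m: "m > 0"
    and X: "low_coherence n s m X"
  defines "Bad \<equiv> {\<xi> \<in> space (PiM {..<m} N). \<exists>A. A \<subseteq> Pow {1..n} \<and> card A = 2 * s \<and>
      (\<Sum>S\<in>A. (\<Sum>t<m. \<xi> t * walsh S (X t))\<^sup>2) > \<rho>}"
  shows "Bad \<in> sets (PiM {..<m} N)"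
    and "emeasure (PiM {..<m} N) Bad
      \<le> ennreal ((2 ^ n) ^ (2 * s) * 2 ^ (2 * s) * exp (- (\<rho> / (450 * \<sigma>\<^sup>2 * real m))))"
proof -
  have probN: "prob_space (N t)" and setsN [measurable_cong]: "sets (N t) = sets borel" for t
    using N[of t] by (auto simp: subgaussian_def)
  interpret PN: product_prob_space N "{..<m}" by (rule product_prob_spaceI[OF probN])
  have sets1 [measurable_cong]: "sets (PiM {..<m} N) = sets (PiM {..<m} (\<lambda>_. borel))"
    by (rule sets_PiM_cong) (auto simp: setsN)
  define \<A> where "\<A> = {A. A \<subseteq> Pow {1..n} \<and> card A = 2 * s}"
  have fin: "finite \<A>" by (rule finite_subset[of _ "Pow (Pow {1..n})"]) (auto simp: \<A>_def)
  define Q where "Q A \<xi> = (\<Sum>S\<in>A. (\<Sum>t<m. \<xi> t * walsh S (X t))\<^sup>2)" for A and \<xi> :: "nat \<Rightarrow> real"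
  \<comment> \<open>Largest admissible value: restricted isometry gives \<open>B = 5 / 4 * m\<close>
    in \<open>quadratic_exp_moment\<close>, and \<open>360 * 5 / 4 = 450\<close>.\<close>
  define a where "a = 1 / (450 * \<sigma>\<^sup>2 * real m)"
  have a: "a > 0" using \<sigma> m by (simp add: a_def)
  have [measurable]: "Q A \<in> borel_measurable (PiM {..<m} N)" for A
    unfolding Q_def by measurable
  define E where "E A = {\<xi> \<in> space (PiM {..<m} N). Q A \<xi> > \<rho>}" for A
  have E [measurable]: "E A \<in> sets (PiM {..<m} N)" for A
    unfolding E_def by measurable
  have Bad: "Bad = (\<Union>A\<in>\<A>. E A)"
    unfolding Bad_def E_def Q_def \<A>_def by auto
  show "Bad \<in> sets (PiM {..<m} N)" unfolding Bad using fin by auto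
  have one: "emeasure (PiM {..<m} N) (E A) \<le> ennreal (2 ^ (2 * s) * exp (- (a * \<rho>)))" if "A \<in> \<A>" for A
  proof -
    have A: "A \<subseteq> Pow {1..n}" "card A = 2 * s" "finite A" using that
      by (auto simp: \<A>_def intro: finite_subset)
    have "emeasure (PiM {..<m} N) (E A) = (\<integral>\<^sup>+\<xi>. indicator (E A) \<xi> \<partial>PiM {..<m} N)" by simp
    also have "\<dots> \<le> (\<integral>\<^sup>+\<xi>. ennreal (exp (- (a * \<rho>))) * ennreal (exp (a * Q A \<xi>)) \<partial>PiM {..<m} N)"
    proof (intro nn_integral_mono)
      fix \<xi>
      have "1 \<le> exp (- (a * \<rho>)) * exp (a * Q A \<xi>)" if "\<xi> \<in> E A"
        using that a by (simp add: E_def exp_add[symmetric])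
      then show "indicator (E A) \<xi> \<le> ennreal (exp (- (a * \<rho>))) * ennreal (exp (a * Q A \<xi>))"
        by (auto simp: indicator_def ennreal_mult[symmetric] simp flip: ennreal_1)
    qed
    also have "\<dots> = ennreal (exp (- (a * \<rho>))) * (\<integral>\<^sup>+\<xi>. ennreal (exp (a * Q A \<xi>)) \<partial>PiM {..<m} N)"
      by (rule nn_integral_cmult) measurable
    also have "\<dots> \<le> ennreal (exp (- (a * \<rho>))) * 2 ^ card A"
      unfolding Q_def
    proof (intro mult_left_mono, rule quadratic_exp_moment[OF \<sigma> N, where B = "5 / 4 * real m"])
      show "(\<Sum>t<m. (\<Sum>S\<in>A. g S * walsh S (X t))\<^sup>2) \<le> 5 / 4 * real m * (\<Sum>S\<in>A. (g S)\<^sup>2)" for g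
      proof -
        have "card A \<le> 2 * s" using A by simp
        from restricted_isometry[OF X s A(1) this, of g] show ?thesis by linarith
      qed
      show "360 * \<sigma>\<^sup>2 * a * (5 / 4 * real m) \<le> 1" using \<sigma> m by (simp add: a_def)
    qed (use A a in auto)
    finally show ?thesis using A
      by (simp add: ennreal_mult ennreal_power[symmetric] mult.commute)
  qed
  have "emeasure (PiM {..<m} N) Bad \<le> (\<Sum>A\<in>\<A>. emeasure (PiM {..<m} N) (E A))"
    unfolding Bad using fin by (intro emeasure_subadditive_finite) auto
  also have "\<dots> \<le> (\<Sum>A\<in>\<A>. ennreal (2 ^ (2 * s) * exp (- (a * \<rho>))))"
    by (intro sum_mono one)
  also have "\<dots> = ennreal (real (card \<A>) * (2 ^ (2 * s) * exp (- (a * \<rho>))))"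
    by (simp add: ennreal_mult ennreal_of_nat_eq_real_of_nat)
  also have "\<dots> \<le> ennreal ((2 ^ n) ^ (2 * s) * (2 ^ (2 * s) * exp (- (a * \<rho>))))"
  proof (intro ennreal_leI mult_right_mono)
    have "card \<A> = (2 ^ n) choose (2 * s)"
      unfolding \<A>_def by (subst n_subsets) (auto simp: card_Pow)
    also have "\<dots> \<le> (2 ^ n) ^ (2 * s)"
      by (cases "2 * s \<le> 2 ^ n") (auto intro: binomial_le_pow simp: binomial_eq_0)
    finally show "real (card \<A>) \<le> (2 ^ n) ^ (2 * s)"
      by (metis of_nat_le_iff of_nat_numeral of_nat_power)
  qed auto
  finally show "emeasure (PiM {..<m} N) Bad
      \<le> ennreal ((2 ^ n) ^ (2 * s) * 2 ^ (2 * s) * exp (- (\<rho> / (450 * \<sigma>\<^sup>2 * real m))))"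
    by (simp add: a_def mult.assoc)
qed

section \<open>The least-squares learner\<close>

text \<open>Coefficients are rounded down to a grid of width \<open>\<eta> / 2 ^ n\<close>. Since
  zero is rounded to zero, sparsity survives. Finiteness guarantees a minimiser of the loss and
  makes its selection a discrete matter; the noise being controlled per support, the mesh may be as
  fine as desired.\<close>

lemma finite_coefficient_net:
  fixes \<eta> :: real
  assumes \<eta>: "\<eta> > 0"
  obtains \<Phi> :: "(nat set \<Rightarrow> real) set" where "finite \<Phi>"
    and "\<forall>\<phi>\<in>\<Phi>. card {S \<in> Pow {1..n}. \<phi> S \<noteq> 0} \<le> s"
    and "\<forall>\<theta>. card {S \<in> Pow {1..n}. \<theta> S \<noteq> 0} \<le> s \<longrightarrow> (\<forall>S. S \<subseteq> {1..n} \<longrightarrow> \<bar>\<theta> S\<bar> \<le> 2) \<longrightarrow>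
       (\<exists>\<phi>\<in>\<Phi>. \<forall>x\<in>cube n. \<bar>wpoly n \<theta> x - wpoly n \<phi> x\<bar> \<le> \<eta>)"
proof -
  define h where "h = \<eta> / 2 ^ n"
  have h: "h > 0" using \<eta> by (simp add: h_def)
  define K where "K = (\<lambda>j::int. h * of_int j) ` {\<lfloor>-2 / h\<rfloor>..\<lfloor>2 / h\<rfloor>}"
  define \<Phi> where "\<Phi> = {\<phi> \<in> Pow {1..n} \<rightarrow>\<^sub>E K. card {S \<in> Pow {1..n}. \<phi> S \<noteq> 0} \<le> s}"
  show ?thesis
  proof (rule that)
    have "finite (Pow {1..n} \<rightarrow>\<^sub>E K)" by (intro finite_PiE) (auto simp: K_def)
    then show "finite \<Phi>" unfolding \<Phi>_def by simp
    show "\<forall>\<phi>\<in>\<Phi>. card {S \<in> Pow {1..n}. \<phi> S \<noteq> 0} \<le> s" by (simp add: \<Phi>_def)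
  next
    show "\<forall>\<theta>. card {S \<in> Pow {1..n}. \<theta> S \<noteq> 0} \<le> s \<longrightarrow> (\<forall>S. S \<subseteq> {1..n} \<longrightarrow> \<bar>\<theta> S\<bar> \<le> 2) \<longrightarrow>
       (\<exists>\<phi>\<in>\<Phi>. \<forall>x\<in>cube n. \<bar>wpoly n \<theta> x - wpoly n \<phi> x\<bar> \<le> \<eta>)"
    proof (intro allI impI)
      fix \<theta> :: "nat set \<Rightarrow> real"
      assume sp: "card {S \<in> Pow {1..n}. \<theta> S \<noteq> 0} \<le> s" and "\<forall>S. S \<subseteq> {1..n} \<longrightarrow> \<bar>\<theta> S\<bar> \<le> 2"
      then have bd: "\<bar>\<theta> S\<bar> \<le> 2" if "S \<subseteq> {1..n}" for S using that by blast
      define \<phi> where "\<phi> = (\<lambda>S\<in>Pow {1..n}. h * of_int \<lfloor>\<theta> S / h\<rfloor>)"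
      have "\<phi> S \<in> K" if "S \<in> Pow {1..n}" for S
      proof -
        have "-2 / h \<le> \<theta> S / h" "\<theta> S / h \<le> 2 / h"
          using bd[of S] that h divide_right_mono[of "-2" "\<theta> S" h] divide_right_mono[of "\<theta> S" 2 h]
          by (auto simp: abs_le_iff)
        then have "\<lfloor>\<theta> S / h\<rfloor> \<in> {\<lfloor>-2 / h\<rfloor>..\<lfloor>2 / h\<rfloor>}" by (simp add: floor_mono)
        then show ?thesis using that by (auto simp: \<phi>_def K_def)
      qed
      moreover have "card {S \<in> Pow {1..n}. \<phi> S \<noteq> 0} \<le> card {S \<in> Pow {1..n}. \<theta> S \<noteq> 0}"
        by (intro card_mono finite_subset[of "{S \<in> Pow {1..n}. \<theta> S \<noteq> 0}" "Pow {1..n}"]) (auto simp: \<phi>_def)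
      ultimately have "\<phi> \<in> \<Phi>" using sp by (auto simp: \<Phi>_def \<phi>_def)
      moreover have "\<bar>wpoly n \<theta> x - wpoly n \<phi> x\<bar> \<le> \<eta>" if x: "x \<in> cube n" for x
      proof -
        have "\<bar>wpoly n \<theta> x - wpoly n \<phi> x\<bar> = \<bar>\<Sum>S\<in>Pow {1..n}. (\<theta> S - \<phi> S) * walsh S x\<bar>"
          by (simp add: wpoly_def sum_subtractf[symmetric] left_diff_distrib)
        also have "\<dots> \<le> (\<Sum>S\<in>Pow {1..n}. h)"
        proof (intro order_trans[OF sum_abs] sum_mono)
          fix S assume S: "S \<in> Pow {1..n}"
          have "\<theta> S - \<phi> S = h * (\<theta> S / h - of_int \<lfloor>\<theta> S / h\<rfloor>)"
            using S h by (simp add: \<phi>_def field_simps)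
          moreover have "\<bar>\<theta> S / h - of_int \<lfloor>\<theta> S / h\<rfloor>\<bar> \<le> 1" by linarith
          ultimately have "\<bar>\<theta> S - \<phi> S\<bar> \<le> h * 1" using h by (simp only: abs_mult) (intro mult_mono, auto)
          then show "\<bar>(\<theta> S - \<phi> S) * walsh S x\<bar> \<le> h"
            using walsh_abs[OF x, of S] S by (simp add: abs_mult)
        qed
        also have "\<dots> = \<eta>" by (simp add: h_def card_Pow)
        finally show ?thesis .
      qed
      ultimately show "\<exists>\<phi>\<in>\<Phi>. \<forall>x\<in>cube n. \<bar>wpoly n \<theta> x - wpoly n \<phi> x\<bar> \<le> \<eta>" by blast
    qed
  qed
qed

text \<open>Leaves room among the \<open>2 ^ n\<close> sets to pad a support to exactly
  \<open>2 * s\<close> members, the size for which the noise is controlled.\<close>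

lemma two_mult_le_two_power: "1 \<le> n \<Longrightarrow> 2 * n \<le> (2::nat) ^ n"
  by (induction n rule: nat_induct_at_least) auto

text \<open>The basic inequality of least squares, entirely deterministic. \<open>\<phi>\<close> is
  the net element near the target and \<open>\<psi>\<close> the minimiser; on the design their
  difference is \<open>H\<close>. Comparing losses bounds the energy of \<open>H\<close> by its
  correlation with the approximation error \<open>d\<close> and with the noise. Both are linear in
  the l2 norm \<open>c\<close> of the coefficient difference, while the energy is quadratic.\<close>

lemma least_squares_error:
  assumes X: "low_coherence n s m X" and s: "1 \<le> s" "s \<le> n" and m: "m > 0"
    and sp: "card {S \<in> Pow {1..n}. \<phi> S \<noteq> 0} \<le> s" "card {S \<in> Pow {1..n}. \<psi> S \<noteq> 0} \<le> s"
    and F: "\<And>x. x \<in> cube n \<Longrightarrow> \<bar>F x - wpoly n \<phi> x\<bar> \<le> \<eta>"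
    and loss: "(\<Sum>t<m. (F (X t) + \<xi> t - wpoly n \<psi> (X t))\<^sup>2) \<le> (\<Sum>t<m. (F (X t) + \<xi> t - wpoly n \<phi> (X t))\<^sup>2)"
    and r: "r \<ge> 0" and noise: "\<And>A. A \<subseteq> Pow {1..n} \<Longrightarrow> card A = 2 * s \<Longrightarrow>
      (\<Sum>S\<in>A. (\<Sum>t<m. \<xi> t * walsh S (X t))\<^sup>2) \<le> (r * real m)\<^sup>2"
    and x: "x \<in> cube n"
  shows "\<bar>F x - wpoly n \<psi> x\<bar> \<le> sqrt (2 * real s) * (3 * r + 4 * \<eta>) + \<eta>"
proof -
  have Xc: "X t \<in> cube n" for t using X by (auto simp: low_coherence_def)
  have \<eta>: "\<eta> \<ge> 0" using F[OF x] by linarith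
  define h where "h S = \<psi> S - \<phi> S" for S
  define A0 where "A0 = {S \<in> Pow {1..n}. \<phi> S \<noteq> 0} \<union> {S \<in> Pow {1..n}. \<psi> S \<noteq> 0}"
  have "card A0 \<le> 2 * s"
    unfolding A0_def using sp by (intro order_trans[OF card_Un_le]) simp
  moreover have "2 * s \<le> card (Pow {1..n})"
    using two_mult_le_two_power[of n] s by (simp add: card_Pow)
  moreover have "A0 \<subseteq> Pow {1..n}" by (auto simp: A0_def)
  ultimately obtain A where A: "A0 \<subseteq> A" "A \<subseteq> Pow {1..n}" "card A = 2 * s"
    using exists_subset_between[of A0 "2 * s" "Pow {1..n}"] by auto
  have A': "card A \<le> 2 * s" using A by simp
  have out: "h S = 0" if "S \<in> Pow {1..n} - A" for S
  proof -
    have "\<phi> S = 0" "\<psi> S = 0" using that A(1) unfolding A0_def by blast+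
    then show ?thesis by (simp add: h_def)
  qed
  have hx: "wpoly n \<psi> y - wpoly n \<phi> y = (\<Sum>S\<in>A. h S * walsh S y)" for y
  proof -
    have "wpoly n \<psi> y - wpoly n \<phi> y = wpoly n h y"
      by (simp add: wpoly_def h_def sum_subtractf[symmetric] left_diff_distrib)
    also have "\<dots> = (\<Sum>S\<in>A. h S * walsh S y)" using A(2) out by (intro wpoly_restrict)
    finally show ?thesis .
  qed
  define H where "H t = (\<Sum>S\<in>A. h S * walsh S (X t))" for t
  define d where "d t = F (X t) - wpoly n \<phi> (X t)" for t
  define V where "V = (\<Sum>S\<in>A. (h S)\<^sup>2)"
  have V: "V \<ge> 0" unfolding V_def by (intro sum_nonneg) auto
  define c where "c = sqrt V"
  have c: "c \<ge> 0" "c\<^sup>2 = V" using V by (auto simp: c_def)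
  have iso: "3/4 * real m * V \<le> (\<Sum>t<m. (H t)\<^sup>2)" "(\<Sum>t<m. (H t)\<^sup>2) \<le> 5/4 * real m * V"
    using restricted_isometry[OF X s(1) A(2) A', of h] unfolding H_def V_def by linarith+
  have "(\<Sum>t<m. (F (X t) + \<xi> t - wpoly n \<psi> (X t))\<^sup>2) = (\<Sum>t<m. (d t + \<xi> t - H t)\<^sup>2)"
  proof (intro sum.cong refl)
    fix t
    have "F (X t) + \<xi> t - wpoly n \<psi> (X t) = d t + \<xi> t - H t"
      using hx[of "X t"] by (simp add: d_def H_def)
    then show "(F (X t) + \<xi> t - wpoly n \<psi> (X t))\<^sup>2 = (d t + \<xi> t - H t)\<^sup>2"
      by (rule arg_cong)
  qed
  also have "\<dots> = (\<Sum>t<m. (d t + \<xi> t)\<^sup>2) - 2 * (\<Sum>t<m. d t * H t) - 2 * (\<Sum>t<m. \<xi> t * H t) + (\<Sum>t<m. (H t)\<^sup>2)"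
    by (simp add: sum_distrib_left sum.distrib[symmetric] sum_subtractf[symmetric] power2_eq_square algebra_simps)
  also have "(\<Sum>t<m. (d t + \<xi> t)\<^sup>2) = (\<Sum>t<m. (F (X t) + \<xi> t - wpoly n \<phi> (X t))\<^sup>2)"
    by (intro sum.cong refl) (simp add: d_def algebra_simps)
  finally have basic: "(\<Sum>t<m. (H t)\<^sup>2) \<le> 2 * (\<Sum>t<m. d t * H t) + 2 * (\<Sum>t<m. \<xi> t * H t)"
    using loss by linarith
  \<comment> \<open>The correlation with the noise is moved to the coefficient side, where only the
    \<open>2 * s\<close> noise coefficients on \<open>A\<close> enter.\<close>
  have n1: "(\<Sum>t<m. \<xi> t * H t) \<le> c * (r * real m)"
  proof (rule power2_le_imp_le)
    define Z where "Z S = (\<Sum>t<m. \<xi> t * walsh S (X t))" for S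
    have "(\<Sum>t<m. \<xi> t * H t) = (\<Sum>S\<in>A. h S * Z S)"
      unfolding H_def Z_def by (simp add: sum_distrib_left mult_ac) (rule sum.swap)
    then have "(\<Sum>t<m. \<xi> t * H t)\<^sup>2 \<le> V * (\<Sum>S\<in>A. (Z S)\<^sup>2)"
      unfolding V_def by (simp only: Cauchy_Schwarz_ineq_sum)
    also have "\<dots> \<le> V * (r * real m)\<^sup>2"
      using noise[OF A(2,3)] V unfolding Z_def by (intro mult_left_mono)
    finally show "(\<Sum>t<m. \<xi> t * H t)\<^sup>2 \<le> (c * (r * real m))\<^sup>2" by (simp add: power_mult_distrib c)
    show "0 \<le> c * (r * real m)" using c r by simp
  qed
  have n2: "(\<Sum>t<m. d t * H t) \<le> 5/4 * c * \<eta> * real m"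
  proof (rule power2_le_imp_le)
    have "(\<Sum>t<m. d t * H t)\<^sup>2 \<le> (\<Sum>t<m. (d t)\<^sup>2) * (\<Sum>t<m. (H t)\<^sup>2)"
      by (rule Cauchy_Schwarz_ineq_sum)
    also have "\<dots> \<le> (real m * \<eta>\<^sup>2) * (5/4 * real m * V)"
    proof (intro mult_mono iso sum_nonneg)
      have "(d t)\<^sup>2 \<le> \<eta>\<^sup>2" for t
        using F[OF Xc, of t] by (metis abs_le_square_iff abs_of_nonneg \<eta> d_def)
      then show "(\<Sum>t<m. (d t)\<^sup>2) \<le> real m * \<eta>\<^sup>2"
        using sum_bounded_above[of "{..<m}" "\<lambda>t. (d t)\<^sup>2" "\<eta>\<^sup>2"] by simp
    qed auto
    also have "\<dots> = (5/4) * (V * \<eta>\<^sup>2 * (real m)\<^sup>2)"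
      by (simp add: power2_eq_square)
    \<comment> \<open>Squares the constant \<open>5/4\<close>, so that no \<open>sqrt (5/4)\<close>
      appears in the bound.\<close>
    also have "\<dots> \<le> (25/16) * (V * \<eta>\<^sup>2 * (real m)\<^sup>2)"
      using V by (intro mult_right_mono) auto
    also have "\<dots> = (5/4 * c * \<eta> * real m)\<^sup>2"
      by (simp only: power_mult_distrib c(2)) (simp add: power2_eq_square)
    finally show "(\<Sum>t<m. d t * H t)\<^sup>2 \<le> (5/4 * c * \<eta> * real m)\<^sup>2" .
    show "0 \<le> 5/4 * c * \<eta> * real m" using c \<eta> by simp
  qed
  have "c \<le> 3 * r + 4 * \<eta>"
  proof (cases "c = 0")
    case False
    then have "c > 0" using c by simp
    have "3/4 * real m * V \<le> 2 * (5/4 * c * \<eta> * real m) + 2 * (c * (r * real m))"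
      using basic iso n1 n2 by linarith
    then have "3/4 * real m * (c * c) \<le> 2 * (5/4 * c * \<eta> * real m) + 2 * (c * (r * real m))"
      by (simp only: c(2)[symmetric] power2_eq_square)
    then have "(real m * c) * (3/4 * c) \<le> (real m * c) * (5/2 * \<eta> + 2 * r)" by (simp add: algebra_simps)
    then have "3/4 * c \<le> 5/2 * \<eta> + 2 * r" using m \<open>c > 0\<close> by (subst (asm) mult_le_cancel_left_pos) auto
    then show ?thesis using r \<eta> by linarith
  qed (use r \<eta> in auto)
  then have "sqrt (2 * real s) * c \<le> sqrt (2 * real s) * (3 * r + 4 * \<eta>)"
    by (intro mult_left_mono) auto
  moreover have "\<bar>wpoly n h x\<bar> \<le> sqrt (real (card A) * (\<Sum>S\<in>A. (h S)\<^sup>2))"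
    using A(2) out x by (intro wpoly_sup_le)
  then have "\<bar>wpoly n \<psi> x - wpoly n \<phi> x\<bar> \<le> sqrt (2 * real s) * c"
    by (simp add: wpoly_def h_def sum_subtractf[symmetric] left_diff_distrib A(3) V_def c_def real_sqrt_mult)
  ultimately show ?thesis using F[OF x] by linarith
qed

text \<open>The values on the design are at most 1 in modulus, so restricted isometry bounds the
  squared coefficients by \<open>4/3\<close> in sum. Hence the target lies in the box covered by the
  net.\<close>

lemma sparse_coefficients_bounded:
  assumes X: "low_coherence n s m X" and s: "1 \<le> s" and m: "m > 0"
    and sp: "card {S \<in> Pow {1..n}. \<theta> S \<noteq> 0} \<le> s"
    and F: "\<And>x. x \<in> cube n \<Longrightarrow> \<bar>wpoly n \<theta> x\<bar> \<le> 1" and S: "S \<subseteq> {1..n}"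
  shows "\<bar>\<theta> S\<bar> \<le> 2"
proof (cases "\<theta> S = 0")
  case False
  define A where "A = {S \<in> Pow {1..n}. \<theta> S \<noteq> 0}"
  have A: "A \<subseteq> Pow {1..n}" "card A \<le> 2 * s" "finite A" "S \<in> A" using sp S False
    by (auto simp: A_def)
  have Xc: "X t \<in> cube n" for t using X by (auto simp: low_coherence_def)
  have eq: "wpoly n \<theta> y = (\<Sum>S\<in>A. \<theta> S * walsh S y)" for y
    by (rule wpoly_restrict) (auto simp: A_def)
  have "(\<Sum>t<m. (\<Sum>S\<in>A. \<theta> S * walsh S (X t))\<^sup>2) \<le> real m * 1"
  proof -
    have "(wpoly n \<theta> (X t))\<^sup>2 \<le> 1" for t using F[OF Xc[of t]] by (simp add: abs_square_le_1)
    then show ?thesis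
      using sum_bounded_above[of "{..<m}" "\<lambda>t. (wpoly n \<theta> (X t))\<^sup>2" 1] by (simp add: eq)
  qed
  then have "real m * (3/4 * (\<Sum>S\<in>A. (\<theta> S)\<^sup>2)) \<le> real m * 1"
    using restricted_isometry[OF X s A(1,2), of \<theta>] by linarith
  then have "3/4 * (\<Sum>S\<in>A. (\<theta> S)\<^sup>2) \<le> 1" using m by (subst (asm) mult_le_cancel_left_pos) auto
  moreover have "(\<theta> S)\<^sup>2 \<le> (\<Sum>S\<in>A. (\<theta> S)\<^sup>2)" using A by (intro member_le_sum) auto
  ultimately have "\<bar>\<theta> S\<bar>\<^sup>2 \<le> 2\<^sup>2" by simp
  then show ?thesis by (rule power2_le_imp_le) simp
qed simp

text \<open>Reduces measurable selection to discrete spaces: once the random set of admissible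
  candidates is measurable, any choice from it is a function on a finite discrete space. Serves both
  the least-squares estimate and the decoder of the lower bound.\<close>

lemma measurable_Collect_finite:
  assumes "finite I" "\<And>i. i \<in> I \<Longrightarrow> {w \<in> space M. P i w} \<in> sets M"
  shows "(\<lambda>w. {i \<in> I. P i w}) \<in> M \<rightarrow>\<^sub>M count_space (Pow I)"
proof -
  have "(\<lambda>w. {i \<in> I. P i w}) -` {B} \<inter> space M \<in> sets M" if "B \<in> Pow I" for B
  proof -
    have "(\<lambda>w. {i \<in> I. P i w}) -` {B} \<inter> space M
        = {w \<in> space M. \<forall>i\<in>I. (if i \<in> B then P i w else \<not> P i w)}"
      using that by auto
    also have "\<dots> \<in> sets M"
    proof (rule sets.sets_Collect_finite_All[OF _ assms(1)])
      fix i assume i: "i \<in> I"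
      show "{w \<in> space M. if i \<in> B then P i w else \<not> P i w} \<in> sets M"
        using assms(2)[OF i] sets.sets_Collect_neg[OF assms(2)[OF i]] by (cases "i \<in> B") auto
    qed
    finally show ?thesis .
  qed
  then show ?thesis using assms(1) by (subst measurable_count_space_eq2) auto
qed

lemma transcript_nonadaptive:
  assumes "t < m" "\<And>t u h. q t u h = X t"
  shows "snd (transcript q f u \<xi> m t) = f (X t) + \<xi> t"
  using assms(1) by (induction m) (auto simp: Let_def assms(2) less_Suc_eq)

lemma learnable_least_squares:
  assumes s: "1 \<le> s" "s \<le> n" and \<sigma>: "\<sigma> > 0" and \<epsilon>: "\<epsilon> > 0" and \<delta>: "0 < \<delta>"
    and m1: "real m \<ge> 512 * real n * (real s)\<^sup>2"
    and m2: "real m \<ge> 32400 * real s * \<sigma>\<^sup>2 * (4 * real n * real s + ln (1 / \<delta>)) / \<epsilon>\<^sup>2"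
  shows "learnable n \<sigma> (sparse_class n s) \<epsilon> \<delta> m"
proof -
  obtain X where X: "low_coherence n s m X"
    using low_coherence_design[of n s m] s m1 by auto
  have Xc: "X t \<in> cube n" for t using X by (auto simp: low_coherence_def)
  have m: "m > 0"
  proof -
    have "0 < 512 * real n * (real s)\<^sup>2" using s by simp
    then show ?thesis using m1 by linarith
  qed
  define S where "S = sqrt (2 * real s)"
  have S: "S \<ge> 1" "S\<^sup>2 = 2 * real s" using s by (auto simp: S_def)
  \<comment> \<open>Error budget in \<open>least_squares_error\<close>: noise takes
    \<open>\<epsilon> / 2\<close>, the net inside the root takes \<open>4 * \<epsilon> / 10\<close>,
    and the last \<open>\<eta>\<close> at most \<open>\<epsilon> / 10\<close>.\<close>
  define r where "r = \<epsilon> / (6 * S)"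
  define \<eta> where "\<eta> = \<epsilon> / (10 * S)"
  have r: "r \<ge> 0" and \<eta>: "\<eta> > 0" using \<epsilon> S by (auto simp: r_def \<eta>_def)
  have err: "S * (3 * r + 4 * \<eta>) + \<eta> \<le> \<epsilon>"
  proof -
    have "S * (3 * r + 4 * \<eta>) = \<epsilon> / 2 + 4 * \<epsilon> / 10" using S by (simp add: r_def \<eta>_def field_simps)
    moreover have "\<eta> \<le> \<epsilon> / 10" using S \<epsilon> by (simp add: \<eta>_def field_simps)
    ultimately show ?thesis by simp
  qed
  obtain \<Phi> where finite_\<Phi>: "finite \<Phi>" and sparse_\<Phi>: "\<forall>\<phi>\<in>\<Phi>. card {S \<in> Pow {1..n}. \<phi> S \<noteq> 0} \<le> s"
    and net: "\<forall>\<theta>. card {S \<in> Pow {1..n}. \<theta> S \<noteq> 0} \<le> s \<longrightarrow> (\<forall>S. S \<subseteq> {1..n} \<longrightarrow> \<bar>\<theta> S\<bar> \<le> 2) \<longrightarrow>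
       (\<exists>\<phi>\<in>\<Phi>. \<forall>x\<in>cube n. \<bar>wpoly n \<theta> x - wpoly n \<phi> x\<bar> \<le> \<eta>)"
    by (rule finite_coefficient_net[OF \<eta>, of n s])
  define loss where "loss \<phi> h = (\<Sum>t<m. (snd (h t) - wpoly n \<phi> (X t))\<^sup>2)" for \<phi> and h :: history
  define best where "best h = {\<phi> \<in> \<Phi>. \<forall>\<psi>\<in>\<Phi>. loss \<phi> h \<le> loss \<psi> h}" for h
  define est where "est h = (SOME \<phi>. \<phi> \<in> best h)" for h
  have best: "est h \<in> best h" if "\<Phi> \<noteq> {}" for h
  proof -
    have "\<exists>\<phi>\<in>\<Phi>. \<forall>\<psi>\<in>\<Phi>. loss \<phi> h \<le> loss \<psi> h"
      using ex_min_if_finite[of "(\<lambda>\<phi>. loss \<phi> h) ` \<Phi>"] finite_\<Phi> that by (auto simp: not_less)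
    then show ?thesis unfolding est_def best_def by (intro someI_ex[of "\<lambda>\<phi>. \<phi> \<in> _"]) auto
  qed
  \<comment> \<open>The learner is deterministic: a point mass as seed and the fixed design as
    queries.\<close>
  define R where "R = return (borel :: real measure) 0"
  define q where "q t u h = X t" for t :: nat and u :: real and h :: history
  define g where "g u h = (\<lambda>x\<in>cube n. wpoly n (est h) x)" for u :: real and h
  have R: "prob_space R" unfolding R_def by (rule prob_space_return) simp
  have loss_meas [measurable]: "loss \<phi> \<in> borel_measurable (history_space n m)" for \<phi>
  proof -
    have Y: "(\<lambda>h. snd (h t)) \<in> borel_measurable (history_space n m)" if "t < m" for t
    proof -
      have "(\<lambda>h. h t) \<in> history_space n m \<rightarrow>\<^sub>M count_space (cube n) \<Otimes>\<^sub>M (borel :: real measure)"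
        unfolding history_space_def using that by (intro measurable_component_singleton) auto
      from measurable_compose[OF this measurable_snd] show ?thesis .
    qed
    show ?thesis
      unfolding loss_def
      by (intro borel_measurable_sum borel_measurable_power borel_measurable_diff borel_measurable_const Y) auto
  qed
  have best_meas: "best \<in> history_space n m \<rightarrow>\<^sub>M count_space (Pow \<Phi>)"
    unfolding best_def
  proof (rule measurable_Collect_finite[OF finite_\<Phi>])
    show "{h \<in> space (history_space n m). \<forall>\<psi>\<in>\<Phi>. loss \<phi> h \<le> loss \<psi> h} \<in> sets (history_space n m)" for \<phi>
      by (intro sets.sets_Collect_finite_All[OF _ finite_\<Phi>] borel_measurable_le loss_meas)
  qed
  have "(\<lambda>B. \<lambda>x\<in>cube n. wpoly n (SOME \<phi>. \<phi> \<in> B) x) \<in> count_space (Pow \<Phi>) \<rightarrow>\<^sub>M PiM (cube n) (\<lambda>_. borel)"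
    by (auto simp: space_PiM)
  from measurable_compose[OF measurable_compose[OF measurable_snd best_meas] this]
  have "(\<lambda>(u, h). g u h) \<in> R \<Otimes>\<^sub>M history_space n m \<rightarrow>\<^sub>M PiM (cube n) (\<lambda>_. borel)"
    by (simp add: g_def est_def case_prod_beta')
  moreover have "(\<lambda>(u, h). q t u h) \<in> R \<Otimes>\<^sub>M history_space n t \<rightarrow>\<^sub>M count_space (cube n)" for t
    unfolding q_def by (auto simp: Xc case_prod_beta')
  ultimately have L: "learner n m R q g" using R by (simp add: learner_def)
  have "measure (data_law m R N) (failure_event n m R q g N f \<epsilon>) \<le> \<delta>"
    if f: "f \<in> sparse_class n s" and N: "\<And>t. subgaussian \<sigma> (N t)" for f N
  proof -
    have probN: "prob_space (N t)" for t using N[of t] by (auto simp: subgaussian_def)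
    interpret PN: product_prob_space N "{..<m}" by (rule product_prob_spaceI[OF probN])
    interpret R: prob_space R by fact
    interpret P: pair_prob_space R "PiM {..<m} N" ..
    define Bad where "Bad = {\<xi> \<in> space (PiM {..<m} N). \<exists>A. A \<subseteq> Pow {1..n} \<and> card A = 2 * s \<and>
      (\<Sum>S\<in>A. (\<Sum>t<m. \<xi> t * walsh S (X t))\<^sup>2) > (r * real m)\<^sup>2}"
    have Bad: "Bad \<in> sets (PiM {..<m} N)"
      and PBad: "emeasure (PiM {..<m} N) Bad
      \<le> ennreal ((2 ^ n) ^ (2 * s) * 2 ^ (2 * s) * exp (- ((r * real m)\<^sup>2 / (450 * \<sigma>\<^sup>2 * real m))))"
      using sparse_noise_tail[OF \<sigma> N s(1) m X, where \<rho> = "(r * real m)\<^sup>2"] unfolding Bad_def by auto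
    obtain \<theta> where \<theta>: "f = (\<lambda>x\<in>cube n. wpoly n \<theta> x)" "card {S \<in> Pow {1..n}. \<theta> S \<noteq> 0} \<le> s"
      and nf: "linf_norm n f \<le> 1" using f by (auto simp: sparse_class_def wpoly_def)
    have f1: "\<bar>wpoly n \<theta> x\<bar> \<le> 1" if "x \<in> cube n" for x
    proof -
      have "\<bar>f x\<bar> \<le> linf_norm n f"
        unfolding linf_norm_def using that finite_cube by (intro Max_ge) auto
      then show ?thesis using nf \<theta>(1) that by simp
    qed
    obtain \<phi> where \<phi>: "\<phi> \<in> \<Phi>" "\<And>x. x \<in> cube n \<Longrightarrow> \<bar>wpoly n \<theta> x - wpoly n \<phi> x\<bar> \<le> \<eta>"
      using net \<theta>(2) sparse_coefficients_bounded[OF X s(1) m \<theta>(2) f1] by blast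
    have "failure_event n m R q g N f \<epsilon> \<subseteq> space R \<times> Bad"
    proof
      fix w assume w: "w \<in> failure_event n m R q g N f \<epsilon>"
      obtain u \<xi> where w_eq: "w = (u, \<xi>)" by force
      define h where "h = transcript q f u \<xi> m"
      have sp: "u \<in> space R" "\<xi> \<in> space (PiM {..<m} N)"
        and bad: "linf_norm n (\<lambda>x. f x - g u h x) > \<epsilon>"
        using w by (auto simp: failure_event_def data_law_def space_pair_measure w_eq h_def)
      have "\<xi> \<in> Bad"
      proof (rule ccontr)
        assume "\<xi> \<notin> Bad"
        then have noise: "(\<Sum>S\<in>A. (\<Sum>t<m. \<xi> t * walsh S (X t))\<^sup>2) \<le> (r * real m)\<^sup>2"
          if "A \<subseteq> Pow {1..n}" "card A = 2 * s" for A
          using that sp(2) unfolding Bad_def by (auto simp: not_less)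
        have e: "est h \<in> \<Phi>" "loss (est h) h \<le> loss \<phi> h"
          using best[of h] \<phi>(1) by (auto simp: best_def)
        have "loss \<psi> h = (\<Sum>t<m. (wpoly n \<theta> (X t) + \<xi> t - wpoly n \<psi> (X t))\<^sup>2)" for \<psi>
          unfolding loss_def h_def
          by (intro sum.cong refl) (subst transcript_nonadaptive[where X = X], auto simp: q_def \<theta>(1) Xc)
        then have le: "(\<Sum>t<m. (wpoly n \<theta> (X t) + \<xi> t - wpoly n (est h) (X t))\<^sup>2)
            \<le> (\<Sum>t<m. (wpoly n \<theta> (X t) + \<xi> t - wpoly n \<phi> (X t))\<^sup>2)"
          using e(2) by simp
        have "\<bar>f x - g u h x\<bar> \<le> \<epsilon>" if x: "x \<in> cube n" for x
        proof -
          have "\<bar>wpoly n \<theta> x - wpoly n (est h) x\<bar> \<le> S * (3 * r + 4 * \<eta>) + \<eta>"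
            unfolding S_def
            by (rule least_squares_error[OF X s m sparse_\<Phi>[rule_format, OF \<phi>(1)] sparse_\<Phi>[rule_format, OF e(1)] \<phi>(2) le r noise x])
          then show ?thesis using err x by (simp add: \<theta>(1) g_def)
        qed
        then have "linf_norm n (\<lambda>x. f x - g u h x) \<le> \<epsilon>"
          unfolding linf_norm_def using finite_cube cube_nonempty by (subst Max_le_iff) auto
        then show False using bad by simp
      qed
      then show "w \<in> space R \<times> Bad" using sp by (simp add: w_eq)
    qed
    then have "emeasure (data_law m R N) (failure_event n m R q g N f \<epsilon>)
        \<le> emeasure (R \<Otimes>\<^sub>M PiM {..<m} N) (space R \<times> Bad)"
      unfolding data_law_def using Bad by (intro emeasure_mono) auto
    also have "\<dots> = emeasure (PiM {..<m} N) Bad"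
      using Bad by (subst PN.emeasure_pair_measure_Times) (auto simp: R.emeasure_space_1)
    also have "\<dots> \<le> ennreal \<delta>"
    proof (rule order_trans[OF PBad], intro ennreal_leI)
      have e: "(2::real) \<le> exp 1" using exp_ge_add_one_self[of 1] by simp
      have "((2::real) ^ n) ^ (2 * s) * 2 ^ (2 * s) = 2 ^ (2 * n * s + 2 * s)"
        by (simp add: power_add power_mult[symmetric] mult_ac)
      also have "\<dots> \<le> 2 ^ (4 * n * s)" using s by (intro power_increasing) auto
      also have "\<dots> \<le> exp 1 ^ (4 * n * s)" using e by (intro power_mono) auto
      also have "\<dots> = exp (4 * real n * real s)" by (simp add: exp_of_nat_mult[symmetric])
      finally have c: "((2::real) ^ n) ^ (2 * s) * 2 ^ (2 * s) \<le> exp (4 * real n * real s)" .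
      \<comment> \<open>Here \<open>r\<^sup>2 = \<epsilon>\<^sup>2 / (72 * s)\<close>, and
        \<open>450 * 72 = 32400\<close>.\<close>
      have "(r * real m)\<^sup>2 / (450 * \<sigma>\<^sup>2 * real m) = real m * \<epsilon>\<^sup>2 / (32400 * real s * \<sigma>\<^sup>2)"
        using m S by (simp add: r_def power_mult_distrib power_divide field_simps power2_eq_square)
      moreover have "4 * real n * real s + ln (1 / \<delta>) \<le> real m * \<epsilon>\<^sup>2 / (32400 * real s * \<sigma>\<^sup>2)"
        using m2 \<epsilon> \<sigma> s by (simp add: field_simps)
      ultimately have "exp (- ((r * real m)\<^sup>2 / (450 * \<sigma>\<^sup>2 * real m)))
          \<le> exp (- (4 * real n * real s + ln (1 / \<delta>)))" by simp
      also have "\<dots> = exp (- (4 * real n * real s)) * \<delta>" using \<delta> by (simp add: exp_diff exp_add exp_minus ln_div field_simps)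
      finally have "(2 ^ n) ^ (2 * s) * 2 ^ (2 * s) * exp (- ((r * real m)\<^sup>2 / (450 * \<sigma>\<^sup>2 * real m)))
          \<le> exp (4 * real n * real s) * (exp (- (4 * real n * real s)) * \<delta>)"
        using c by (intro mult_mono) auto
      then show "(2 ^ n) ^ (2 * s) * 2 ^ (2 * s) * exp (- ((r * real m)\<^sup>2 / (450 * \<sigma>\<^sup>2 * real m))) \<le> \<delta>"
        by (simp add: mult.assoc[symmetric] exp_minus)
    qed
    finally show ?thesis
      unfolding data_law_def measure_def using \<delta> by (intro enn2real_leI) auto
  qed
  then show ?thesis unfolding learnable_def using L by blast
qed

section \<open>Change of measure\<close>

text \<open>The one-dimensional Cameron-Martin formula; the exponential is the density of the
  shifted Gaussian with respect to the centered one.\<close>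

lemma gaussian_shift:
  assumes "\<sigma> > 0" and [measurable]: "G \<in> borel_measurable borel"
  shows "(\<integral>\<^sup>+z. G (a + z) \<partial>gaussian \<sigma>)
    = (\<integral>\<^sup>+z. G z * ennreal (exp ((a * z - a\<^sup>2 / 2) / \<sigma>\<^sup>2)) \<partial>gaussian \<sigma>)"
proof -
  have *: "normal_density 0 \<sigma> (z - a) = normal_density 0 \<sigma> z * exp ((a * z - a\<^sup>2 / 2) / \<sigma>\<^sup>2)" for z
  proof -
    have "- (z - a)\<^sup>2 / (2 * \<sigma>\<^sup>2) = - z\<^sup>2 / (2 * \<sigma>\<^sup>2) + (a * z - a\<^sup>2 / 2) / \<sigma>\<^sup>2"
      using assms(1) by (simp add: field_simps power2_eq_square)
    then have "exp (- (z - a)\<^sup>2 / (2 * \<sigma>\<^sup>2)) = exp (- z\<^sup>2 / (2 * \<sigma>\<^sup>2)) * exp ((a * z - a\<^sup>2 / 2) / \<sigma>\<^sup>2)"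
      by (simp only: exp_add)
    then show ?thesis by (simp add: normal_density_def)
  qed
  have "(\<integral>\<^sup>+z. G (a + z) \<partial>gaussian \<sigma>) = (\<integral>\<^sup>+z. ennreal (normal_density 0 \<sigma> z) * G (a + z) \<partial>lborel)"
    by (subst nn_integral_density) auto
  also have "\<dots> = (\<integral>\<^sup>+z. ennreal (normal_density 0 \<sigma> (z - a)) * G z \<partial>lborel)"
    using nn_integral_real_affine[of "\<lambda>z. ennreal (normal_density 0 \<sigma> (z - a)) * G z" 1 a] by simp
  also have "\<dots> = (\<integral>\<^sup>+z. G z * ennreal (exp ((a * z - a\<^sup>2 / 2) / \<sigma>\<^sup>2)) \<partial>gaussian \<sigma>)"
    by (subst nn_integral_density) (auto simp: * ennreal_mult mult_ac)
  finally show ?thesis .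
qed

text \<open>Density of responses with means \<open>f\<close> against pure noise. Only responses
  contribute factors: given the seed and the past, a query is chosen in the same way under both
  laws.\<close>

definition likelihood_ratio :: "real \<Rightarrow> nat \<Rightarrow> ((nat \<Rightarrow> real) \<Rightarrow> real) \<Rightarrow> history \<Rightarrow> real" where
  "likelihood_ratio \<sigma> m f h = (\<Prod>t<m. exp ((f (fst (h t)) * snd (h t) - (f (fst (h t)))\<^sup>2 / 2) / \<sigma>\<^sup>2))"

lemma likelihood_ratio_pos: "likelihood_ratio \<sigma> m f h > 0"
  unfolding likelihood_ratio_def by (intro prod_pos) auto

lemma likelihood_ratio_measurable [measurable]:
  "likelihood_ratio \<sigma> m f \<in> borel_measurable (history_space n m)"
proof -
  have *: "(\<lambda>h. f (fst (h t))) \<in> borel_measurable (history_space n m)"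
    "(\<lambda>h. snd (h t)) \<in> borel_measurable (history_space n m)" if "t < m" for t
  proof -
    have 1: "(\<lambda>h. h t) \<in> history_space n m \<rightarrow>\<^sub>M count_space (cube n) \<Otimes>\<^sub>M (borel :: real measure)"
      unfolding history_space_def using that by (intro measurable_component_singleton) auto
    show "(\<lambda>h. snd (h t)) \<in> borel_measurable (history_space n m)"
      using measurable_compose[OF 1 measurable_snd] .
    show "(\<lambda>h. f (fst (h t))) \<in> borel_measurable (history_space n m)"
      using measurable_compose[OF measurable_compose[OF 1 measurable_fst], of f] by simp
  qed
  have "(\<lambda>h. exp ((f (fst (h t)) * snd (h t) - (f (fst (h t)))\<^sup>2 / 2) / \<sigma>\<^sup>2)) \<in> borel_measurable (history_space n m)"
    if "t < m" for t
  proof -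
    note [measurable] = *[OF that]
    show ?thesis by measurable
  qed
  then show ?thesis
    unfolding likelihood_ratio_def by (intro borel_measurable_prod) auto
qed

lemma transcript_cong:
  "(\<And>i. i < t \<Longrightarrow> \<xi> i = \<xi>' i) \<Longrightarrow> transcript q f u \<xi> t = transcript q f u \<xi>' t"
  by (induction t) (auto simp: Let_def)

text \<open>The output is a dummy. Stopping early allows the noise space to have exactly as many
  coordinates as rounds, which the induction on rounds needs.\<close>

lemma learner_truncate:
  assumes "learner n m R q g" "t \<le> m"
  shows "learner n t R q (\<lambda>_ _. \<lambda>x\<in>cube n. 0)"
  using assms unfolding learner_def by (auto simp: case_prod_beta' intro!: measurable_const simp: space_PiM)

lemma transcript_measurable_fixed_seed:
  assumes L: "learner n m R q g" and "t \<le> m" and u: "u \<in> space R"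
  shows "(\<lambda>\<xi>. transcript q f u \<xi> t) \<in> PiM {..<t} (\<lambda>_. gaussian \<sigma>) \<rightarrow>\<^sub>M history_space n t"
proof -
  have "(\<lambda>(u, \<xi>). transcript q f u \<xi> t) \<in> data_law t R (\<lambda>_. gaussian \<sigma>) \<rightarrow>\<^sub>M history_space n t"
    by (rule transcript_measurable[OF learner_truncate[OF assms(1,2)]]) auto
  from measurable_Pair2[OF this[unfolded data_law_def] u] show ?thesis by simp
qed

text \<open>Induction on rounds with the seed fixed. The last noise is integrated first: given the
  history, the last query is the same for \<open>f\<close> and for \<open>0\<close>, and its
  response differs only by a shift. Allowing an arbitrary nonnegative \<open>F\<close> lets the
  induction hypothesis absorb what remains.\<close>

lemma transcript_change_of_measure:
  assumes L: "learner n m R q g" and \<sigma>: "\<sigma> > 0" and u: "u \<in> space R" and "t \<le> m"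
    and "F \<in> borel_measurable (history_space n t)"
  shows "(\<integral>\<^sup>+\<xi>. F (transcript q f u \<xi> t) \<partial>PiM {..<t} (\<lambda>_. gaussian \<sigma>))
    = (\<integral>\<^sup>+\<xi>. F (transcript q (\<lambda>_. 0) u \<xi> t)
        * ennreal (likelihood_ratio \<sigma> t f (transcript q (\<lambda>_. 0) u \<xi> t)) \<partial>PiM {..<t} (\<lambda>_. gaussian \<sigma>))"
  using assms(4,5)
proof (induction t arbitrary: F)
  case 0
  then show ?case by (simp add: likelihood_ratio_def)
next
  case (Suc t)
  note F [measurable] = Suc.prems(2)
  interpret G: prob_space "gaussian \<sigma>" by (rule prob_space_gaussian[OF \<sigma>])
  interpret PG: product_prob_space "\<lambda>_::nat. gaussian \<sigma>" "{..<t}"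
    by (rule product_prob_spaceI[OF prob_space_gaussian[OF \<sigma>]])
  have tm: "t \<le> m" "t < m" using Suc by auto
  let ?HS = "history_space n t"
  have qm [measurable]: "q t u \<in> ?HS \<rightarrow>\<^sub>M count_space (cube n)"
  proof -
    have "(\<lambda>(u, h). q t u h) \<in> R \<Otimes>\<^sub>M ?HS \<rightarrow>\<^sub>M count_space (cube n)"
      using L tm by (simp add: learner_def)
    from measurable_Pair2[OF this u] show ?thesis by simp
  qed
  have upd: "(\<lambda>w. (fst w)(t := (q t u (fst w), snd w))) \<in> ?HS \<Otimes>\<^sub>M borel \<rightarrow>\<^sub>M history_space n (Suc t)"
  proof -
    have P: "(\<lambda>w. (q t u (fst w), snd w)) \<in> ?HS \<Otimes>\<^sub>M (borel :: real measure) \<rightarrow>\<^sub>M count_space (cube n) \<Otimes>\<^sub>M borel"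
      by measurable
    have "(\<lambda>w. (fst w)(t := (q t u (fst w), snd w)))
       \<in> ?HS \<Otimes>\<^sub>M (borel :: real measure) \<rightarrow>\<^sub>M PiM (insert t {..<t}) (\<lambda>_. count_space (cube n) \<Otimes>\<^sub>M borel)"
    proof (rule measurable_fun_upd[where J = "{..<t}"])
      show "(\<lambda>w. (q t u (fst w), snd w)) \<in> ?HS \<Otimes>\<^sub>M (borel :: real measure) \<rightarrow>\<^sub>M count_space (cube n) \<Otimes>\<^sub>M borel"
        by (rule P)
      show "fst \<in> ?HS \<Otimes>\<^sub>M (borel :: real measure) \<rightarrow>\<^sub>M PiM {..<t} (\<lambda>_. count_space (cube n) \<Otimes>\<^sub>M borel)"
        unfolding history_space_def[symmetric] by (rule measurable_fst)
    qed auto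
    then show ?thesis by (simp add: history_space_def lessThan_Suc)
  qed
  have Fupd: "(\<lambda>w. F ((fst w)(t := (q t u (fst w), snd w)))) \<in> borel_measurable (?HS \<Otimes>\<^sub>M borel)"
    by (rule measurable_compose[OF upd F])
  have fq [measurable]: "(\<lambda>H. f (q t u H)) \<in> borel_measurable ?HS"
    by (rule measurable_compose[OF qm]) simp
  define E where "E x z = ennreal (exp ((f x * z - (f x)\<^sup>2 / 2) / \<sigma>\<^sup>2))" for x z
  \<comment> \<open>What integrating the last response leaves of \<open>F\<close>, as a function of
    the earlier history; this is the \<open>F\<close> of the induction hypothesis.\<close>
  define \<Psi> where "\<Psi> H = (\<integral>\<^sup>+z. F (H(t := (q t u H, z))) * E (q t u H) z \<partial>gaussian \<sigma>)" for H
  have \<Psi> [measurable]: "\<Psi> \<in> borel_measurable ?HS"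
  proof -
    have "(\<lambda>w. F ((fst w)(t := (q t u (fst w), snd w))) * E (q t u (fst w)) (snd w)) \<in> borel_measurable (?HS \<Otimes>\<^sub>M gaussian \<sigma>)"
    proof (subst measurable_cong_sets[OF sets_pair_measure_cong[OF refl] refl])
      show "sets (gaussian \<sigma>) = sets borel" by simp
      have "(\<lambda>w. E (q t u (fst w)) (snd w)) \<in> borel_measurable (?HS \<Otimes>\<^sub>M (borel :: real measure))"
        unfolding E_def by measurable
      with Fupd show "(\<lambda>w. F ((fst w)(t := (q t u (fst w), snd w))) * E (q t u (fst w)) (snd w))
          \<in> borel_measurable (?HS \<Otimes>\<^sub>M (borel :: real measure))"
        by (rule borel_measurable_times_ennreal)
    qed
    then show ?thesis
      unfolding \<Psi>_def by (intro G.borel_measurable_nn_integral) (simp add: case_prod_beta')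
  qed
  have shift: "(\<integral>\<^sup>+z. F (H(t := (q t u H, f (q t u H) + z))) \<partial>gaussian \<sigma>) = \<Psi> H" if H: "H \<in> space ?HS" for H
  proof -
    have "(\<lambda>z. F (H(t := (q t u H, z)))) \<in> borel_measurable borel"
      using measurable_Pair2[OF Fupd H] by simp
    from gaussian_shift[OF \<sigma> this, of "f (q t u H)"] show ?thesis unfolding \<Psi>_def E_def .
  qed
  have step: "transcript q f u (\<xi>(t := z)) (Suc t)
      = (transcript q f u \<xi> t)(t := (q t u (transcript q f u \<xi> t), f (q t u (transcript q f u \<xi> t)) + z))" for f \<xi> z
  proof -
    have "transcript q f u (\<xi>(t := z)) t = transcript q f u \<xi> t" by (rule transcript_cong) auto
    then show ?thesis by (simp add: Let_def)
  qed
  have tr: "(\<lambda>\<xi>. transcript q f u \<xi> t) \<in> PiM {..<t} (\<lambda>_. gaussian \<sigma>) \<rightarrow>\<^sub>M ?HS" for f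
    by (rule transcript_measurable_fixed_seed[OF L tm(1) u])
  have trS [measurable]: "(\<lambda>\<xi>. transcript q f u \<xi> (Suc t)) \<in> PiM {..<Suc t} (\<lambda>_. gaussian \<sigma>) \<rightarrow>\<^sub>M history_space n (Suc t)" for f
    by (rule transcript_measurable_fixed_seed[OF L Suc.prems(1) u])
  let ?T0 = "\<lambda>\<xi>. transcript q (\<lambda>_. 0) u \<xi> t"
  have lhs: "(\<integral>\<^sup>+\<xi>. F (transcript q f u \<xi> (Suc t)) \<partial>PiM {..<Suc t} (\<lambda>_. gaussian \<sigma>))
      = (\<integral>\<^sup>+\<xi>. \<Psi> (transcript q f u \<xi> t) \<partial>PiM {..<t} (\<lambda>_. gaussian \<sigma>))"
  proof -
    have "(\<integral>\<^sup>+\<xi>. F (transcript q f u \<xi> (Suc t)) \<partial>PiM {..<Suc t} (\<lambda>_. gaussian \<sigma>))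
        = (\<integral>\<^sup>+\<xi>. (\<integral>\<^sup>+z. F (transcript q f u (\<xi>(t := z)) (Suc t)) \<partial>gaussian \<sigma>) \<partial>PiM {..<t} (\<lambda>_. gaussian \<sigma>))"
      unfolding lessThan_Suc
    proof (rule PG.product_nn_integral_insert)
      show "(\<lambda>\<xi>. F (transcript q f u \<xi> (Suc t))) \<in> borel_measurable (PiM (insert t {..<t}) (\<lambda>_. gaussian \<sigma>))"
        using measurable_compose[OF trS F, of f] by (simp add: lessThan_Suc)
    qed auto
    also have "\<dots> = (\<integral>\<^sup>+\<xi>. \<Psi> (transcript q f u \<xi> t) \<partial>PiM {..<t} (\<lambda>_. gaussian \<sigma>))"
      unfolding step by (intro nn_integral_cong shift measurable_space[OF tr])
    finally show ?thesis .
  qed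
  have rhs: "(\<integral>\<^sup>+\<xi>. F (transcript q (\<lambda>_. 0) u \<xi> (Suc t))
        * ennreal (likelihood_ratio \<sigma> (Suc t) f (transcript q (\<lambda>_. 0) u \<xi> (Suc t))) \<partial>PiM {..<Suc t} (\<lambda>_. gaussian \<sigma>))
      = (\<integral>\<^sup>+\<xi>. \<Psi> (?T0 \<xi>) * ennreal (likelihood_ratio \<sigma> t f (?T0 \<xi>)) \<partial>PiM {..<t} (\<lambda>_. gaussian \<sigma>))"
  proof -
    have FL: "(\<lambda>h. F h * ennreal (likelihood_ratio \<sigma> (Suc t) f h)) \<in> borel_measurable (history_space n (Suc t))"
      by measurable
    have "(\<integral>\<^sup>+\<xi>. F (transcript q (\<lambda>_. 0) u \<xi> (Suc t))
        * ennreal (likelihood_ratio \<sigma> (Suc t) f (transcript q (\<lambda>_. 0) u \<xi> (Suc t))) \<partial>PiM {..<Suc t} (\<lambda>_. gaussian \<sigma>))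
      = (\<integral>\<^sup>+\<xi>. (\<integral>\<^sup>+z. F (transcript q (\<lambda>_. 0) u (\<xi>(t := z)) (Suc t))
        * ennreal (likelihood_ratio \<sigma> (Suc t) f (transcript q (\<lambda>_. 0) u (\<xi>(t := z)) (Suc t))) \<partial>gaussian \<sigma>) \<partial>PiM {..<t} (\<lambda>_. gaussian \<sigma>))"
      unfolding lessThan_Suc
    proof (rule PG.product_nn_integral_insert)
      show "(\<lambda>\<xi>. F (transcript q (\<lambda>_. 0) u \<xi> (Suc t))
        * ennreal (likelihood_ratio \<sigma> (Suc t) f (transcript q (\<lambda>_. 0) u \<xi> (Suc t))))
        \<in> borel_measurable (PiM (insert t {..<t}) (\<lambda>_. gaussian \<sigma>))"
        using measurable_compose[OF trS FL] unfolding lessThan_Suc .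
    qed auto
    also have "\<dots> = (\<integral>\<^sup>+\<xi>. \<Psi> (?T0 \<xi>) * ennreal (likelihood_ratio \<sigma> t f (?T0 \<xi>)) \<partial>PiM {..<t} (\<lambda>_. gaussian \<sigma>))"
    proof (intro nn_integral_cong)
      fix \<xi> assume \<xi>: "\<xi> \<in> space (PiM {..<t} (\<lambda>_. gaussian \<sigma>))"
      define H where "H = ?T0 \<xi>"
      have H: "H \<in> space ?HS" unfolding H_def by (rule measurable_space[OF tr \<xi>])
      have lr: "likelihood_ratio \<sigma> (Suc t) f (H(t := (x, z)))
          = likelihood_ratio \<sigma> t f H * exp ((f x * z - (f x)\<^sup>2 / 2) / \<sigma>\<^sup>2)" for x z
        by (simp add: likelihood_ratio_def)
      have Em: "(\<lambda>z. F (H(t := (q t u H, z))) * E (q t u H) z) \<in> borel_measurable (gaussian \<sigma>)"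
        using measurable_Pair2[OF Fupd H] unfolding E_def by simp
      have "(\<integral>\<^sup>+z. F (transcript q (\<lambda>_. 0) u (\<xi>(t := z)) (Suc t))
        * ennreal (likelihood_ratio \<sigma> (Suc t) f (transcript q (\<lambda>_. 0) u (\<xi>(t := z)) (Suc t))) \<partial>gaussian \<sigma>)
        = (\<integral>\<^sup>+z. F (H(t := (q t u H, z))) * E (q t u H) z * ennreal (likelihood_ratio \<sigma> t f H) \<partial>gaussian \<sigma>)"
        unfolding step H_def[symmetric]
        by (intro nn_integral_cong)
          (simp add: lr E_def ennreal_mult less_imp_le[OF likelihood_ratio_pos] mult_ac)
      also have "\<dots> = \<Psi> H * ennreal (likelihood_ratio \<sigma> t f H)"
        unfolding \<Psi>_def by (rule nn_integral_multc[OF Em])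
      finally show "(\<integral>\<^sup>+z. F (transcript q (\<lambda>_. 0) u (\<xi>(t := z)) (Suc t))
        * ennreal (likelihood_ratio \<sigma> (Suc t) f (transcript q (\<lambda>_. 0) u (\<xi>(t := z)) (Suc t))) \<partial>gaussian \<sigma>)
        = \<Psi> (?T0 \<xi>) * ennreal (likelihood_ratio \<sigma> t f (?T0 \<xi>))" by (simp add: H_def)
    qed
    finally show ?thesis .
  qed
  show ?case unfolding lhs rhs by (rule Suc.IH[OF tm(1) \<Psi>])
qed

lemma transcript_response:
  "t < m \<Longrightarrow> snd (transcript q f u \<xi> m t) = f (fst (transcript q f u \<xi> m t)) + \<xi> t"
  by (induction m) (auto simp: Let_def less_Suc_eq)

section \<open>One sample space carrying the laws for all target functions\<close>

locale gaussian_experiment =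
  fixes n m :: nat and R :: "real measure" and q g and \<sigma> :: real
  assumes learner: "learner n m R q g" and \<sigma>: "\<sigma> > 0"
begin

definition D :: "(real \<times> (nat \<Rightarrow> real)) measure" where "D = data_law m R (\<lambda>_. gaussian \<sigma>)"

definition null_history :: "real \<times> (nat \<Rightarrow> real) \<Rightarrow> history" where
  "null_history w = transcript q (\<lambda>_. 0) (fst w) (snd w) m"

text \<open>For the function \<open>0\<close> the responses are the noises, so the law of the transcript under any \<open>f\<close>
  has a density with respect to the data law with \<open>0\<close> in place of \<open>f\<close>.\<close>

definition W :: "((nat \<Rightarrow> real) \<Rightarrow> real) \<Rightarrow> real \<times> (nat \<Rightarrow> real) \<Rightarrow> real" where
  "W f w = likelihood_ratio \<sigma> m f (null_history w)"

definition P :: "((nat \<Rightarrow> real) \<Rightarrow> real) \<Rightarrow> (real \<times> (nat \<Rightarrow> real)) measure" where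
  "P f = density D (\<lambda>w. ennreal (W f w))"

text \<open>Written with \<open>null_history\<close> for every \<open>f\<close>: the output at a
  sample point is then one and the same for all targets, so bad events of different targets can be
  compared there, and only the measure \<open>P f\<close> changes.\<close>

definition bad :: "real \<Rightarrow> ((nat \<Rightarrow> real) \<Rightarrow> real) \<Rightarrow> (real \<times> (nat \<Rightarrow> real)) set" where
  "bad \<epsilon> f = {w \<in> space D. linf_norm n (\<lambda>x. f x - g (fst w) (null_history w) x) > \<epsilon>}"

lemma prob_space_R: "prob_space R" using learner by (simp add: learner_def)

lemma prob_space_PiM_gaussian: "prob_space (PiM {..<m} (\<lambda>_. gaussian \<sigma>))"
  by (intro prob_space_PiM prob_space_gaussian \<sigma>)

lemma prob_space_D: "prob_space D"
proof -
  interpret R: prob_space R by (rule prob_space_R)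
  interpret G: prob_space "PiM {..<m} (\<lambda>_. gaussian \<sigma>)" by (rule prob_space_PiM_gaussian)
  interpret pair_prob_space R "PiM {..<m} (\<lambda>_. gaussian \<sigma>)" ..
  show ?thesis unfolding D_def data_law_def by (rule prob_space_axioms)
qed

lemma transcript_meas: "(\<lambda>w. transcript q f (fst w) (snd w) m) \<in> D \<rightarrow>\<^sub>M history_space n m"
  using transcript_measurable[OF learner _ order_refl, of "\<lambda>_. gaussian \<sigma>" f]
  by (simp add: D_def case_prod_beta')

lemma null_history_measurable [measurable]: "null_history \<in> D \<rightarrow>\<^sub>M history_space n m"
  using transcript_meas unfolding null_history_def .

lemma fst_measurable_D [measurable]: "fst \<in> D \<rightarrow>\<^sub>M R"
  unfolding D_def data_law_def by (rule measurable_fst)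

lemma W_measurable [measurable]: "W f \<in> borel_measurable D"
  unfolding W_def by measurable

lemma W_pos: "W f w > 0"
  unfolding W_def by (rule likelihood_ratio_pos)

lemma sets_P [simp]: "sets (P f) = sets D" and space_P [simp]: "space (P f) = space D"
  by (simp_all add: P_def)

lemma query_in_cube:
  assumes "w \<in> space D" "t < m"
  shows "fst (null_history w t) \<in> cube n"
proof -
  have mem: "null_history w \<in> {..<m} \<rightarrow>\<^sub>E cube n \<times> UNIV"
    using measurable_space[OF null_history_measurable assms(1)]
    by (simp add: history_space_def space_PiM space_pair_measure)
  show ?thesis using PiE_mem[OF mem, of t] assms(2) by (simp add: mem_Times_iff)
qed

lemma W_eq:
  "W f w = exp (\<Sum>t<m. (f (fst (null_history w t)) * snd w t - (f (fst (null_history w t)))\<^sup>2 / 2) / \<sigma>\<^sup>2)"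
  unfolding W_def likelihood_ratio_def exp_sum[OF finite_lessThan]
  by (intro prod.cong refl) (simp add: null_history_def transcript_response)

lemma change_of_measure:
  assumes G [measurable]: "G \<in> borel_measurable (R \<Otimes>\<^sub>M history_space n m)"
  shows "(\<integral>\<^sup>+w. G (fst w, transcript q f (fst w) (snd w) m) \<partial>D)
    = (\<integral>\<^sup>+w. G (fst w, null_history w) * ennreal (W f w) \<partial>D)"
proof -
  interpret N: prob_space "PiM {..<m} (\<lambda>_. gaussian \<sigma>)" by (rule prob_space_PiM_gaussian)
  note [measurable] = transcript_meas
  have 1: "(\<lambda>w. G (fst w, transcript q f (fst w) (snd w) m)) \<in> borel_measurable (R \<Otimes>\<^sub>M PiM {..<m} (\<lambda>_. gaussian \<sigma>))"
    unfolding data_law_def[symmetric] D_def[symmetric] by measurable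
  have 2: "(\<lambda>w. G (fst w, null_history w) * ennreal (W f w)) \<in> borel_measurable (R \<Otimes>\<^sub>M PiM {..<m} (\<lambda>_. gaussian \<sigma>))"
    unfolding data_law_def[symmetric] D_def[symmetric] by measurable
  have "(\<integral>\<^sup>+w. G (fst w, transcript q f (fst w) (snd w) m) \<partial>D)
      = (\<integral>\<^sup>+u. \<integral>\<^sup>+\<xi>. G (u, transcript q f u \<xi> m) \<partial>PiM {..<m} (\<lambda>_. gaussian \<sigma>) \<partial>R)"
    unfolding D_def data_law_def using N.nn_integral_fst[OF 1] by simp
  also have "\<dots> = (\<integral>\<^sup>+u. \<integral>\<^sup>+\<xi>. G (u, null_history (u, \<xi>)) * ennreal (W f (u, \<xi>)) \<partial>PiM {..<m} (\<lambda>_. gaussian \<sigma>) \<partial>R)"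
  proof (rule nn_integral_cong)
    fix u assume u: "u \<in> space R"
    show "(\<integral>\<^sup>+\<xi>. G (u, transcript q f u \<xi> m) \<partial>PiM {..<m} (\<lambda>_. gaussian \<sigma>))
        = (\<integral>\<^sup>+\<xi>. G (u, null_history (u, \<xi>)) * ennreal (W f (u, \<xi>)) \<partial>PiM {..<m} (\<lambda>_. gaussian \<sigma>))"
      using transcript_change_of_measure[OF learner \<sigma> u order_refl measurable_Pair2[OF G u], of f]
      by (simp add: null_history_def W_def)
  qed
  also have "\<dots> = (\<integral>\<^sup>+w. G (fst w, null_history w) * ennreal (W f w) \<partial>D)"
    unfolding D_def data_law_def using N.nn_integral_fst[OF 2] by simp
  finally show ?thesis .
qed

text \<open>Valid for every \<open>f\<close>, inside the class or not; the comparison functions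
  \<open>p\<close> and \<open>2 f - p\<close> used later rely on this.\<close>

lemma prob_space_P: "prob_space (P f)"
proof
  interpret D: prob_space D by (rule prob_space_D)
  have "(\<integral>\<^sup>+w. ennreal (W f w) \<partial>D) = 1"
    using change_of_measure[of "\<lambda>_. 1" f] D.emeasure_space_1 by simp
  then show "emeasure (P f) (space (P f)) = 1"
    unfolding P_def by (simp add: emeasure_density cong: nn_integral_cong)
qed

lemma estimation_error_measurable:
  "{w \<in> space (R \<Otimes>\<^sub>M history_space n m). linf_norm n (\<lambda>x. f x - g (fst w) (snd w) x) > \<epsilon>}
    \<in> sets (R \<Otimes>\<^sub>M history_space n m)"
proof -
  let ?M = "R \<Otimes>\<^sub>M history_space n m"
  have "(\<lambda>(u, h). g u h) \<in> ?M \<rightarrow>\<^sub>M PiM (cube n) (\<lambda>_. borel)"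
    using learner by (simp add: learner_def)
  then have G: "(\<lambda>w. g (fst w) (snd w)) \<in> ?M \<rightarrow>\<^sub>M PiM (cube n) (\<lambda>_. borel)"
    by (simp add: case_prod_beta')
  have Gx: "(\<lambda>w. g (fst w) (snd w) x) \<in> borel_measurable ?M" if "x \<in> cube n" for x
    by (rule measurable_compose[OF G measurable_component_singleton[OF that]])
  have *: "{w \<in> space ?M. linf_norm n (\<lambda>x. f x - g (fst w) (snd w) x) > \<epsilon>} =
     (\<Union>x\<in>cube n. {w \<in> space ?M. \<epsilon> < \<bar>f x - g (fst w) (snd w) x\<bar>})"
    unfolding linf_norm_def using finite_cube cube_nonempty by (auto simp: Max_gr_iff)
  show ?thesis
    unfolding * using finite_cube
  proof (intro sets.finite_UN)
    fix x assume "x \<in> cube n"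
    note [measurable] = Gx[OF this]
    show "{w \<in> space ?M. \<epsilon> < \<bar>f x - g (fst w) (snd w) x\<bar>} \<in> sets ?M" by measurable
  qed
qed

lemma bad_measurable [measurable]: "bad \<epsilon> f \<in> sets D"
proof -
  have "(\<lambda>w. (fst w, null_history w)) \<in> D \<rightarrow>\<^sub>M R \<Otimes>\<^sub>M history_space n m" by measurable
  from measurable_sets[OF this estimation_error_measurable[where f = f and \<epsilon> = \<epsilon>]] measurable_space[OF this]
  show ?thesis
    by (auto simp: bad_def vimage_def Int_def conj_commute cong: conj_cong)
qed

text \<open>The change of measure applied to the indicator of a large estimation error. Through this
  equation the guarantee of the learner enters the lower bounds.\<close>

lemma measure_P_bad:
  "measure (P f) (bad \<epsilon> f) = measure (data_law m R (\<lambda>_. gaussian \<sigma>)) (failure_event n m R q g (\<lambda>_. gaussian \<sigma>) f \<epsilon>)"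
proof -
  let ?E = "{w \<in> space (R \<Otimes>\<^sub>M history_space n m). linf_norm n (\<lambda>x. f x - g (fst w) (snd w) x) > \<epsilon>}"
  have null: "(fst w, null_history w) \<in> space (R \<Otimes>\<^sub>M history_space n m)"
    and tr: "(fst w, transcript q f (fst w) (snd w) m) \<in> space (R \<Otimes>\<^sub>M history_space n m)" if "w \<in> space D" for w
    using measurable_space[OF null_history_measurable that] measurable_space[OF fst_measurable_D that]
      measurable_space[OF transcript_meas that] by (auto simp: space_pair_measure)
  have fe: "failure_event n m R q g (\<lambda>_. gaussian \<sigma>) f \<epsilon> \<in> sets D"
    unfolding D_def by (rule failure_event_measurable[OF learner]) simp
  have "emeasure (P f) (bad \<epsilon> f) = (\<integral>\<^sup>+w. ennreal (W f w) * indicator (bad \<epsilon> f) w \<partial>D)"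
    unfolding P_def by (rule emeasure_density) auto
  also have "\<dots> = (\<integral>\<^sup>+w. indicator ?E (fst w, null_history w) * ennreal (W f w) \<partial>D)"
    by (intro nn_integral_cong) (use null in \<open>auto simp: bad_def indicator_def\<close>)
  also have "\<dots> = (\<integral>\<^sup>+w. indicator ?E (fst w, transcript q f (fst w) (snd w) m) \<partial>D)"
    by (rule change_of_measure[symmetric]) (use estimation_error_measurable[where f = f and \<epsilon> = \<epsilon>] in auto)
  also have "\<dots> = (\<integral>\<^sup>+w. indicator (failure_event n m R q g (\<lambda>_. gaussian \<sigma>) f \<epsilon>) w \<partial>D)"
    by (intro nn_integral_cong) (use tr in \<open>auto simp: failure_event_def D_def indicator_def\<close>)
  also have "\<dots> = emeasure D (failure_event n m R q g (\<lambda>_. gaussian \<sigma>) f \<epsilon>)"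
    using fe by simp
  finally show ?thesis unfolding measure_def D_def by simp
qed

lemma noise_sum_measurable [measurable]: "(\<lambda>w. \<Sum>t<m. snd w t) \<in> borel_measurable D"
proof -
  have "(\<lambda>w. snd w t) \<in> borel_measurable D" if "t < m" for t
  proof -
    have "(\<lambda>w. snd w t) \<in> D \<rightarrow>\<^sub>M gaussian \<sigma>"
      unfolding D_def data_law_def using that
      by (intro measurable_compose[OF measurable_snd] measurable_component_singleton) auto
    then show ?thesis by simp
  qed
  then show ?thesis by (intro borel_measurable_sum) auto
qed

lemma noise_sum_lower_tail:
  "measure D {w \<in> space D. (\<Sum>t<m. snd w t) < - (2 * \<sigma> * sqrt (real m))} \<le> 1/4"
proof (cases "m = 0")
  case False
  interpret D: prob_space D by (rule prob_space_D)
  interpret R: prob_space R by (rule prob_space_R)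
  interpret N: prob_space "PiM {..<m} (\<lambda>_. gaussian \<sigma>)" by (rule prob_space_PiM_gaussian)
  interpret PG: product_prob_space "\<lambda>_::nat. gaussian \<sigma>" "{..<m}"
    by (rule product_prob_spaceI[OF prob_space_gaussian[OF \<sigma>]])
  \<comment> \<open>Optimal Chernoff parameter: the threshold contributes -4 and the moments +2, and
    \<open>exp (-2) \<le> 1/4\<close>.\<close>
  define l where "l = 2 / (\<sigma> * sqrt (real m))"
  have l: "l > 0" using \<sigma> False by (simp add: l_def)
  define E where "E = {w \<in> space D. (\<Sum>t<m. snd w t) < - (2 * \<sigma> * sqrt (real m))}"
  have E [measurable]: "E \<in> sets D" unfolding E_def by measurable
  have "emeasure D E = (\<integral>\<^sup>+w. indicator E w \<partial>D)" by simp
  also have "\<dots> \<le> (\<integral>\<^sup>+w. ennreal (exp (-4)) * ennreal (exp (- l * (\<Sum>t<m. snd w t))) \<partial>D)"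
  proof (intro nn_integral_mono)
    fix w
    have "1 \<le> exp (-4) * exp (- l * (\<Sum>t<m. snd w t))" if "w \<in> E"
    proof -
      have "l * (\<Sum>t<m. snd w t) \<le> l * - (2 * \<sigma> * sqrt (real m))"
        using that l by (intro mult_left_mono) (auto simp: E_def)
      also have "\<dots> = -4" using False \<sigma> by (simp add: l_def)
      finally show ?thesis by (simp add: exp_add[symmetric])
    qed
    then show "indicator E w \<le> ennreal (exp (-4)) * ennreal (exp (- l * (\<Sum>t<m. snd w t)))"
      by (auto simp: indicator_def ennreal_mult[symmetric] simp flip: ennreal_1)
  qed
  also have "\<dots> = ennreal (exp (-4)) * (\<integral>\<^sup>+w. ennreal (exp (- l * (\<Sum>t<m. snd w t))) \<partial>D)"
    by (rule nn_integral_cmult) measurable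
  also have "(\<integral>\<^sup>+w. ennreal (exp (- l * (\<Sum>t<m. snd w t))) \<partial>D)
      = (\<integral>\<^sup>+u. \<integral>\<^sup>+\<xi>. ennreal (exp (- l * (\<Sum>t<m. \<xi> t))) \<partial>PiM {..<m} (\<lambda>_. gaussian \<sigma>) \<partial>R)"
  proof -
    have "(\<lambda>w. ennreal (exp (- l * (\<Sum>t<m. snd w t)))) \<in> borel_measurable (R \<Otimes>\<^sub>M PiM {..<m} (\<lambda>_. gaussian \<sigma>))"
      unfolding data_law_def[symmetric] D_def[symmetric] by measurable
    from N.nn_integral_fst[OF this] show ?thesis unfolding D_def data_law_def by simp
  qed
  also have "(\<integral>\<^sup>+\<xi>. ennreal (exp (- l * (\<Sum>t<m. \<xi> t))) \<partial>PiM {..<m} (\<lambda>_. gaussian \<sigma>)) = ennreal (exp 2)"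
  proof -
    have "(\<integral>\<^sup>+\<xi>. ennreal (exp (- l * (\<Sum>t<m. \<xi> t))) \<partial>PiM {..<m} (\<lambda>_. gaussian \<sigma>))
        = (\<integral>\<^sup>+\<xi>. (\<Prod>t<m. ennreal (exp (- l * \<xi> t))) \<partial>PiM {..<m} (\<lambda>_. gaussian \<sigma>))"
      unfolding sum_distrib_left exp_sum[OF finite_lessThan] by (simp add: prod_ennreal)
    also have "\<dots> = (\<Prod>t<m. \<integral>\<^sup>+x. ennreal (exp (- l * x)) \<partial>gaussian \<sigma>)"
      by (intro PG.product_nn_integral_prod) auto
    also have "\<dots> = (\<Prod>t<m. ennreal (exp (l\<^sup>2 * \<sigma>\<^sup>2 / 2)))"
      by (subst gaussian_mgf[OF \<sigma>]) simp
    also have "\<dots> = ennreal (exp (real m * (l\<^sup>2 * \<sigma>\<^sup>2 / 2)))"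
      by (simp add: ennreal_power flip: exp_of_nat_mult)
    also have "real m * (l\<^sup>2 * \<sigma>\<^sup>2 / 2) = 2"
      using False \<sigma> by (simp add: l_def power_divide power_mult_distrib)
    finally show ?thesis .
  qed
  finally have "emeasure D E \<le> ennreal (exp (-4)) * ennreal (exp 2)"
    by (simp add: R.emeasure_space_1)
  also have "\<dots> = ennreal (exp (-2))" by (simp add: ennreal_mult[symmetric] exp_add[symmetric])
  also have "\<dots> \<le> ennreal (1/4)"
  proof (intro ennreal_leI)
    have "(2::real) * 2 \<le> exp 1 * exp 1" using exp_ge_add_one_self[of "1::real"] by (intro mult_mono) auto
    also have "\<dots> = exp 2" by (simp add: exp_add[symmetric])
    finally show "exp (-2) \<le> (1/4 :: real)" by (simp add: exp_minus field_simps)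
  qed
  finally show ?thesis unfolding E_def by (simp add: D.emeasure_eq_measure)
qed simp

end

section \<open>Testing against subcube bumps\<close>

definition subcube_bump :: "nat \<Rightarrow> nat \<Rightarrow> real \<Rightarrow> (nat \<Rightarrow> real) \<Rightarrow> (nat \<Rightarrow> real) \<Rightarrow> real" where
  "subcube_bump n k b a = (\<lambda>x\<in>cube n. if \<forall>i\<in>{1..k}. x i = a i then b else 0)"

text \<open>The indicator of a subcube of codimension \<open>k\<close> is the product of
  \<open>(1 + a i * x i) / 2\<close> over \<open>i \<le> k\<close>, which expands into
  \<open>2 ^ k\<close> Walsh functions.\<close>

lemma subcube_bump_sparse:
  assumes k: "k \<le> n" "2 ^ k \<le> s" and a: "a \<in> cube k" and b: "0 \<le> b" "b \<le> 1"
  shows "subcube_bump n k b a \<in> sparse_class n s"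
proof -
  define \<theta> where "\<theta> S = (if S \<subseteq> {1..k} then b / 2 ^ k * (\<Prod>i\<in>S. a i) else 0)" for S
  have "subcube_bump n k b a = (\<lambda>x\<in>cube n. \<Sum>S\<in>Pow {1..n}. \<theta> S * walsh S x)"
  proof -
    have "(\<Sum>S\<in>Pow {1..n}. \<theta> S * walsh S x) = (if \<forall>i\<in>{1..k}. x i = a i then b else 0)" if x: "x \<in> cube n" for x
    proof -
      have v: "x i \<in> {-1, 1}" "a i \<in> {-1, 1}" if "i \<in> {1..k}" for i
        using x a that k unfolding cube_def PiE_iff by auto
      have "(\<Sum>S\<in>Pow {1..n}. \<theta> S * walsh S x) = (\<Sum>S\<in>Pow {1..k}. \<theta> S * walsh S x)"
        using k by (intro sum.mono_neutral_right) (auto simp: \<theta>_def)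
      also have "\<dots> = (\<Sum>S\<in>Pow {1..k}. b / 2 ^ k * ((\<Prod>i\<in>S. a i * x i) * (\<Prod>i\<in>{1..k} - S. 1)))"
        by (intro sum.cong refl) (auto simp: \<theta>_def walsh_def prod.distrib)
      also have "\<dots> = b / 2 ^ k * (\<Prod>i\<in>{1..k}. a i * x i + 1)"
        unfolding sum_distrib_left[symmetric] by (subst prod_add[symmetric]) auto
      also have "\<dots> = (if \<forall>i\<in>{1..k}. x i = a i then b else 0)"
      proof (cases "\<forall>i\<in>{1..k}. x i = a i")
        case True
        have "(\<Prod>i\<in>{1..k}. a i * x i + 1) = (\<Prod>i\<in>{1..k}. 2)"
          using True v by (intro prod.cong refl) fastforce
        then show ?thesis using True by simp
      next
        case False
        then obtain i where i: "i \<in> {1..k}" "x i \<noteq> a i" by blast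
        then have "a i * x i + 1 = 0" using v[OF i(1)] by auto
        then have zero: "(\<Prod>i\<in>{1..k}. a i * x i + 1) = 0" using i by (intro prod_zero) auto
        show ?thesis unfolding zero if_not_P[OF False] by simp
      qed
      finally show ?thesis .
    qed
    then show ?thesis unfolding subcube_bump_def by (intro restrict_ext) simp
  qed
  moreover have "card {S \<in> Pow {1..n}. \<theta> S \<noteq> 0} \<le> s"
  proof -
    have "card {S \<in> Pow {1..n}. \<theta> S \<noteq> 0} \<le> card (Pow {1..k})"
      by (intro card_mono) (auto simp: \<theta>_def split: if_splits)
    then show ?thesis using k by (simp add: card_Pow)
  qed
  moreover have "linf_norm n (subcube_bump n k b a) \<le> 1"
    using b by (simp add: linf_norm_le_iff subcube_bump_def)
  ultimately show ?thesis unfolding sparse_class_def by blast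
qed

text \<open>The subcubes partition the cube, so exactly one \<open>a\<close> contributes. A general
  \<open>h\<close> is allowed in order to sum log-likelihood terms.\<close>

lemma sum_subcube_bump:
  assumes k: "k \<le> n" and x: "x \<in> cube n" and h: "h 0 = (0::real)"
  shows "(\<Sum>a\<in>cube k. h (subcube_bump n k b a x)) = h b"
proof -
  define a0 where "a0 = restrict x {1..k}"
  have a0: "a0 \<in> cube k" using x k unfolding cube_def PiE_iff a0_def by auto
  have "h (subcube_bump n k b a x) = (if a = a0 then h b else 0)" if "a \<in> cube k" for a
  proof -
    have "(\<forall>i\<in>{1..k}. x i = a i) \<longleftrightarrow> a = a0"
      using that unfolding a0_def cube_def by (auto simp: fun_eq_iff PiE_iff extensional_def)
    then show ?thesis using x h by (simp add: subcube_bump_def)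
  qed
  then have "(\<Sum>a\<in>cube k. h (subcube_bump n k b a x)) = (\<Sum>a\<in>cube k. if a = a0 then h b else 0)"
    by (intro sum.cong) auto
  then show ?thesis using a0 finite_cube by simp
qed

text \<open>Jensen's inequality, from the tangent of \<open>exp\<close> at the mean.\<close>

lemma exp_average_le:
  fixes l :: "'a \<Rightarrow> real"
  assumes "finite A" "A \<noteq> {}"
  shows "real (card A) * exp ((\<Sum>a\<in>A. l a) / real (card A)) \<le> (\<Sum>a\<in>A. exp (l a))"
proof -
  define \<mu> where "\<mu> = (\<Sum>a\<in>A. l a) / real (card A)"
  have cA: "real (card A) > 0" using assms by (simp add: card_gt_0_iff)
  have "exp \<mu> * (1 + (l a - \<mu>)) \<le> exp (l a)" for a
  proof -
    have "exp \<mu> * (1 + (l a - \<mu>)) \<le> exp \<mu> * exp (l a - \<mu>)" by (intro mult_left_mono exp_ge_add_one_self) auto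
    then show ?thesis by (simp add: exp_add[symmetric])
  qed
  then have "(\<Sum>a\<in>A. exp \<mu> * (1 + (l a - \<mu>))) \<le> (\<Sum>a\<in>A. exp (l a))" by (intro sum_mono)
  moreover have "(\<Sum>a\<in>A. exp \<mu> * (1 + (l a - \<mu>))) = real (card A) * exp \<mu>"
  proof -
    have "(\<Sum>a\<in>A. exp \<mu> * (1 + (l a - \<mu>))) = exp \<mu> * (real (card A) + (\<Sum>a\<in>A. l a) - real (card A) * \<mu>)"
      by (simp add: sum_distrib_left[symmetric] sum.distrib sum_subtractf)
    then show ?thesis using cA by (simp add: \<mu>_def)
  qed
  ultimately show ?thesis by (simp add: \<mu>_def)
qed

context gaussian_experiment
begin

text \<open>The null measure is compared with the average of the likelihood ratios of all bumps. By AM-GM this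
  average is at least the exponential of the mean log-likelihood ratio, and as every query meets exactly
  one bump, that mean does not depend on the queries: adaptivity is of no use.\<close>

lemma localized_lower_bound:
  assumes k: "k \<le> n" and \<epsilon>: "\<epsilon> > 0" and \<delta>: "0 < \<delta>" "\<delta> \<le> 1/4"
    and null: "measure (P (\<lambda>x\<in>cube n. 0)) (bad \<epsilon> (\<lambda>x\<in>cube n. 0)) \<le> \<delta>"
    and fail: "\<And>a. a \<in> cube k \<Longrightarrow> measure (P (subcube_bump n k (3 * \<epsilon>) a)) (bad \<epsilon> (subcube_bump n k (3 * \<epsilon>) a)) \<le> \<delta>"
  shows "2 ^ k * \<sigma>\<^sup>2 * ln (1 / \<delta>) / (204 * \<epsilon>\<^sup>2) \<le> real m"
proof -
  interpret D: prob_space D by (rule prob_space_D)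
  \<comment> \<open>An estimate within \<open>\<epsilon>\<close> of \<open>0\<close> misses a bump
    of height \<open>3 * \<epsilon>\<close> by at least \<open>2 * \<epsilon>\<close>.\<close>
  define b where "b = 3 * \<epsilon>"
  let ?B = "subcube_bump n k b"
  let ?Z = "\<lambda>x\<in>cube n. (0::real)"
  \<comment> \<open>\<open>x\<^sup>2\<close> is the total signal-to-noise ratio of all queries. The
    log-likelihood ratios of all bumps sum to at least \<open>- 2 * x - x\<^sup>2 / 2\<close> once
    the noise sum is not too low.\<close>
  define x where "x = b * sqrt (real m) / \<sigma>"
  define A :: real where "A = 2 ^ k"
  have A: "A \<ge> 1" by (simp add: A_def)
  have cardA: "real (card (cube k)) = A" by (simp add: card_cube A_def)
  \<comment> \<open>The linear term is absorbed by \<open>2 * x \<le> 8 * x\<^sup>2 + 1/8\<close>,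
    whence \<open>17/2 = 8 + 1/2\<close>. The weight 8 keeps the additive constant small against
    \<open>ln (1 / \<delta>)\<close>.\<close>
  define \<rho> where "\<rho> = exp (- (17/2 * x\<^sup>2 / A + 1/8))"
  define E1 where "E1 = {w \<in> space D. (\<Sum>t<m. snd w t) < - (2 * \<sigma> * sqrt (real m))}"
  \<comment> \<open>On \<open>E\<close> the estimate is close to \<open>0\<close>, hence wrong for
    every bump at once: each bump law gives \<open>E\<close> mass at most \<open>\<delta>\<close>,
    although their densities sum to at least \<open>A * \<rho>\<close> on it.\<close>
  define E where "E = space D - (bad \<epsilon> ?Z \<union> E1)"
  have E1 [measurable]: "E1 \<in> sets D" unfolding E1_def by measurable
  have E [measurable]: "E \<in> sets D" unfolding E_def by measurable
  have PE: "measure D E \<ge> 1/2"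
  proof -
    have "P ?Z = D"
    proof -
      have "P ?Z = density D (\<lambda>_. 1)"
        unfolding P_def
      proof (rule density_cong)
        show "AE w in D. ennreal (W ?Z w) = 1"
          by (rule AE_I2) (simp add: W_eq query_in_cube)
      qed measurable
      then show ?thesis by (simp add: density_1)
    qed
    then have "measure D (bad \<epsilon> ?Z \<union> E1) \<le> 1/4 + 1/4"
      using null \<delta> noise_sum_lower_tail measure_Un_le[of "bad \<epsilon> ?Z" D E1] unfolding E1_def[symmetric] by auto
    then show ?thesis unfolding E_def by (subst D.prob_compl) auto
  qed
  have sub: "E \<subseteq> bad \<epsilon> (?B a)" if a: "a \<in> cube k" for a
  proof
    fix w assume w: "w \<in> E"
    then have wD: "w \<in> space D" and "linf_norm n (\<lambda>x. ?Z x - g (fst w) (null_history w) x) \<le> \<epsilon>"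
      by (auto simp: E_def bad_def)
    then have small: "\<bar>g (fst w) (null_history w) y\<bar> \<le> \<epsilon>" if "y \<in> cube n" for y
      using that by (auto simp: linf_norm_le_iff)
    define y where "y = (\<lambda>i\<in>{1..n}. if i \<le> k then a i else (1::real))"
    have y: "y \<in> cube n" using a unfolding cube_def y_def by (auto simp: PiE_iff)
    have "?B a y = 3 * \<epsilon>" using y k unfolding subcube_bump_def b_def by (auto simp: y_def)
    then have "\<bar>?B a y - g (fst w) (null_history w) y\<bar> > \<epsilon>" using small[OF y] \<epsilon> by linarith
    then have "\<not> linf_norm n (\<lambda>x. ?B a x - g (fst w) (null_history w) x) \<le> \<epsilon>"
      using y unfolding linf_norm_le_iff by fastforce
    then show "w \<in> bad \<epsilon> (?B a)" using wD by (simp add: bad_def)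
  qed
  have key: "A * \<rho> \<le> (\<Sum>a\<in>cube k. W (?B a) w)" if w: "w \<in> E" for w
  proof -
    have wD: "w \<in> space D" and ns: "- (2 * \<sigma> * sqrt (real m)) \<le> (\<Sum>t<m. snd w t)"
      using w by (auto simp: E_def E1_def)
    define z where "z t = fst (null_history w t)" for t
    have z: "z t \<in> cube n" if "t < m" for t using query_in_cube[OF wD that] by (simp add: z_def)
    define l where "l a = (\<Sum>t<m. (?B a (z t) * snd w t - (?B a (z t))\<^sup>2 / 2) / \<sigma>\<^sup>2)" for a
    have "(\<Sum>a\<in>cube k. l a) = (\<Sum>t<m. \<Sum>a\<in>cube k. (?B a (z t) * snd w t - (?B a (z t))\<^sup>2 / 2) / \<sigma>\<^sup>2)"
      unfolding l_def by (rule sum.swap)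
    also have "\<dots> = (\<Sum>t<m. (b * snd w t - b\<^sup>2 / 2) / \<sigma>\<^sup>2)"
    proof (intro sum.cong refl)
      fix t assume "t \<in> {..<m}"
      then show "(\<Sum>a\<in>cube k. (?B a (z t) * snd w t - (?B a (z t))\<^sup>2 / 2) / \<sigma>\<^sup>2) = (b * snd w t - b\<^sup>2 / 2) / \<sigma>\<^sup>2"
        using sum_subcube_bump[OF k z[of t], of "\<lambda>v. (v * snd w t - v\<^sup>2 / 2) / \<sigma>\<^sup>2" b] by simp
    qed
    also have "\<dots> = (b * (\<Sum>t<m. snd w t) - real m * (b\<^sup>2 / 2)) / \<sigma>\<^sup>2"
      by (simp add: sum_divide_distrib[symmetric] sum_subtractf sum_distrib_left)
    also have "\<dots> \<ge> (b * - (2 * \<sigma> * sqrt (real m)) - real m * (b\<^sup>2 / 2)) / \<sigma>\<^sup>2"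
      using ns \<epsilon> by (intro divide_right_mono diff_right_mono mult_left_mono) (auto simp: b_def)
    also have "(b * - (2 * \<sigma> * sqrt (real m)) - real m * (b\<^sup>2 / 2)) / \<sigma>\<^sup>2 = - (2 * x) - x\<^sup>2 / 2"
      using \<sigma> by (simp add: x_def power_mult_distrib power_divide field_simps power2_eq_square)
    finally have sl: "- (2 * x) - x\<^sup>2 / 2 \<le> (\<Sum>a\<in>cube k. l a)" .
    have "2 * x \<le> 8 * x\<^sup>2 + 1/8"
    proof -
      have "8 * (x - 1/8)\<^sup>2 = 8 * x\<^sup>2 - 2 * x + 1/8" by (simp add: power2_eq_square algebra_simps)
      moreover have "0 \<le> 8 * (x - 1/8)\<^sup>2" by simp
      ultimately show ?thesis by linarith
    qed
    then have "- (17/2 * x\<^sup>2 + 1/8) \<le> (\<Sum>a\<in>cube k. l a)" using sl by linarith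
    then have "- (17/2 * x\<^sup>2 + 1/8) / A \<le> (\<Sum>a\<in>cube k. l a) / A"
      using A by (intro divide_right_mono) auto
    moreover have "(1/8) / A \<le> 1/8" using A by (simp add: field_simps)
    moreover have "- (17/2 * x\<^sup>2 + 1/8) / A = - (17/2 * x\<^sup>2 / A) - (1/8) / A"
    proof -
      have "A \<noteq> 0" using A by simp
      then show ?thesis by (simp add: field_simps)
    qed
    ultimately have "\<rho> \<le> exp ((\<Sum>a\<in>cube k. l a) / A)" unfolding \<rho>_def by simp
    then have "A * \<rho> \<le> A * exp ((\<Sum>a\<in>cube k. l a) / A)" using A by (intro mult_left_mono) auto
    also have "\<dots> \<le> (\<Sum>a\<in>cube k. exp (l a))"
      using exp_average_le[OF finite_cube cube_nonempty, of k l] by (simp add: cardA)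
    also have "\<dots> = (\<Sum>a\<in>cube k. W (?B a) w)" by (simp add: W_eq l_def z_def)
    finally show ?thesis .
  qed
  have "ennreal (A * \<rho> * (1/2)) \<le> ennreal (A * \<rho>) * emeasure D E"
    using PE A by (simp add: D.emeasure_eq_measure ennreal_mult[symmetric] \<rho>_def)
  also have "\<dots> = (\<integral>\<^sup>+w. ennreal (A * \<rho>) * indicator E w \<partial>D)"
    by (simp add: nn_integral_cmult_indicator)
  also have "\<dots> \<le> (\<integral>\<^sup>+w. (\<Sum>a\<in>cube k. ennreal (W (?B a) w) * indicator E w) \<partial>D)"
  proof (rule nn_integral_mono)
    fix w
    show "ennreal (A * \<rho>) * indicator E w \<le> (\<Sum>a\<in>cube k. ennreal (W (?B a) w) * indicator E w)"
    proof (cases "w \<in> E")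
      case True
      then show ?thesis using key[OF True] less_imp_le[OF W_pos]
        by (simp add: sum_ennreal ennreal_leI)
    qed simp
  qed
  also have "\<dots> = (\<Sum>a\<in>cube k. emeasure (P (?B a)) E)"
    by (subst nn_integral_sum) (auto simp: P_def emeasure_density)
  also have "\<dots> \<le> (\<Sum>a\<in>cube k. ennreal \<delta>)"
  proof (rule sum_mono)
    fix a assume a: "a \<in> cube k"
    interpret Pa: prob_space "P (?B a)" by (rule prob_space_P)
    have "emeasure (P (?B a)) E \<le> emeasure (P (?B a)) (bad \<epsilon> (?B a))"
      by (intro emeasure_mono sub[OF a]) simp
    also have "\<dots> \<le> ennreal \<delta>"
      unfolding Pa.emeasure_eq_measure using fail[OF a, folded b_def] by (intro ennreal_leI)
    finally show "emeasure (P (?B a)) E \<le> ennreal \<delta>" .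
  qed
  also have "\<dots> = ennreal (A * \<delta>)"
    using A \<delta> by (simp add: ennreal_mult ennreal_of_nat_eq_real_of_nat cardA)
  finally have "A * \<rho> * (1/2) \<le> A * \<delta>" using A \<delta> by (subst (asm) ennreal_le_iff) auto
  then have "A * (\<rho> / 2) \<le> A * \<delta>" by simp
  then have "\<rho> / 2 \<le> \<delta>" using A by (subst (asm) mult_le_cancel_left_pos) auto
  then have "ln \<rho> \<le> ln (2 * \<delta>)" using \<delta> by (subst ln_le_cancel_iff) (auto simp: \<rho>_def)
  then have "ln (1 / \<delta>) - ln 2 - 1/8 \<le> 17/2 * x\<^sup>2 / A"
    using \<delta> by (simp add: \<rho>_def ln_mult ln_div)
  moreover have "2 * ln 2 \<le> ln (1 / \<delta>)"
  proof -
    have "2 * ln 2 = ln (4::real)" using ln_realpow[of 2 2] by simp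
    also have "\<dots> \<le> ln (1 / \<delta>)" using \<delta> by (subst ln_le_cancel_iff) (auto simp: field_simps)
    finally show ?thesis .
  qed
  moreover have "ln 2 \<ge> (1/2 :: real)" using ln_2_less_1 ln2_ge_two_thirds by linarith
  ultimately have "3/8 * ln (1 / \<delta>) \<le> 17/2 * x\<^sup>2 / A" by linarith
  then have "3/68 * (A * ln (1 / \<delta>)) \<le> x\<^sup>2" using A by (simp add: field_simps)
  also have "x\<^sup>2 = 9 * \<epsilon>\<^sup>2 * real m / \<sigma>\<^sup>2" by (simp add: x_def b_def power_mult_distrib power_divide)
  finally show ?thesis using \<epsilon> \<sigma> by (simp add: A_def field_simps)
qed

end

section \<open>Decoding tuples of Walsh functions\<close>

text \<open>Keeping the sets away from \<open>{1..k}\<close> leaves the first \<open>k\<close>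
  coordinates free as signs.\<close>

definition tuples :: "nat \<Rightarrow> nat \<Rightarrow> (nat \<Rightarrow> nat set) set" where
  "tuples n k = {1..k} \<rightarrow>\<^sub>E Pow {k+1..n}"

definition signed_walsh :: "nat \<Rightarrow> nat \<Rightarrow> real \<Rightarrow> (nat \<Rightarrow> nat set) \<Rightarrow> (nat \<Rightarrow> real) \<Rightarrow> real" where
  "signed_walsh n k \<theta> T = (\<lambda>x\<in>cube n. \<theta> * (\<Sum>j\<in>{1..k}. x j * walsh (T j) x))"

lemma finite_tuples: "finite (tuples n k)"
  unfolding tuples_def by (intro finite_PiE) auto

lemma tuples_nonempty: "tuples n k \<noteq> {}"
  by (auto simp: tuples_def PiE_eq_empty_iff)

lemma tuples_mem: "T \<in> tuples n k \<Longrightarrow> j \<in> {1..k} \<Longrightarrow> T j \<subseteq> {k+1..n}"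
  unfolding tuples_def by auto

lemma signed_walsh_term_abs:
  assumes "k \<le> n" "T \<in> tuples n k" "x \<in> cube n" "j \<in> {1..k}"
  shows "\<bar>x j * walsh (T j) x\<bar> = 1"
proof -
  have "x j \<in> {-1, 1}" using assms(1,3,4) unfolding cube_def PiE_iff by auto
  then have "\<bar>x j\<bar> = 1" by auto
  moreover have "T j \<subseteq> {1..n}" using tuples_mem[OF assms(2,4)] by auto
  ultimately show ?thesis using walsh_abs[OF assms(3)] by (simp add: abs_mult)
qed

text \<open>Each term is the Walsh function of \<open>insert j (T j)\<close>. These sets are
  distinct even if some \<open>T j\<close> coincide, because \<open>j\<close> is the only element in
  \<open>{1..k}\<close>.\<close>

lemma signed_walsh_sparse:
  assumes k: "k \<le> n" "k \<le> s" and T: "T \<in> tuples n k" and \<theta>: "\<theta> \<ge> 0" "\<theta> * real k \<le> 1"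
  shows "signed_walsh n k \<theta> T \<in> sparse_class n s"
proof -
  define I where "I = (\<lambda>j. insert j (T j)) ` {1..k}"
  define c where "c S = (if S \<in> I then \<theta> else 0)" for S
  have inj: "inj_on (\<lambda>j. insert j (T j)) {1..k}"
  proof (rule inj_onI)
    fix i j assume ij: "i \<in> {1..k}" "j \<in> {1..k}" "insert i (T i) = insert j (T j)"
    have "i \<notin> T j" using tuples_mem[OF T ij(2)] ij(1) by auto
    then show "i = j" using ij(3) by blast
  qed
  have I: "I \<subseteq> Pow {1..n}"
  proof -
    have "insert j (T j) \<subseteq> {1..n}" if "j \<in> {1..k}" for j
      using tuples_mem[OF T that] that k by auto
    then show ?thesis unfolding I_def by blast
  qed
  have "(\<Sum>S\<in>Pow {1..n}. c S * walsh S x) = \<theta> * (\<Sum>j\<in>{1..k}. x j * walsh (T j) x)" for x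
  proof -
    have "(\<Sum>S\<in>Pow {1..n}. c S * walsh S x) = (\<Sum>S\<in>I. c S * walsh S x)"
      using I by (intro sum.mono_neutral_right) (auto simp: c_def)
    also have "\<dots> = (\<Sum>j\<in>{1..k}. c (insert j (T j)) * walsh (insert j (T j)) x)"
      unfolding I_def by (rule sum.reindex[OF inj, unfolded comp_def])
    also have "\<dots> = (\<Sum>j\<in>{1..k}. \<theta> * (x j * walsh (T j) x))"
    proof (intro sum.cong refl)
      fix j assume j: "j \<in> {1..k}"
      have "finite (T j)" "j \<notin> T j" using tuples_mem[OF T j] j by (auto intro: finite_subset)
      then show "c (insert j (T j)) * walsh (insert j (T j)) x = \<theta> * (x j * walsh (T j) x)"
        using j by (simp add: c_def I_def walsh_def)
    qed
    finally show ?thesis by (simp add: sum_distrib_left)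
  qed
  then have "signed_walsh n k \<theta> T = (\<lambda>x\<in>cube n. \<Sum>S\<in>Pow {1..n}. c S * walsh S x)"
    by (simp add: signed_walsh_def)
  moreover have "card {S \<in> Pow {1..n}. c S \<noteq> 0} \<le> s"
  proof -
    have "card {S \<in> Pow {1..n}. c S \<noteq> 0} \<le> card I"
      by (intro card_mono) (auto simp: c_def I_def split: if_splits)
    also have "\<dots> \<le> k" unfolding I_def using card_image_le[of "{1..k}"] by simp
    finally show ?thesis using k by simp
  qed
  moreover have "linf_norm n (signed_walsh n k \<theta> T) \<le> 1"
    unfolding linf_norm_le_iff
  proof
    fix x assume x: "x \<in> cube n"
    have "\<bar>\<Sum>j\<in>{1..k}. x j * walsh (T j) x\<bar> \<le> (\<Sum>j\<in>{1..k}. \<bar>x j * walsh (T j) x\<bar>)" by (rule sum_abs)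
    also have "\<dots> = real k" using signed_walsh_term_abs[OF k(1) T x] by simp
    finally have "\<theta> * \<bar>\<Sum>j\<in>{1..k}. x j * walsh (T j) x\<bar> \<le> \<theta> * real k" using \<theta> by (intro mult_left_mono)
    then show "\<bar>signed_walsh n k \<theta> T x\<bar> \<le> 1" using x \<theta> by (simp add: signed_walsh_def abs_mult)
  qed
  ultimately show ?thesis unfolding sparse_class_def by blast
qed

text \<open>For fixed coordinates beyond \<open>k\<close> the best first \<open>k\<close> coordinates align all the signs; averaging
  over the former makes every index with distinct Walsh functions contribute \<open>1\<close>.\<close>

lemma signed_walsh_separated:
  assumes k: "k \<le> n" and T: "T \<in> tuples n k" and T': "T' \<in> tuples n k" and \<theta>: "\<theta> \<ge> 0"
    and le: "\<And>x. x \<in> cube n \<Longrightarrow> signed_walsh n k \<theta> T x - signed_walsh n k \<theta> T' x \<le> c"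
  shows "\<theta> * real (card {j \<in> {1..k}. T j \<noteq> T' j}) \<le> c"
proof -
  have sub: "T j \<subseteq> {1..n}" "T' j \<subseteq> {1..n}" if "j \<in> {1..k}" for j
    using tuples_mem[OF T that] tuples_mem[OF T' that] by auto
  have pt: "\<theta> * (\<Sum>j\<in>{1..k}. 1 - walsh (sym_diff (T j) (T' j)) y) \<le> c" if y: "y \<in> cube n" for y
  proof -
    \<comment> \<open>Overwriting the first \<open>k\<close> coordinates changes none of the Walsh
      functions of \<open>T\<close> or \<open>T'\<close>, so these signs turn every term of
      \<open>T\<close> into \<open>1\<close> simultaneously.\<close>
    define x where "x i = (if i \<in> {1..k} then walsh (T i) y else y i)" for i
    have x: "x \<in> cube n"
    proof -
      have "walsh (T i) y \<in> {-1, 1}" if "i \<in> {1..k}" for i using walsh_pm[OF y sub(1)[OF that]] by auto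
      then show ?thesis using y k unfolding cube_def PiE_iff x_def extensional_def by auto
    qed
    have "x j * walsh (T j) x - x j * walsh (T' j) x = 1 - walsh (sym_diff (T j) (T' j)) y" if j: "j \<in> {1..k}" for j
    proof -
      have eq: "walsh U x = walsh U y" if "U \<subseteq> {k+1..n}" for U
        unfolding walsh_def x_def using that by (intro prod.cong refl) auto
      have "x j * walsh (T j) x - x j * walsh (T' j) x
          = walsh (T j) y * walsh (T j) y - walsh (T j) y * walsh (T' j) y"
        using j eq[OF tuples_mem[OF T j]] eq[OF tuples_mem[OF T' j]] by (simp add: x_def)
      also have "walsh (T j) y * walsh (T j) y = 1"
        using walsh_square[OF y sub(1)[OF j]] by (simp add: power2_eq_square)
      also have "walsh (T j) y * walsh (T' j) y = walsh (sym_diff (T j) (T' j)) y"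
        by (rule walsh_mult[OF y sub[OF j]])
      finally show ?thesis .
    qed
    then have "(\<Sum>j\<in>{1..k}. 1 - walsh (sym_diff (T j) (T' j)) y)
        = (\<Sum>j\<in>{1..k}. x j * walsh (T j) x - x j * walsh (T' j) x)"
      by (intro sum.cong) auto
    then show ?thesis
      using le[OF x] x by (simp add: signed_walsh_def sum_subtractf right_diff_distrib)
  qed
  have "(\<Sum>y\<in>cube n. \<theta> * (\<Sum>j\<in>{1..k}. 1 - walsh (sym_diff (T j) (T' j)) y)) \<le> (\<Sum>y\<in>cube n. c)"
    by (intro sum_mono pt)
  also have "(\<Sum>y\<in>cube n. \<theta> * (\<Sum>j\<in>{1..k}. 1 - walsh (sym_diff (T j) (T' j)) y))
      = \<theta> * (\<Sum>j\<in>{1..k}. \<Sum>y\<in>cube n. 1 - walsh (sym_diff (T j) (T' j)) y)"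
    by (simp only: sum_distrib_left[symmetric]) (subst sum.swap, rule refl)
  also have "(\<Sum>j\<in>{1..k}. \<Sum>y\<in>cube n. 1 - walsh (sym_diff (T j) (T' j)) y)
      = (\<Sum>j\<in>{1..k}. if T j \<noteq> T' j then 2 ^ n else 0)"
  proof (intro sum.cong refl)
    fix j assume j: "j \<in> {1..k}"
    show "(\<Sum>y\<in>cube n. 1 - walsh (sym_diff (T j) (T' j)) y) = (if T j \<noteq> T' j then 2 ^ n else 0)"
    proof (cases "T j = T' j")
      case False
      then have "(\<Sum>y\<in>cube n. walsh (sym_diff (T j) (T' j)) y) = 0"
        using sub[OF j] by (intro sum_walsh) auto
      then show ?thesis using False by (simp add: sum_subtractf card_cube)
    qed simp
  qed
  also have "\<dots> = 2 ^ n * real (card {j \<in> {1..k}. T j \<noteq> T' j})"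
    by (simp add: sum.If_cases Int_def)
  finally have "2 ^ n * (\<theta> * real (card {j \<in> {1..k}. T j \<noteq> T' j})) \<le> 2 ^ n * c"
    by (simp add: card_cube mult.left_commute)
  then show ?thesis by simp
qed

text \<open>Resampling one entry of a uniform tuple leaves it uniform. The map \<open>swap\<close>
  exchanges the old entry with the fresh one and is its own inverse.\<close>

lemma sum_tuples_update:
  fixes h :: "(nat \<Rightarrow> nat set) \<Rightarrow> real"
  assumes j: "j \<in> {1..k}"
  shows "(\<Sum>T\<in>tuples n k. \<Sum>S\<in>Pow {k+1..n}. h (T(j := S))) = 2 ^ (n - k) * (\<Sum>T\<in>tuples n k. h T)"
proof -
  define V where "V = Pow {k+1..n}"
  have upd: "T(j := S) \<in> tuples n k" "T j \<in> V" if "T \<in> tuples n k" "S \<in> V" for T S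
    using PiE_fun_upd[of S "\<lambda>_. V" j T "{1..k}"] that j tuples_mem[OF that(1) j]
    by (auto simp: tuples_def V_def insert_absorb)
  define swap where "swap = (\<lambda>(T :: nat \<Rightarrow> nat set, S). (T(j := S), T j))"
  have "(\<Sum>T\<in>tuples n k. \<Sum>S\<in>V. h (T(j := S))) = (\<Sum>p\<in>tuples n k \<times> V. h ((fst p)(j := snd p)))"
    by (simp add: sum.cartesian_product case_prod_beta')
  also have "\<dots> = (\<Sum>p\<in>tuples n k \<times> V. h (fst p))"
    by (rule sum.reindex_bij_witness[of _ swap swap]) (use upd in \<open>auto simp: swap_def\<close>)
  also have "\<dots> = (\<Sum>T\<in>tuples n k. \<Sum>S\<in>V. h T)"
    unfolding sum.cartesian_product by (simp only: case_prod_beta')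
  also have "\<dots> = 2 ^ (n - k) * (\<Sum>T\<in>tuples n k. h T)"
    by (simp add: V_def card_Pow sum_distrib_left)
  finally show ?thesis by (simp only: V_def)
qed

context gaussian_experiment
begin

text \<open>A chi-square comparison: \<open>W f\<^sup>2 = exp(\<dots>) W p W (2 f - p)\<close>, combined with AM-GM.\<close>

lemma P_compare:
  assumes fp: "\<And>x. x \<in> cube n \<Longrightarrow> \<bar>f x - p x\<bar> = \<theta>" and \<alpha>: "\<alpha> > 0" and B: "B \<in> sets D"
  shows "measure (P f) B \<le> \<alpha> / 2 * exp (real m * \<theta>\<^sup>2 / \<sigma>\<^sup>2) + measure (P p) B / (2 * \<alpha>)"
proof -
  define K where "K = exp (real m * \<theta>\<^sup>2 / \<sigma>\<^sup>2)"
  \<comment> \<open>Reflection of \<open>p\<close> in \<open>f\<close>. As \<open>f\<close> is the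
    midpoint, \<open>r\<^sup>2 + p\<^sup>2 = 2 * f\<^sup>2 + 2 * (f - p)\<^sup>2\<close>, so the
    log-likelihoods of \<open>r\<close> and \<open>p\<close> add up to twice that of
    \<open>f\<close> minus a constant known from \<open>\<theta>\<close>.\<close>
  define r where "r x = 2 * f x - p x" for x
  interpret Pf: prob_space "P f" by (rule prob_space_P)
  interpret Pp: prob_space "P p" by (rule prob_space_P)
  interpret Pr: prob_space "P r" by (rule prob_space_P)
  have W: "W f w \<le> \<alpha> / 2 * K * W r w + 1 / (2 * \<alpha>) * W p w" if w: "w \<in> space D" for w
  proof -
    define z where "z t = fst (null_history w t)" for t
    have "(\<Sum>t<m. 2 * ((f (z t) * snd w t - (f (z t))\<^sup>2 / 2) / \<sigma>\<^sup>2))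
        = (\<Sum>t<m. (r (z t) * snd w t - (r (z t))\<^sup>2 / 2) / \<sigma>\<^sup>2 + (p (z t) * snd w t - (p (z t))\<^sup>2 / 2) / \<sigma>\<^sup>2 + \<theta>\<^sup>2 / \<sigma>\<^sup>2)"
    proof (intro sum.cong refl)
      fix t assume "t \<in> {..<m}"
      then have "\<bar>f (z t) - p (z t)\<bar> = \<theta>" using fp query_in_cube[OF w] by (simp add: z_def)
      then have th: "\<theta>\<^sup>2 = (f (z t) - p (z t))\<^sup>2" by (metis power2_abs)
      show "2 * ((f (z t) * snd w t - (f (z t))\<^sup>2 / 2) / \<sigma>\<^sup>2)
        = (r (z t) * snd w t - (r (z t))\<^sup>2 / 2) / \<sigma>\<^sup>2 + (p (z t) * snd w t - (p (z t))\<^sup>2 / 2) / \<sigma>\<^sup>2 + \<theta>\<^sup>2 / \<sigma>\<^sup>2"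
        unfolding th r_def using \<sigma> by (simp add: field_simps power2_eq_square)
    qed
    also have "\<dots> = (\<Sum>t<m. (r (z t) * snd w t - (r (z t))\<^sup>2 / 2) / \<sigma>\<^sup>2)
        + (\<Sum>t<m. (p (z t) * snd w t - (p (z t))\<^sup>2 / 2) / \<sigma>\<^sup>2) + real m * \<theta>\<^sup>2 / \<sigma>\<^sup>2"
      by (simp add: sum.distrib)
    finally have "exp (2 * (\<Sum>t<m. (f (z t) * snd w t - (f (z t))\<^sup>2 / 2) / \<sigma>\<^sup>2)) = W r w * W p w * K"
      unfolding sum_distrib_left W_eq z_def[symmetric] K_def by (simp only: exp_add)
    then have sq: "(W f w)\<^sup>2 = W r w * W p w * K"
      unfolding W_eq z_def[symmetric] by (simp add: exp_double)
    have pos: "W r w > 0" "W p w > 0" "K > 0" using W_pos by (auto simp: K_def)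
    have "(W f w)\<^sup>2 = (\<alpha> * K * W r w) * (W p w / \<alpha>)" using sq \<alpha> by simp
    also have "\<dots> \<le> ((\<alpha> * K * W r w + W p w / \<alpha>) / 2)\<^sup>2"
    proof -
      define a where "a = \<alpha> * K * W r w"
      define b where "b = W p w / \<alpha>"
      have "((a + b) / 2)\<^sup>2 - a * b = ((a - b) / 2)\<^sup>2" by (simp add: power2_eq_square field_simps)
      then show ?thesis using zero_le_power2[of "(a - b) / 2"] unfolding a_def[symmetric] b_def[symmetric] by linarith
    qed
    finally have "W f w \<le> (\<alpha> * K * W r w + W p w / \<alpha>) / 2"
      using pos \<alpha> by (rule_tac power2_le_imp_le) auto
    then show ?thesis by (simp add: add_divide_distrib)
  qed
  have lin: "ennreal (a * x + b * y) = ennreal a * ennreal x + ennreal b * ennreal y"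
    if "a \<ge> 0" "b \<ge> 0" "x \<ge> 0" "y \<ge> 0" for a b x y :: real
    using that by (simp add: ennreal_mult)
  have "emeasure (P f) B = (\<integral>\<^sup>+w. ennreal (W f w) * indicator B w \<partial>D)"
    unfolding P_def using B by (intro emeasure_density) auto
  also have "\<dots> \<le> (\<integral>\<^sup>+w. ennreal (\<alpha> / 2 * K) * (ennreal (W r w) * indicator B w)
      + ennreal (1 / (2 * \<alpha>)) * (ennreal (W p w) * indicator B w) \<partial>D)"
  proof (rule nn_integral_mono)
    fix w assume w: "w \<in> space D"
    have pos: "W r w \<ge> 0" "W p w \<ge> 0" "K \<ge> 0" using less_imp_le[OF W_pos] by (auto simp: K_def)
    show "ennreal (W f w) * indicator B w \<le> ennreal (\<alpha> / 2 * K) * (ennreal (W r w) * indicator B w)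
      + ennreal (1 / (2 * \<alpha>)) * (ennreal (W p w) * indicator B w)"
    proof (cases "w \<in> B")
      case True
      have "ennreal (W f w) \<le> ennreal (\<alpha> / 2 * K * W r w + 1 / (2 * \<alpha>) * W p w)"
        by (intro ennreal_leI W[OF w])
      also have "\<dots> = ennreal (\<alpha> / 2 * K) * ennreal (W r w) + ennreal (1 / (2 * \<alpha>)) * ennreal (W p w)"
        using pos \<alpha> by (intro lin) auto
      finally show ?thesis using True by simp
    qed simp
  qed
  also have "\<dots> = ennreal (\<alpha> / 2 * K) * emeasure (P r) B + ennreal (1 / (2 * \<alpha>)) * emeasure (P p) B"
    unfolding P_def using B
    by (simp add: nn_integral_add nn_integral_cmult emeasure_density)
  also have "\<dots> = ennreal (\<alpha> / 2 * K * measure (P r) B + 1 / (2 * \<alpha>) * measure (P p) B)"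
    unfolding Pr.emeasure_eq_measure Pp.emeasure_eq_measure
    using \<alpha> by (intro lin[symmetric]) (auto simp: K_def)
  finally have "measure (P f) B \<le> \<alpha> / 2 * K * measure (P r) B + 1 / (2 * \<alpha>) * measure (P p) B"
    unfolding Pf.emeasure_eq_measure using \<alpha> by (subst (asm) ennreal_le_iff) (auto simp: K_def)
  also have "\<alpha> / 2 * K * measure (P r) B \<le> \<alpha> / 2 * K * 1"
    using \<alpha> by (intro mult_left_mono) (auto simp: K_def)
  finally show ?thesis by (simp add: K_def)
qed

end

context gaussian_experiment
begin

text \<open>A successful learner decodes at least half of the entries of a random tuple. But dropping the
  \<open>j\<close>-th term changes every response by only \<open>\<theta>\<close>, so entry \<open>j\<close> stays hard to decode even if all the
  other entries are revealed.\<close>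

lemma adaptive_lower_bound:
  assumes k: "1 \<le> k" "k \<le> n" and \<epsilon>: "\<epsilon> > 0"
  defines "\<theta> \<equiv> 4 * \<epsilon> / real k"
  assumes fail: "\<And>T. T \<in> tuples n k \<Longrightarrow> measure (P (signed_walsh n k \<theta> T)) (bad \<epsilon> (signed_walsh n k \<theta> T)) \<le> 1/4"
  shows "2 ^ (n - k) \<le> 8 * exp (real m * \<theta>\<^sup>2 / \<sigma>\<^sup>2)"
proof -
  let ?f = "signed_walsh n k \<theta>"
  have \<theta>: "\<theta> > 0" "\<theta> * real k = 4 * \<epsilon>" using k \<epsilon> by (auto simp: \<theta>_def)
  define ok where "ok w = {T \<in> tuples n k. w \<in> space D - bad \<epsilon> (?f T)}" for w
  \<comment> \<open>Some tuple whose function is within \<open>\<epsilon>\<close> of the estimate.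
    It is computed from the sample alone, so it is one decoder for all \<open>T\<close>.\<close>
  define dec where "dec w = (SOME T. T \<in> ok w)" for w
  have ok_m: "ok \<in> D \<rightarrow>\<^sub>M count_space (Pow (tuples n k))"
    unfolding ok_def
  proof (rule measurable_Collect_finite[OF finite_tuples])
    fix T
    have "{w \<in> space D. w \<in> space D - bad \<epsilon> (?f T)} = space D - bad \<epsilon> (?f T)" by auto
    then show "{w \<in> space D. w \<in> space D - bad \<epsilon> (?f T)} \<in> sets D" by simp
  qed
  define C where "C j S = {w \<in> space D. dec w j = S}" for j S
  have C [measurable]: "C j S \<in> sets D" for j S
  proof -
    have "(\<lambda>B. (SOME T. T \<in> B) j) \<in> count_space (Pow (tuples n k)) \<rightarrow>\<^sub>M count_space UNIV" by simp
    from measurable_sets[OF measurable_compose[OF ok_m this], of "{S}"]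
    show ?thesis by (simp add: C_def dec_def vimage_def Int_def conj_commute)
  qed
  have decoded: "real k / 2 \<le> real (card {j \<in> {1..k}. dec w j = T j})"
    if T: "T \<in> tuples n k" and w: "w \<in> space D - bad \<epsilon> (?f T)" for T w
  proof -
    have "T \<in> ok w" using T w by (simp add: ok_def)
    then have d: "dec w \<in> ok w" unfolding dec_def by (rule someI[of "\<lambda>T. T \<in> ok w"])
    have est: "\<bar>?f U x - g (fst w) (null_history w) x\<bar> \<le> \<epsilon>" if "U \<in> ok w" "x \<in> cube n" for U x
    proof -
      have "linf_norm n (\<lambda>x. ?f U x - g (fst w) (null_history w) x) \<le> \<epsilon>"
        using that(1) by (auto simp: ok_def bad_def)
      then show ?thesis using that(2) unfolding linf_norm_le_iff by blast
    qed
    \<comment> \<open>Both functions are within \<open>\<epsilon>\<close> of the same estimate. As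
      \<open>\<theta> * k = 4 * \<epsilon>\<close>, the bound \<open>2 * \<epsilon>\<close> means at
      most half of the entries are wrong.\<close>
    have "\<theta> * real (card {j \<in> {1..k}. T j \<noteq> dec w j}) \<le> 2 * \<epsilon>"
    proof (rule signed_walsh_separated[OF k(2) T])
      show "dec w \<in> tuples n k" using d by (simp add: ok_def)
      show "?f T x - ?f (dec w) x \<le> 2 * \<epsilon>" if "x \<in> cube n" for x
        using est[OF \<open>T \<in> ok w\<close> that] est[OF d that] by linarith
    qed (use \<theta> in simp)
    then have "\<theta> * real (card {j \<in> {1..k}. T j \<noteq> dec w j}) \<le> \<theta> * (real k / 2)" using \<theta>(2) by linarith
    then have "real (card {j \<in> {1..k}. T j \<noteq> dec w j}) \<le> real k / 2"
      using \<theta>(1) by (subst (asm) mult_le_cancel_left_pos) auto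
    moreover have "real k = real (card {j \<in> {1..k}. dec w j = T j}) + real (card {j \<in> {1..k}. T j \<noteq> dec w j})"
    proof -
      have "card {1..k} = card ({j \<in> {1..k}. dec w j = T j} \<union> {j \<in> {1..k}. T j \<noteq> dec w j})"
        by (rule arg_cong[where f = card]) auto
      also have "\<dots> = card {j \<in> {1..k}. dec w j = T j} + card {j \<in> {1..k}. T j \<noteq> dec w j}"
        by (intro card_Un_disjoint) auto
      finally show ?thesis by simp
    qed
    ultimately show ?thesis by linarith
  qed
  \<comment> \<open>Half of the entries are correct with probability at least
    \<open>3/4\<close>.\<close>
  have lower: "3 / 8 * real k \<le> (\<Sum>j\<in>{1..k}. measure (P (?f T)) (C j (T j)))" if T: "T \<in> tuples n k" for T
  proof -
    interpret Pf: prob_space "P (?f T)" by (rule prob_space_P)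
    define G where "G = space D - bad \<epsilon> (?f T)"
    have G: "G \<in> sets (P (?f T))" by (simp add: G_def)
    have Cs: "C j S \<in> sets (P (?f T))" for j S by simp
    have "measure (P (?f T)) G = 1 - measure (P (?f T)) (bad \<epsilon> (?f T))"
      using Pf.prob_compl[of "bad \<epsilon> (?f T)"] by (simp add: G_def)
    then have "3 / 8 * real k \<le> real k / 2 * measure (P (?f T)) G"
      using fail[OF T] by (simp add: field_simps mult_left_mono)
    also have "\<dots> = (\<integral>w. real k / 2 * indicator G w \<partial>P (?f T))"
      using G by simp
    also have "\<dots> \<le> (\<integral>w. (\<Sum>j\<in>{1..k}. indicator (C j (T j)) w) \<partial>P (?f T))"
    proof (rule integral_mono)
      show "integrable (P (?f T)) (\<lambda>w. real k / 2 * indicator G w)"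
        using G by (intro integrable_mult_right integrable_real_indicator) (auto simp: Pf.emeasure_eq_measure)
      show "integrable (P (?f T)) (\<lambda>w. \<Sum>j\<in>{1..k}. indicator (C j (T j)) w :: real)"
        using Cs by (intro Bochner_Integration.integrable_sum integrable_real_indicator) (auto simp: Pf.emeasure_eq_measure)
      fix w assume w: "w \<in> space (P (?f T))"
      show "real k / 2 * indicator G w \<le> (\<Sum>j\<in>{1..k}. indicator (C j (T j)) w)"
      proof (cases "w \<in> G")
        case True
        have "(\<Sum>j\<in>{1..k}. indicator (C j (T j)) w) = (\<Sum>j\<in>{1..k}. if dec w j = T j then 1 else 0 :: real)"
          using w by (intro sum.cong refl) (simp add: C_def indicator_def)
        also have "\<dots> = real (card {j \<in> {1..k}. dec w j = T j})"
          by (simp add: sum.If_cases Int_def)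
        finally show ?thesis using decoded[OF T, of w] True by (simp add: G_def)
      qed (simp add: sum_nonneg)
    qed
    also have "\<dots> = (\<Sum>j\<in>{1..k}. measure (P (?f T)) (C j (T j)))"
      using Cs by (subst Bochner_Integration.integral_sum) (auto simp: Pf.emeasure_eq_measure intro!: integrable_real_indicator)
    finally show ?thesis .
  qed
  define p where "p j T = (\<lambda>x\<in>cube n. \<theta> * (\<Sum>i\<in>{1..k} - {j}. x i * walsh (T i) x))" for j T
  define h where "h j T = measure (P (p j T)) (C j (T j))" for j T
  define K where "K = exp (real m * \<theta>\<^sup>2 / \<sigma>\<^sup>2)"
  have K: "K > 0" by (simp add: K_def)
  have upper: "measure (P (?f T)) (C j (T j)) \<le> 1 / 8 + 2 * K * h j T"
    if T: "T \<in> tuples n k" and j: "j \<in> {1..k}" for T j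
  proof -
    have "\<bar>?f T x - p j T x\<bar> = \<theta>" if x: "x \<in> cube n" for x
    proof -
      have "?f T x - p j T x = \<theta> * (x j * walsh (T j) x)"
      proof -
        have "(\<Sum>i\<in>{1..k}. x i * walsh (T i) x) = x j * walsh (T j) x + (\<Sum>i\<in>{1..k} - {j}. x i * walsh (T i) x)"
          using j by (intro sum.remove) auto
        then have "?f T x = \<theta> * (x j * walsh (T j) x + (\<Sum>i\<in>{1..k} - {j}. x i * walsh (T i) x))"
          using x by (simp add: signed_walsh_def)
        then show ?thesis using x by (simp add: p_def distrib_left)
      qed
      then show ?thesis using signed_walsh_term_abs[OF k(2) T x j] \<theta>(1) by (simp only: abs_mult)
    qed
    \<comment> \<open>This \<open>\<alpha>\<close> makes the first term \<open>1/8\<close>, leaving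
      \<open>3/8 - 1/8 = 1/4\<close> of decoding probability to be explained by
      \<open>h\<close>.\<close>
    from P_compare[OF this, where \<alpha> = "1 / (4 * K)" and B = "C j (T j)"] K
    have "measure (P (?f T)) (C j (T j)) \<le> 1 / (4 * K) / 2 * K + h j T / (2 * (1 / (4 * K)))"
      by (simp add: K_def h_def)
    then show ?thesis using K by (simp add: field_simps)
  qed
  define N where "N = real (card (tuples n k))"
  have N: "N > 0" using finite_tuples tuples_nonempty by (simp add: N_def card_gt_0_iff)
  \<comment> \<open>Under \<open>p j T\<close> the data carry no trace of entry \<open>j\<close>,
    and the events \<open>C j S\<close> are disjoint. So decoding it is a blind guess among
    \<open>2 ^ (n - k)\<close> sets.\<close>
  have hsum: "2 ^ (n - k) * (\<Sum>T\<in>tuples n k. h j T) \<le> N" if j: "j \<in> {1..k}" for j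
  proof -
    have "2 ^ (n - k) * (\<Sum>T\<in>tuples n k. h j T) = (\<Sum>T\<in>tuples n k. \<Sum>S\<in>Pow {k+1..n}. h j (T(j := S)))"
      by (rule sum_tuples_update[OF j, symmetric])
    also have "\<dots> \<le> (\<Sum>T\<in>tuples n k. 1)"
    proof (rule sum_mono)
      fix T
      interpret Pp: prob_space "P (p j T)" by (rule prob_space_P)
      have "p j (T(j := S)) = p j T" for S
        unfolding p_def by (intro restrict_ext arg_cong2[where f = "(*)"] refl sum.cong) auto
      then have "(\<Sum>S\<in>Pow {k+1..n}. h j (T(j := S))) = (\<Sum>S\<in>Pow {k+1..n}. measure (P (p j T)) (C j S))"
        by (simp add: h_def)
      also have "\<dots> = measure (P (p j T)) (\<Union>S\<in>Pow {k+1..n}. C j S)"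
      proof (rule Pp.finite_measure_finite_Union[symmetric])
        show "disjoint_family_on (C j) (Pow {k+1..n})" by (auto simp: disjoint_family_on_def C_def)
      qed auto
      finally show "(\<Sum>S\<in>Pow {k+1..n}. h j (T(j := S))) \<le> 1" by simp
    qed
    finally show ?thesis by (simp add: N_def)
  qed
  have "N * (3 / 8 * real k) = (\<Sum>T\<in>tuples n k. 3 / 8 * real k)" by (simp add: N_def)
  also have "\<dots> \<le> (\<Sum>T\<in>tuples n k. \<Sum>j\<in>{1..k}. measure (P (?f T)) (C j (T j)))"
    by (intro sum_mono lower)
  also have "\<dots> \<le> (\<Sum>T\<in>tuples n k. \<Sum>j\<in>{1..k}. 1 / 8 + 2 * K * h j T)"
    by (intro sum_mono upper)
  also have "\<dots> = (\<Sum>j\<in>{1..k}. N / 8 + 2 * K * (\<Sum>T\<in>tuples n k. h j T))"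
    by (subst sum.swap) (simp add: sum.distrib sum_distrib_left N_def)
  also have "\<dots> \<le> (\<Sum>j\<in>{1..k}. N / 8 + 2 * K * (N / 2 ^ (n - k)))"
    using hsum K by (intro sum_mono add_left_mono mult_left_mono) (auto simp: field_simps)
  also have "\<dots> = (N * real k) * (1 / 8 + 2 * K / 2 ^ (n - k))" by (simp add: algebra_simps)
  finally have "(N * real k) * (3 / 8) \<le> (N * real k) * (1 / 8 + 2 * K / 2 ^ (n - k))" by (simp add: mult_ac)
  then have "3 / 8 \<le> 1 / 8 + 2 * K / 2 ^ (n - k)"
    using N k by (subst (asm) mult_le_cancel_left_pos) auto
  then show ?thesis unfolding K_def[symmetric] by (simp add: field_simps)
qed

end

section \<open>Query complexity\<close>

lemma zero_mem_sparse_class: "(\<lambda>x\<in>cube n. 0) \<in> sparse_class n s"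
proof -
  have "linf_norm n (\<lambda>x\<in>cube n. 0) \<le> 1" by (simp add: linf_norm_le_iff)
  then show ?thesis unfolding sparse_class_def by (intro CollectI exI[of _ "\<lambda>_. 0"]) simp
qed

lemma ln_inverse_ge_1:
  assumes "0 < \<delta>" "\<delta> \<le> (1/4 :: real)"
  shows "1 \<le> ln (1 / \<delta>)"
proof -
  have "ln (4 :: real) = 2 * ln 2" using ln_realpow[of 2 2] by simp
  then have "1 \<le> ln (4 :: real)" using ln2_ge_two_thirds by simp
  also have "\<dots> \<le> ln (1 / \<delta>)" using assms by (subst ln_le_cancel_iff) (auto simp: field_simps)
  finally show ?thesis .
qed

text \<open>The two lower bounds are added up. The restriction \<open>\<epsilon> \<le> 1/4\<close>
  keeps both families in the class: bumps have height \<open>3 * \<epsilon>\<close>, and signed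
  Walsh sums have norm at most \<open>4 * \<epsilon>\<close>.\<close>

lemma learnable_imp_queries_ge:
  assumes s: "1 \<le> s" "s \<le> n" and \<sigma>: "\<sigma> > 0" and \<epsilon>: "0 < \<epsilon>" "\<epsilon> \<le> 1/4" and \<delta>: "0 < \<delta>" "\<delta> \<le> 1/4"
    and lrn: "learnable n \<sigma> (sparse_class n s) \<epsilon> \<delta> m"
  shows "1/70000 * \<sigma>\<^sup>2 * (real n * (real s)\<^sup>2 + real s * ln (1 / \<delta>)) / \<epsilon>\<^sup>2 \<le> real m"
proof -
  obtain R q g where L: "learner n m R q g" and ok: "\<And>f N. f \<in> sparse_class n s \<Longrightarrow> (\<forall>t. subgaussian \<sigma> (N t)) \<Longrightarrow>
      measure (data_law m R N) (failure_event n m R q g N f \<epsilon>) \<le> \<delta>"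
    using lrn unfolding learnable_def by blast
  interpret gaussian_experiment n m R q g \<sigma> using L \<sigma> by unfold_locales
  have fail: "measure (P f) (bad \<epsilon> f) \<le> \<delta>" if "f \<in> sparse_class n s" for f
    unfolding measure_P_bad by (rule ok[OF that]) (simp add: gaussian_subgaussian[OF \<sigma>])
  define \<Lambda> where "\<Lambda> = ln (1 / \<delta>)"
  have \<Lambda>: "\<Lambda> \<ge> 1" using ln_inverse_ge_1[OF \<delta>] by (simp add: \<Lambda>_def)
  define \<tau> where "\<tau> = \<sigma>\<^sup>2 / \<epsilon>\<^sup>2"
  have \<tau>: "\<tau> > 0" using \<sigma> \<epsilon> by (simp add: \<tau>_def)
  have b1: "real s * \<Lambda> * \<tau> \<le> 408 * real m"
  proof -
    \<comment> \<open>The largest number of bumps that sparsity \<open>s\<close> permits; rounding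
      to a power of two costs a factor 2, turning 204 into 408.\<close>
    obtain k where k: "2 ^ k \<le> s" "s < 2 ^ (k + 1)"
      using ex_power_ivl1[of 2 s] s by auto
    have "k < 2 ^ k" by (rule less_exp)
    then have kn: "k \<le> n" using k s by linarith
    have "2 ^ k * \<sigma>\<^sup>2 * ln (1 / \<delta>) / (204 * \<epsilon>\<^sup>2) \<le> real m"
    proof (rule localized_lower_bound[OF kn \<epsilon>(1) \<delta>])
      show "measure (P (\<lambda>x\<in>cube n. 0)) (bad \<epsilon> (\<lambda>x\<in>cube n. 0)) \<le> \<delta>"
        by (rule fail[OF zero_mem_sparse_class])
      show "measure (P (subcube_bump n k (3 * \<epsilon>) a)) (bad \<epsilon> (subcube_bump n k (3 * \<epsilon>) a)) \<le> \<delta>"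
        if "a \<in> cube k" for a
        using \<epsilon> by (intro fail subcube_bump_sparse kn k that) auto
    qed
    then have "2 ^ k * (\<Lambda> * \<tau>) \<le> 204 * real m" using \<epsilon> by (simp add: \<Lambda>_def \<tau>_def field_simps)
    moreover have "real s \<le> 2 * 2 ^ k"
    proof -
      have "real s \<le> real (2 ^ (k + 1))" using k(2) by (subst of_nat_le_iff) simp
      then show ?thesis by simp
    qed
    then have "real s * (\<Lambda> * \<tau>) \<le> 2 * 2 ^ k * (\<Lambda> * \<tau>)" using \<Lambda> \<tau> by (intro mult_right_mono) auto
    ultimately show ?thesis by (simp add: mult.assoc)
  qed
  have b2: "real n * (real s)\<^sup>2 * \<tau> \<le> 512 * real m" if n: "n \<ge> 14"
  proof -
    \<comment> \<open>Half of \<open>s\<close>, rounded up: still of order \<open>s\<close>, yet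
      \<open>n - k\<close> stays of order \<open>n\<close> even when \<open>s = n\<close>.\<close>
    define k where "k = (s + 1) div 2"
    have k: "1 \<le> k" "k \<le> s" "k \<le> n" "s \<le> 2 * k" "2 * k \<le> n + 1" using s by (auto simp: k_def)
    define \<theta> where "\<theta> = 4 * \<epsilon> / real k"
    have \<theta>: "\<theta> \<ge> 0" "\<theta> * real k \<le> 1" using \<epsilon> k by (auto simp: \<theta>_def)
    have "2 ^ (n - k) \<le> 8 * exp (real m * \<theta>\<^sup>2 / \<sigma>\<^sup>2)"
      unfolding \<theta>_def
    proof (rule adaptive_lower_bound[OF k(1,3) \<epsilon>(1)])
      show "measure (P (signed_walsh n k (4 * \<epsilon> / real k) T)) (bad \<epsilon> (signed_walsh n k (4 * \<epsilon> / real k) T)) \<le> 1/4"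
        if T: "T \<in> tuples n k" for T
        using fail[OF signed_walsh_sparse[OF k(3,2) T \<theta>]] \<delta> by (simp add: \<theta>_def)
    qed
    then have "ln (2 ^ (n - k)) \<le> ln (8 * exp (real m * \<theta>\<^sup>2 / \<sigma>\<^sup>2))" by (subst ln_le_cancel_iff) auto
    also have "\<dots> = ln (2 ^ 3) + real m * \<theta>\<^sup>2 / \<sigma>\<^sup>2" by (simp add: ln_mult)
    finally have "real (n - k) * ln 2 - 3 * ln 2 \<le> real m * \<theta>\<^sup>2 / \<sigma>\<^sup>2"
      using ln_realpow[of 2 "n - k"] ln_realpow[of 2 3] by simp
    \<comment> \<open>The 3 is the binary logarithm of the factor 8 in
      \<open>adaptive_lower_bound\<close>. From \<open>n - k \<ge> (n - 1) / 2\<close>, at least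
      \<open>n / 4\<close> remains as soon as \<open>n \<ge> 14\<close>.\<close>
    moreover have "real n / 4 * (1/2) \<le> (real (n - k) - 3) * ln 2"
    proof (rule mult_mono)
      have "2 * real (n - k) \<ge> real n - 1" using k by (simp add: of_nat_diff)
      then show "real n / 4 \<le> real (n - k) - 3" using n by linarith
      show "1/2 \<le> ln (2::real)" using ln2_ge_two_thirds by linarith
      have "real n / 4 \<le> real (n - k) - 3" by fact
      then show "0 \<le> real (n - k) - 3" by linarith
    qed auto
    moreover have "(real (n - k) - 3) * ln 2 = real (n - k) * ln 2 - 3 * ln 2" by (rule left_diff_distrib)
    ultimately have "real n / 8 \<le> real m * \<theta>\<^sup>2 / \<sigma>\<^sup>2" by linarith
    also have "\<dots> = 16 * real m / ((real k)\<^sup>2 * \<tau>)"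
      using \<epsilon> \<sigma> k by (simp add: \<theta>_def \<tau>_def power_divide power_mult_distrib field_simps)
    finally have "real n * ((real k)\<^sup>2 * \<tau>) \<le> 128 * real m"
      using \<tau> k by (simp add: field_simps)
    moreover have "(real s)\<^sup>2 \<le> 4 * (real k)\<^sup>2"
    proof -
      have "(real s)\<^sup>2 \<le> (2 * real k)\<^sup>2" using k(4) by (intro power_mono) auto
      then show ?thesis by (simp add: power_mult_distrib)
    qed
    then have "real n * ((real s)\<^sup>2 * \<tau>) \<le> real n * (4 * (real k)\<^sup>2 * \<tau>)"
      using \<tau> by (intro mult_left_mono mult_right_mono) auto
    ultimately show ?thesis by (simp add: mult_ac)
  qed
  have "(real n * (real s)\<^sup>2 + real s * \<Lambda>) * \<tau> \<le> 70000 * real m"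
  proof (cases "n \<ge> 14")
    case True
    then show ?thesis using b1 b2 by (simp add: distrib_right)
  next
    case False
    \<comment> \<open>For bounded \<open>n\<close> the term \<open>n * s\<^sup>2\<close> is at most
      \<open>169 * s\<close>, so \<open>b1\<close> alone suffices; \<open>170 * 408\<close> is below
      70000.\<close>
    then have "real n \<le> 13" "real s \<le> 13" using s by auto
    then have "real n * (real s * real s) \<le> 13 * (13 * real s)" by (intro mult_mono mult_right_mono) auto
    also have "\<dots> \<le> 169 * (real s * \<Lambda>)" using \<Lambda> mult_left_mono[of 1 \<Lambda> "real s"] by simp
    finally have "(real n * (real s)\<^sup>2 + real s * \<Lambda>) * \<tau> \<le> 170 * (real s * \<Lambda>) * \<tau>"
      using \<tau> by (intro mult_right_mono) (auto simp: power2_eq_square mult_ac)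
    then show ?thesis using b1 by simp
  qed
  moreover have "1/70000 * \<sigma>\<^sup>2 * (real n * (real s)\<^sup>2 + real s * ln (1 / \<delta>)) / \<epsilon>\<^sup>2
      = (real n * (real s)\<^sup>2 + real s * \<Lambda>) * \<tau> / 70000"
    by (simp add: \<tau>_def \<Lambda>_def mult.commute)
  ultimately show ?thesis by linarith
qed

text \<open>A finite infimum of naturals is attained; if no number of queries suffices it is
  infinite and nothing is to be shown.\<close>

lemma query_complexity_ge:
  assumes "\<And>m. learnable n \<sigma> F \<epsilon> \<delta> m \<Longrightarrow> r \<le> real m"
  shows "ereal r \<le> ereal_of_enat (query_complexity n \<sigma> F \<epsilon> \<delta>)"
proof (cases "query_complexity n \<sigma> F \<epsilon> \<delta>")
  case (enat k)
  define A where "A = enat ` {m. learnable n \<sigma> F \<epsilon> \<delta> m}"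
  have "A \<noteq> {}" using enat by (auto simp: query_complexity_def A_def Inf_enat_def split: if_splits)
  then have "Inf A \<in> A" unfolding Inf_enat_def by (auto intro: LeastI)
  then have "learnable n \<sigma> F \<epsilon> \<delta> k" using enat by (auto simp: query_complexity_def A_def)
  then show ?thesis using assms enat by simp
qed simp

lemma query_complexity_le:
  assumes "learnable n \<sigma> F \<epsilon> \<delta> m"
  shows "ereal_of_enat (query_complexity n \<sigma> F \<epsilon> \<delta>) \<le> ereal (real m)"
proof -
  have "query_complexity n \<sigma> F \<epsilon> \<delta> \<le> enat m"
    unfolding query_complexity_def using assms by (intro Inf_lower) auto
  then show ?thesis by (metis ereal_of_enat_le_iff ereal_of_enat_simps(1))
qed

lemma query_complexity_upper:
  assumes s: "1 \<le> s" "s \<le> n" and \<sigma>: "\<sigma> > 0" and \<epsilon>: "0 < \<epsilon>" "\<epsilon> \<le> 1/4" and \<delta>: "0 < \<delta>" "\<delta> \<le> 1/4"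
  shows "ereal_of_enat (query_complexity n \<sigma> (sparse_class n s) \<epsilon> \<delta>)
    \<le> ereal (129601 * (\<sigma>\<^sup>2 + 1) * (real n * (real s)\<^sup>2 + real s * ln (1 / \<delta>)) / \<epsilon>\<^sup>2)"
proof -
  define \<Lambda> where "\<Lambda> = ln (1 / \<delta>)"
  have \<Lambda>: "\<Lambda> \<ge> 1" using ln_inverse_ge_1[OF \<delta>] by (simp add: \<Lambda>_def)
  define Q where "Q = real n * (real s)\<^sup>2 + real s * \<Lambda>"
  define Y where "Y = (\<sigma>\<^sup>2 + 1) * Q / \<epsilon>\<^sup>2"
  have ns: "real n * (real s)\<^sup>2 \<ge> 1" using s mult_mono[of 1 "real n" 1 "(real s)\<^sup>2"] by auto
  have Q: "Q \<ge> real n * (real s)\<^sup>2" using \<Lambda> by (simp add: Q_def)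
  have e2: "\<epsilon>\<^sup>2 \<le> 1" using \<epsilon> by (simp add: power_le_one)
  have YQ: "Q \<le> Y" "\<sigma>\<^sup>2 * Q / \<epsilon>\<^sup>2 \<le> Y"
  proof -
    have "Q * \<epsilon>\<^sup>2 \<le> (\<sigma>\<^sup>2 + 1) * Q"
    proof -
      have "Q * \<epsilon>\<^sup>2 \<le> Q * 1" using e2 Q ns by (intro mult_left_mono) auto
      also have "\<dots> \<le> (\<sigma>\<^sup>2 + 1) * Q" using Q ns by (simp add: distrib_right)
      finally show ?thesis .
    qed
    then show "Q \<le> Y" using \<epsilon> by (simp add: Y_def field_simps)
    show "\<sigma>\<^sup>2 * Q / \<epsilon>\<^sup>2 \<le> Y" unfolding Y_def using Q ns by (intro divide_right_mono mult_right_mono) auto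
  qed
  \<comment> \<open>\<open>129600 = 4 * 32400\<close> covers the noise requirement and, as
    \<open>\<epsilon> \<le> 1\<close>, also that of the design. Rounding up costs at most
    \<open>1 \<le> Y\<close>, hence the final 129601.\<close>
  define m where "m = nat \<lceil>129600 * Y\<rceil>"
  have Y1: "Y \<ge> 1" using YQ Q ns by linarith
  have m: "129600 * Y \<le> real m" "real m \<le> 129600 * Y + 1"
    using Y1 unfolding m_def by linarith+
  have "learnable n \<sigma> (sparse_class n s) \<epsilon> \<delta> m"
  proof (rule learnable_least_squares[OF s \<sigma> \<epsilon>(1) \<delta>(1)])
    show "512 * real n * (real s)\<^sup>2 \<le> real m" using m YQ Q Y1 by linarith
    have "32400 * real s * \<sigma>\<^sup>2 * (4 * real n * real s + ln (1 / \<delta>)) / \<epsilon>\<^sup>2 \<le> 129600 * (\<sigma>\<^sup>2 * Q / \<epsilon>\<^sup>2)"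
    proof -
      have "32400 * real s * \<sigma>\<^sup>2 * (4 * real n * real s + ln (1 / \<delta>))
          = \<sigma>\<^sup>2 * (129600 * (real n * (real s)\<^sup>2) + 32400 * (real s * \<Lambda>))"
        by (simp add: \<Lambda>_def power2_eq_square algebra_simps)
      also have "\<dots> \<le> \<sigma>\<^sup>2 * (129600 * Q)"
        using \<Lambda> by (intro mult_left_mono) (auto simp: Q_def)
      finally show ?thesis using \<epsilon> by (simp add: divide_right_mono mult_ac)
    qed
    then show "32400 * real s * \<sigma>\<^sup>2 * (4 * real n * real s + ln (1 / \<delta>)) / \<epsilon>\<^sup>2 \<le> real m"
      using m YQ by linarith
  qed
  from query_complexity_le[OF this]
  have "ereal_of_enat (query_complexity n \<sigma> (sparse_class n s) \<epsilon> \<delta>) \<le> ereal (real m)" .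
  also have "\<dots> \<le> ereal (129601 * Y)" using m Y1 by simp
  finally show ?thesis unfolding Y_def Q_def \<Lambda>_def by (simp only: mult.assoc times_divide_eq_right)
qed

theorem theorem4p1:
  "\<exists>c>0. \<exists>C>0. \<exists>\<epsilon>0>0.
     (\<forall>(n::nat) (s::nat) (\<sigma>::real) (\<epsilon>::real) (\<delta>::real).
        1 \<le> s \<and> s \<le> n \<and> 0 < \<sigma> \<and> 0 < \<epsilon> \<and> \<epsilon> \<le> \<epsilon>0 \<and> 0 < \<delta> \<and> \<delta> \<le> 1/4 \<longrightarrow>
        ereal (c * \<sigma>\<^sup>2 * (real n * (real s)\<^sup>2 + real s * ln (1 / \<delta>)) / \<epsilon>\<^sup>2)
          \<le> ereal_of_enat (query_complexity n \<sigma> (sparse_class n s) \<epsilon> \<delta>) \<and>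
        ereal_of_enat (query_complexity n \<sigma> (sparse_class n s) \<epsilon> \<delta>)
          \<le> ereal (C * (\<sigma>\<^sup>2 + 1) * (real n * (real s)\<^sup>2 + real s * ln (1 / \<delta>)) / \<epsilon>\<^sup>2)) \<and>
     (\<forall>\<sigma>0>0. \<exists>c'>0. \<exists>C'>0.
        \<forall>(n::nat) (s::nat) (\<sigma>::real) (\<epsilon>::real) (\<delta>::real).
        1 \<le> s \<and> s \<le> n \<and> \<sigma>0 \<le> \<sigma> \<and> 0 < \<epsilon> \<and> \<epsilon> \<le> \<epsilon>0 \<and> 0 < \<delta> \<and> \<delta> \<le> 1/4 \<longrightarrow>
        ereal (c' * ((\<sigma> / \<epsilon>)\<^sup>2 * (real n * (real s)\<^sup>2 + real s * ln (1 / \<delta>))))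
          \<le> ereal_of_enat (query_complexity n \<sigma> (sparse_class n s) \<epsilon> \<delta>) \<and>
        ereal_of_enat (query_complexity n \<sigma> (sparse_class n s) \<epsilon> \<delta>)
          \<le> ereal (C' * ((\<sigma> / \<epsilon>)\<^sup>2 * (real n * (real s)\<^sup>2 + real s * ln (1 / \<delta>)))))"
proof -
  have lower: "ereal (1/70000 * \<sigma>\<^sup>2 * (real n * (real s)\<^sup>2 + real s * ln (1 / \<delta>)) / \<epsilon>\<^sup>2)
      \<le> ereal_of_enat (query_complexity n \<sigma> (sparse_class n s) \<epsilon> \<delta>)"
    if "1 \<le> s \<and> s \<le> n \<and> 0 < \<sigma> \<and> 0 < \<epsilon> \<and> \<epsilon> \<le> 1/4 \<and> 0 < \<delta> \<and> \<delta> \<le> 1/4" for n s :: nat and \<sigma> \<epsilon> \<delta> :: real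
    using that by (intro query_complexity_ge learnable_imp_queries_ge) auto
  have upper: "ereal_of_enat (query_complexity n \<sigma> (sparse_class n s) \<epsilon> \<delta>)
      \<le> ereal (129601 * (\<sigma>\<^sup>2 + 1) * (real n * (real s)\<^sup>2 + real s * ln (1 / \<delta>)) / \<epsilon>\<^sup>2)"
    if "1 \<le> s \<and> s \<le> n \<and> 0 < \<sigma> \<and> 0 < \<epsilon> \<and> \<epsilon> \<le> 1/4 \<and> 0 < \<delta> \<and> \<delta> \<le> 1/4" for n s :: nat and \<sigma> \<epsilon> \<delta> :: real
    using that by (intro query_complexity_upper) auto
  have theta: "\<exists>c'>0. \<exists>C'>0. \<forall>(n::nat) (s::nat) (\<sigma>::real) (\<epsilon>::real) (\<delta>::real).
        1 \<le> s \<and> s \<le> n \<and> \<sigma>0 \<le> \<sigma> \<and> 0 < \<epsilon> \<and> \<epsilon> \<le> 1/4 \<and> 0 < \<delta> \<and> \<delta> \<le> 1/4 \<longrightarrow>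
        ereal (c' * ((\<sigma> / \<epsilon>)\<^sup>2 * (real n * (real s)\<^sup>2 + real s * ln (1 / \<delta>))))
          \<le> ereal_of_enat (query_complexity n \<sigma> (sparse_class n s) \<epsilon> \<delta>) \<and>
        ereal_of_enat (query_complexity n \<sigma> (sparse_class n s) \<epsilon> \<delta>)
          \<le> ereal (C' * ((\<sigma> / \<epsilon>)\<^sup>2 * (real n * (real s)\<^sup>2 + real s * ln (1 / \<delta>))))"
    if \<sigma>0: "\<sigma>0 > 0" for \<sigma>0 :: real
  proof (rule exI[of _ "1/70000"], intro conjI, simp, rule exI[of _ "129601 * (1 + 1 / \<sigma>0\<^sup>2)"], intro conjI allI impI)
    show "0 < 129601 * (1 + 1 / \<sigma>0\<^sup>2)" using \<sigma>0 by (simp add: add_pos_pos)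
    fix n s :: nat and \<sigma> \<epsilon> \<delta> :: real
    assume A: "1 \<le> s \<and> s \<le> n \<and> \<sigma>0 \<le> \<sigma> \<and> 0 < \<epsilon> \<and> \<epsilon> \<le> 1/4 \<and> 0 < \<delta> \<and> \<delta> \<le> 1/4"
    define Q where "Q = real n * (real s)\<^sup>2 + real s * ln (1 / \<delta>)"
    have B: "1 \<le> s \<and> s \<le> n \<and> 0 < \<sigma> \<and> 0 < \<epsilon> \<and> \<epsilon> \<le> 1/4 \<and> 0 < \<delta> \<and> \<delta> \<le> 1/4" using A \<sigma>0 by auto
    have Q: "Q \<ge> 0" using ln_inverse_ge_1[of \<delta>] A by (simp add: Q_def)
    show "ereal (1/70000 * ((\<sigma> / \<epsilon>)\<^sup>2 * (real n * (real s)\<^sup>2 + real s * ln (1 / \<delta>))))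
          \<le> ereal_of_enat (query_complexity n \<sigma> (sparse_class n s) \<epsilon> \<delta>)"
      using lower[OF B] by (simp add: power_divide)
    \<comment> \<open>A lower bound on the noise level allows the additive \<open>1\<close> to be
      absorbed, at a price depending on \<open>\<sigma>0\<close> only.\<close>
    have "\<sigma>\<^sup>2 + 1 \<le> (1 + 1 / \<sigma>0\<^sup>2) * \<sigma>\<^sup>2"
    proof -
      have "\<sigma>0\<^sup>2 \<le> \<sigma>\<^sup>2" using A \<sigma>0 by (intro power_mono) auto
      then show ?thesis using \<sigma>0 by (simp add: field_simps)
    qed
    then have "(\<sigma>\<^sup>2 + 1) * (Q / \<epsilon>\<^sup>2) \<le> (1 + 1 / \<sigma>0\<^sup>2) * \<sigma>\<^sup>2 * (Q / \<epsilon>\<^sup>2)"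
      using Q by (intro mult_right_mono) auto
    then have "129601 * ((\<sigma>\<^sup>2 + 1) * (Q / \<epsilon>\<^sup>2)) \<le> 129601 * ((1 + 1 / \<sigma>0\<^sup>2) * \<sigma>\<^sup>2 * (Q / \<epsilon>\<^sup>2))"
      by (rule mult_left_mono) simp
    then have "129601 * (\<sigma>\<^sup>2 + 1) * Q / \<epsilon>\<^sup>2 \<le> 129601 * (1 + 1 / \<sigma>0\<^sup>2) * ((\<sigma> / \<epsilon>)\<^sup>2 * Q)"
      by (simp only: power_divide mult.assoc times_divide_eq_right times_divide_eq_left)
    then have "ereal (129601 * (\<sigma>\<^sup>2 + 1) * Q / \<epsilon>\<^sup>2) \<le> ereal (129601 * (1 + 1 / \<sigma>0\<^sup>2) * ((\<sigma> / \<epsilon>)\<^sup>2 * Q))"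
      by (simp only: ereal_less_eq)
    with upper[OF B]
    show "ereal_of_enat (query_complexity n \<sigma> (sparse_class n s) \<epsilon> \<delta>)
          \<le> ereal (129601 * (1 + 1 / \<sigma>0\<^sup>2) * ((\<sigma> / \<epsilon>)\<^sup>2 * (real n * (real s)\<^sup>2 + real s * ln (1 / \<delta>))))"
      unfolding Q_def by (rule order_trans)
  qed
  show ?thesis
  proof (rule exI[of _ "1/70000"], intro conjI, simp, rule exI[of _ 129601], intro conjI, simp,
      rule exI[of _ "1/4"], intro conjI, simp)
    show "\<forall>(n::nat) (s::nat) (\<sigma>::real) (\<epsilon>::real) (\<delta>::real).
        1 \<le> s \<and> s \<le> n \<and> 0 < \<sigma> \<and> 0 < \<epsilon> \<and> \<epsilon> \<le> 1/4 \<and> 0 < \<delta> \<and> \<delta> \<le> 1/4 \<longrightarrow>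
        ereal (1/70000 * \<sigma>\<^sup>2 * (real n * (real s)\<^sup>2 + real s * ln (1 / \<delta>)) / \<epsilon>\<^sup>2)
          \<le> ereal_of_enat (query_complexity n \<sigma> (sparse_class n s) \<epsilon> \<delta>) \<and>
        ereal_of_enat (query_complexity n \<sigma> (sparse_class n s) \<epsilon> \<delta>)
          \<le> ereal (129601 * (\<sigma>\<^sup>2 + 1) * (real n * (real s)\<^sup>2 + real s * ln (1 / \<delta>)) / \<epsilon>\<^sup>2)"
      using lower upper by blast
  qed (use theta in blast)
qed

end
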